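(* Let $F|R$ be an extension of real closed fields, with canonical valuation $v$. (i) Suppose $vR$ is a convex subgroup of $vF$, and let $\tilde\iota:\mathcal C(R)\to\mathcal C(F)$ be any map constructed as follows: for a non-ball cut $C=(D,E)$ of $R$, $\tilde\iota(C)$ is one of $D^{+}_F$ or $E^{-}_F$; if $C$ is the lower edge $B_0^-$ (resp. upper edge $B_0^+$) in $R$ of a ball $B_0\neq R$ of $R$ with ball complement $(D,E)$ in $R$, then $\tilde\iota(C)=D^{+}_F$ (resp. $\tilde\iota(C)=E^{-}_F$); and $\tilde\iota$ sends the cuts $(\emptyset,R)$ and $(R,\emptyset)$ of $R$ to $R^{-}_F$ and $R^{+}_F$ respectively. Then the map $\iota:M(R(y))\to M(F(y))$ given by $\iota(\lambda_{R(y)}(\chi_R(C)))=\lambda_{F(y)}(\chi_F(\tilde\iota(C)))$ for $C\in\mathcal C(R)$ is well defined, does not depend on the choice of $\tilde\iota$, is injective, continuous and compatible with restriction. (ii) Conversely, if $\iota:M(R(y))\to M(F(y))$ is a continuous injective map compatible with restriction, then there is an injective map $\tilde\iota:\mathcal C(R)\to\mathcal C(F)$ which is continuous with respect to the full topologies and compatible with restriction of cuts, such that $\lambda_{F(y)}\circ\chi_F\circ\tilde\iota=\iota\circ\lambda_{R(y)}\circ\chi_R$; moreover, $vR$ is a convex subgroup of $vF$.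
   Context: For a field $K$, $M(K)$ is the set of $\mathbb R$-places $K\to\mathbb R\cup\{\infty\}$, with topology generated by the subbasis $H'(b)=\{\zeta\in M(K)\mid \infty\ne\zeta(b)>0\}$, $b\in K$. For an ordering $P$ of $K$, $\lambda_K(P)\in M(K)$ is the $\mathbb R$-place associated with $P$ (the place of the convex hull of $\mathbb Q$, composed with the order embedding of the residue field into $\mathbb R$). For $L|K$, $\mathrm{res}(\zeta)=\zeta|_K$; $\iota:M(K)\to M(L)$ is compatible with restriction if $\mathrm{res}\circ\iota=\mathrm{id}$. The canonical valuation $v$ of an ordered field has as valuation ring the convex hull of $\mathbb Z$. Cuts: for a totally ordered set $T$, a cut is a pair $(D,E)$ with $D<E$ (every element of $D$ below every element of $E$) and $D\cup E=T$ (the cuts $(\emptyset,T)$, $(T,\emptyset)$ included); $\mathcal C(T)$ is the set of cuts, ordered by $(D_1,E_1)<(D_2,E_2)$ iff $D_1\subsetneq D_2$. For nonempty $A\subseteq T$, $A^+=(D,T\setminus D)$ with $D$ the smallest initial segment containing $A$, and $A^-=(T\setminus E,E)$ with $E$ the smallest final segment containing $A$; for $A\subseteq R\subseteq F$, $A^{+}_F,A^{-}_F$ denote these cuts taken in $F$. The restriction of a cut $(D',E')$ of $F$ to $R$ is $(D'\cap R,E'\cap R)$; $\tilde\iota$ is compatible with restriction if restriction of $\tilde\iota(C)$ is $C$ for all $C$. Balls: for an ordered field $K$ with canonical valuation $v$, $a\in K$ and a final segment $S$ of $vK$ (possibly empty), $B_S(a,K)=\{b\in K\mid v(a-b)\in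 S\cup\{\infty\}\}$; such sets are balls. A ball complement of a ball $B$ of $K$ is a pair $(D,E)$ with $D<B<E$ and $D\cup B\cup E=K$. A cut is a ball cut if it equals $B^+$ or $B^-$ for some ball $B$ (upper/lower edge of $B$), otherwise a non-ball cut. Two cuts are equivalent if they are equal or are the lower and upper edge of the same ball. A subset of $\mathcal C(K)$ is full if closed under equivalence. The interval topology on $\mathcal C(K)$ has basic open sets $(C_1,C_2)$, $(C_1,(K,\emptyset)]$ and $[(\emptyset,K),C_2)$; the full topology consists of the full sets that are open in the interval topology. For real closed $K$, $\chi_K:\mathcal C(K)\to\{\text{orderings of }K(y)\}$ sends $(D,E)$ to the unique ordering $P$ of $K(y)$ with $D=\{d\in K\mid y-d\in P\}$; it is a bijection. *)

theory Defs
  imports "HOL-Analysis.Analysis" "HOL-Computational_Algebra.Polynomial"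
          "HOL-Computational_Algebra.Fraction_Field"
begin

text \<open>A (linearly) ordered field is real closed iff every non-negative element
  is a square and every polynomial of odd degree has a root (Artin--Schreier).
  For a real closed field the ordering is the unique one, so the type-class
  ordering is the ordering of the real closed field.\<close>
definition real_closed :: "'a::linordered_field itself \<Rightarrow> bool" where
  "real_closed _ \<longleftrightarrow>
     (\<forall>x::'a. 0 \<le> x \<longrightarrow> (\<exists>s. s * s = x)) \<and>
     (\<forall>p::'a poly. odd (degree p) \<longrightarrow> (\<exists>x. poly p x = 0))"

text \<open>A field extension F|R is given by a field embedding e : R \<rightarrow> F.\<close>
definition field_hom :: "('a::field \<Rightarrow> 'b::field) \<Rightarrow> bool" where
  "field_hom e \<longleftrightarrow> e 1 = 1 \<and> (\<forall>a b. e (a + b) = e a + e b) \<and> (\<forall>a b. e (a * b) = e a * e b)"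

definition rf_y :: "'a::field poly fract" where
  "rf_y = Fract [:0, 1:] 1"

definition rf_const :: "'a::field \<Rightarrow> 'a poly fract" where
  "rf_const c = Fract [:c:] 1"

definition rf_emb :: "('a::field \<Rightarrow> 'b::field) \<Rightarrow> 'a poly fract \<Rightarrow> 'b poly fract" where
  "rf_emb e x = (THE z. \<exists>p q. q \<noteq> 0 \<and> x = Fract p q \<and> z = Fract (map_poly e p) (map_poly e q))"

definition field_ordering :: "'k::field set \<Rightarrow> bool" where
  "field_ordering P \<longleftrightarrow>
     (\<forall>a\<in>P. \<forall>b\<in>P. a + b \<in> P \<and> a * b \<in> P) \<and>
     P \<union> uminus ` P = UNIV \<and> P \<inter> uminus ` P = {0}"

text \<open>R-places K \<rightarrow> \<real> \<union> {\<infinity>}; None plays the role of \<infinity>.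
  The finite locus O is a valuation ring, the place is a ring homomorphism on O
  with kernel the maximal ideal of O.\<close>
definition R_place :: "('k::field \<Rightarrow> real option) \<Rightarrow> bool" where
  "R_place \<zeta> \<longleftrightarrow>
     (let Ov = {x. \<zeta> x \<noteq> None} in
        0 \<in> Ov \<and> 1 \<in> Ov \<and> (\<forall>a\<in>Ov. \<forall>b\<in>Ov. a + b \<in> Ov \<and> a * b \<in> Ov \<and> - a \<in> Ov) \<and>
        (\<forall>x. x \<noteq> 0 \<longrightarrow> x \<notin> Ov \<longrightarrow> inverse x \<in> Ov) \<and>
        the (\<zeta> 1) = 1 \<and>
        (\<forall>a\<in>Ov. \<forall>b\<in>Ov. the (\<zeta> (a + b)) = the (\<zeta> a) + the (\<zeta> b) \<and>
                         the (\<zeta> (a * b)) = the (\<zeta> a) * the (\<zeta> b)) \<and>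
        (\<forall>x\<in>Ov. the (\<zeta> x) = 0 \<longleftrightarrow> (x = 0 \<or> inverse x \<notin> Ov)))"

definition places :: "('k::field \<Rightarrow> real option) set" where
  "places = {\<zeta>. R_place \<zeta>}"

definition H' :: "'k::field \<Rightarrow> ('k \<Rightarrow> real option) set" where
  "H' b = {\<zeta> \<in> places. \<zeta> b \<noteq> None \<and> the (\<zeta> b) > 0}"

definition places_top :: "('k::field \<Rightarrow> real option) topology" where
  "places_top = topology_generated_by (range H')"

definition res :: "('a::field \<Rightarrow> 'b::field) \<Rightarrow> ('b poly fract \<Rightarrow> real option) \<Rightarrow> ('a poly fract \<Rightarrow> real option)" where
  "res e \<zeta> = \<zeta> \<circ> rf_emb e"

text \<open>\<lambda>_K(P): the place of the convex hull of \<rat> (w.r.t. P), composed with the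
  order embedding of the residue field into \<real>.\<close>
definition lam :: "'k::field set \<Rightarrow> 'k \<Rightarrow> real option" where
  "lam P x = (if \<exists>n::nat. of_nat n - x \<in> P \<and> of_nat n + x \<in> P
              then Some (Sup {real_of_int m / real n | m n. 0 < n \<and> of_nat n * x - of_int m \<in> P})
              else None)"

definition cuts :: "('a::linorder set \<times> 'a set) set" where
  "cuts = {(D, E). (\<forall>d\<in>D. \<forall>x\<in>E. d < x) \<and> D \<union> E = UNIV}"

definition cut_less :: "('a::linorder set \<times> 'a set) \<Rightarrow> ('a set \<times> 'a set) \<Rightarrow> bool" where
  "cut_less C1 C2 \<longleftrightarrow> fst C1 \<subset> fst C2"

text \<open>A^+ and A^- (A nonempty in the paper)\<close>
definition upper_cut :: "'a::linorder set \<Rightarrow> 'a set \<times> 'a set" where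
  "upper_cut A = ({t. \<exists>a\<in>A. t \<le> a}, - {t. \<exists>a\<in>A. t \<le> a})"

definition lower_cut :: "'a::linorder set \<Rightarrow> 'a set \<times> 'a set" where
  "lower_cut A = (- {t. \<exists>a\<in>A. a \<le> t}, {t. \<exists>a\<in>A. a \<le> t})"

definition restrict_cut :: "('a \<Rightarrow> 'b) \<Rightarrow> 'b set \<times> 'b set \<Rightarrow> 'a set \<times> 'a set" where
  "restrict_cut e C = (e -` fst C, e -` snd C)"

definition chi :: "'a::linordered_field set \<times> 'a set \<Rightarrow> 'a poly fract set" where
  "chi C = (THE P. field_ordering P \<and> fst C = {d. rf_y - rf_const d \<in> P})"

definition cval_ring :: "'a::linordered_field set" where
  "cval_ring = {x. \<exists>n::nat. \<bar>x\<bar> \<le> of_nat n}"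

definition cval_units :: "'a::linordered_field set" where
  "cval_units = {u \<in> cval_ring. u \<noteq> 0 \<and> inverse u \<in> cval_ring}"

text \<open>v(x) = x O^\<times> \<in> K^\<times>/O^\<times> for x \<noteq> 0 (v(0) = \<infinity> is treated separately).\<close>
definition cval :: "'a::linordered_field \<Rightarrow> 'a set" where
  "cval x = {x * u | u. u \<in> cval_units}"

definition value_group :: "'a::linordered_field set set" where
  "value_group = {cval x | x. x \<noteq> 0}"

definition val_le :: "'a::linordered_field set \<Rightarrow> 'a set \<Rightarrow> bool" where
  "val_le g h \<longleftrightarrow> (\<exists>x\<in>g. \<exists>y\<in>h. x \<noteq> 0 \<and> y / x \<in> cval_ring)"

definition final_segment :: "'a::linordered_field set set \<Rightarrow> bool" where
  "final_segment S \<longleftrightarrow> S \<subseteq> value_group \<and> (\<forall>g\<in>S. \<forall>h\<in>value_group. val_le g h \<longrightarrow> h \<in> S)"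

definition ballS :: "'a::linordered_field set set \<Rightarrow> 'a \<Rightarrow> 'a set" where
  "ballS S a = {b. a = b \<or> cval (a - b) \<in> S}"

definition is_ball :: "'a::linordered_field set \<Rightarrow> bool" where
  "is_ball B \<longleftrightarrow> (\<exists>S a. final_segment S \<and> B = ballS S a)"

definition ball_complement :: "'a::linordered_field set \<Rightarrow> 'a set \<Rightarrow> 'a set \<Rightarrow> bool" where
  "ball_complement B D E \<longleftrightarrow>
     (\<forall>d\<in>D. \<forall>b\<in>B. d < b) \<and> (\<forall>b\<in>B. \<forall>x\<in>E. b < x) \<and> D \<union> B \<union> E = UNIV"

definition ball_cut :: "'a::linordered_field set \<times> 'a set \<Rightarrow> bool" where
  "ball_cut C \<longleftrightarrow> (\<exists>B. is_ball B \<and> (C = upper_cut B \<or> C = lower_cut B))"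

definition cut_equiv :: "'a::linordered_field set \<times> 'a set \<Rightarrow> 'a set \<times> 'a set \<Rightarrow> bool" where
  "cut_equiv C1 C2 \<longleftrightarrow> C1 = C2 \<or>
     (\<exists>B. is_ball B \<and> ((C1 = lower_cut B \<and> C2 = upper_cut B) \<or> (C1 = upper_cut B \<and> C2 = lower_cut B)))"

definition full :: "('a::linordered_field set \<times> 'a set) set \<Rightarrow> bool" where
  "full U \<longleftrightarrow> U \<subseteq> cuts \<and> (\<forall>C1\<in>U. \<forall>C2\<in>cuts. cut_equiv C1 C2 \<longrightarrow> C2 \<in> U)"

definition interval_topology :: "('a::linorder set \<times> 'a set) topology" where
  "interval_topology = topology_generated_by
     ({{C \<in> cuts. cut_less C1 C \<and> cut_less C C2} | C1 C2. C1 \<in> cuts \<and> C2 \<in> cuts} \<union>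
      {{C \<in> cuts. cut_less C1 C} | C1. C1 \<in> cuts} \<union>
      {{C \<in> cuts. cut_less C C2} | C2. C2 \<in> cuts})"

definition full_topology :: "('a::linordered_field set \<times> 'a set) topology" where
  "full_topology = topology_generated_by {U. openin interval_topology U \<and> full U}"

definition value_group_image :: "('a::linordered_field \<Rightarrow> 'b::linordered_field) \<Rightarrow> 'b set set" where
  "value_group_image e = {cval (e x) | x. x \<noteq> 0}"

definition convex_subgroup :: "'b::linordered_field set set \<Rightarrow> bool" where
  "convex_subgroup H \<longleftrightarrow> H \<subseteq> value_group \<and> cval 1 \<in> H \<and>
     (\<forall>x y. x \<noteq> 0 \<longrightarrow> y \<noteq> 0 \<longrightarrow> cval x \<in> H \<longrightarrow> cval y \<in> H \<longrightarrow>
            cval (x * y) \<in> H \<and> cval (inverse x) \<in> H) \<and>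
     (\<forall>g\<in>value_group. \<forall>h1\<in>H. \<forall>h2\<in>H. val_le h1 g \<and> val_le g h2 \<longrightarrow> g \<in> H)"

definition admissible_cut_map ::
  "('a::linordered_field \<Rightarrow> 'b::linordered_field) \<Rightarrow> ('a set \<times> 'a set \<Rightarrow> 'b set \<times> 'b set) \<Rightarrow> bool" where
  "admissible_cut_map e \<tau> \<longleftrightarrow>
     \<tau> \<in> cuts \<rightarrow> cuts \<and>
     (\<forall>C\<in>cuts. \<not> ball_cut C \<longrightarrow>
        \<tau> C = upper_cut (e ` fst C) \<or> \<tau> C = lower_cut (e ` snd C)) \<and>
     (\<forall>B0 D E. is_ball B0 \<and> B0 \<noteq> UNIV \<and> ball_complement B0 D E \<longrightarrow>
        \<tau> (lower_cut B0) = upper_cut (e ` D) \<and> \<tau> (upper_cut B0) = lower_cut (e ` E)) \<and>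
     \<tau> ({}, UNIV) = lower_cut (range e) \<and>
     \<tau> (UNIV, {}) = upper_cut (range e)"

end

theory Submission
  imports "HOL-Algebra.Algebraic_Closure_Type" Defs
begin

text \<open>
  Over a real closed field \<open>K\<close> polynomials factor into linear and sums-of-two-squares factors, so orderings of
  \<open>K(y)\<close> correspond to cuts of \<open>K\<close>. Two cuts induce the same place iff the set of elements between them is empty or
  a ball, and balls are exactly the nonempty convex sets closed under the reflections \<open>(a, b) \<mapsto> 2 b - a\<close>: if \<open>a\<close> and \<open>b\<close>
  lie between the cuts but \<open>2 b - a\<close> does not, then \<open>(y - a) / (b - a)\<close> separates the two places; at the edges of a
  ball around \<open>a\<close> every rational function is, up to a factor infinitely close to \<open>1\<close>, a monomial in \<open>y - a\<close>. The
  space of cuts is compact and the space of places is Hausdorff, hence the latter carries the quotient topology.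

  A cut \<open>(D, E)\<close> of \<open>R\<close> has a smallest and a largest extension to \<open>F\<close>, namely \<open>D\<^sup>+\<close> and \<open>E\<^sup>-\<close>. Either \<open>D\<close> has no last
  element or \<open>E\<close> has no first element. A continuous section of the restriction must send the place of the cut to
  the place of \<open>D\<^sup>+\<close> in the former case and of \<open>E\<^sup>-\<close> in the latter. If neither extremum exists,
  the gap between the two extensions is therefore empty or a ball; this holds for all cuts iff \<open>vR\<close> is convex in \<open>vF\<close>.
\<close>

section \<open>Roots of polynomials over real closed fields\<close>

text \<open>The definition of real closed offers only square roots and roots of polynomials of odd
  degree, so no intermediate value theorem is at hand. The factorization replaces it: each statement
  on signs or on approximation of rational functions is proved for a single factor and then
  multiplied up. On the side of cuts the obstacle is that a canonical choice of extensions need not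
  be continuous for the interval topologies. At a cut with neither extremum it may take the smallest
  extension, while its values at larger cuts stay above the largest one. Only for places can this
  jump disappear. Hence continuity is examined on the two sides of a cut separately and then
  descends to places through the quotient map. Injectivity of the maps constructed is automatic,
  because restriction is a left inverse. Singleton balls link the prescription for ball cuts with
  continuity: a cut whose lower side has a last element, or whose upper side has a first one, is an
  edge of such a ball.\<close>

lemma sum_list_in_range_to_ac:
  "(\<And>x. x \<in> set xs \<Longrightarrow> f x \<in> range to_ac) \<Longrightarrow> sum_list (map f xs) \<in> range (to_ac :: 'a::field \<Rightarrow> _)"
proof (induction xs)
  case Nil
  then show ?case by (metis list.map(1) range_eqI sum_list.Nil to_ac_0)
next
  case (Cons x xs)
  then obtain a b where "f x = to_ac a" "sum_list (map f xs) = to_ac b" by fastforce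
  then show ?case by (metis list.map(2) rangeI sum_list.Cons to_ac_add)
qed

lemma range_to_ac_closed:
  assumes "a \<in> range to_ac" "b \<in> range to_ac"
  shows "a + b \<in> range to_ac" "a - b \<in> range to_ac" "a * b \<in> range to_ac" "a / b \<in> range to_ac"
  using assms by (auto simp flip: to_ac_add to_ac_diff to_ac_mult to_ac_divide)

lemma range_to_ac_closed':
  assumes "a \<in> range to_ac"
  shows "- a \<in> range to_ac" "a ^ n \<in> range to_ac"
  using assms by (auto simp flip: to_ac_minus to_ac_power)

lemma sum_in_range_to_ac:
  "(\<And>x. x \<in> A \<Longrightarrow> f x \<in> range to_ac) \<Longrightarrow> sum f A \<in> range (to_ac :: 'a::field \<Rightarrow> _)"
proof (induction A rule: infinite_finite_induct)
  case (insert x F)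
  then show ?case by (simp add: range_to_ac_closed)
qed (metis range_eqI sum.infinite to_ac_0, metis range_eqI sum.empty to_ac_0)

lemma of_nat_in_range_to_ac: "of_nat n \<in> range (to_ac :: 'a::field \<Rightarrow> _)"
  by (metis rangeI to_ac_of_nat)

lemma one_zero_in_range_to_ac: "1 \<in> range (to_ac :: 'a::field \<Rightarrow> _)" "0 \<in> range (to_ac :: 'a::field \<Rightarrow> _)"
  by (metis rangeI to_ac_1, metis rangeI to_ac_0)

section \<open>Newton's identities over a base field inside its algebraic closure\<close>

abbreviation power_sum :: "'a::comm_ring_1 list \<Rightarrow> nat \<Rightarrow> 'a" where
  "power_sum xs m \<equiv> (\<Sum>x\<leftarrow>xs. x ^ m)"

text \<open>The factors are reversed so that the constant term is 1 and the coefficient of index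
  \<open>k\<close> is the signed elementary symmetric function of degree \<open>k\<close>.\<close>

definition rev_roots_fps :: "'a::comm_ring_1 list \<Rightarrow> 'a fps" where
  "rev_roots_fps xs = (\<Prod>x\<leftarrow>xs. 1 - fps_const x * fps_X)"

text \<open>The sum of the geometric series \<open>x T / (1 - x T)\<close>. These have no constant
  term, which is why the coefficient of index \<open>0\<close> is not
  \<open>power_sum xs 0\<close>.\<close>

definition power_sum_fps :: "'a::comm_ring_1 list \<Rightarrow> 'a fps" where
  "power_sum_fps xs = Abs_fps (\<lambda>m. if m = 0 then 0 else power_sum xs m)"

text \<open>Up to sign this is the logarithmic derivative, multiplied out to avoid division. It
  turns the product over the roots into a sum, so the induction peels off one factor, whose
  contribution is the geometric series in \<open>geo\<close>.\<close>

lemma newton_fps: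
  "fps_X * fps_deriv (rev_roots_fps xs) = - rev_roots_fps xs * power_sum_fps (xs :: 'a::comm_ring_1 list)"
proof (induction xs)
  case Nil
  show ?case by (simp add: rev_roots_fps_def power_sum_fps_def fps_eq_iff)
next
  case (Cons x xs)
  let ?l = "1 - fps_const x * fps_X" and ?Q = "rev_roots_fps xs" and ?S = "power_sum_fps xs"
  have split: "power_sum_fps (x # xs) = power_sum_fps [x] + ?S"
    by (simp add: power_sum_fps_def fps_eq_iff)
  have geo: "?l * power_sum_fps [x] = fps_const x * fps_X"
    by (rule fps_ext) (auto simp: power_sum_fps_def algebra_simps le_Suc_eq simp flip: power_Suc split: nat.splits)
  have Q: "rev_roots_fps (x # xs) = ?l * ?Q"
    by (simp add: rev_roots_fps_def)
  have "fps_X * fps_deriv (rev_roots_fps (x # xs)) = - (fps_const x * fps_X) * ?Q + ?l * (fps_X * fps_deriv ?Q)"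
    unfolding Q by (simp add: algebra_simps)
  also have "\<dots> = - (?l * power_sum_fps [x]) * ?Q + ?l * (- ?Q * ?S)"
    unfolding Cons.IH geo ..
  also have "\<dots> = - rev_roots_fps (x # xs) * power_sum_fps (x # xs)"
    unfolding Q split by (simp add: algebra_simps)
  finally show ?case .
qed

lemma rev_roots_fps_0: "fps_nth (rev_roots_fps xs) 0 = (1::'a::comm_ring_1)"
  by (induction xs) (auto simp: rev_roots_fps_def)

lemma newton_identity:
  "of_nat k * fps_nth (rev_roots_fps xs) k =
    - (\<Sum>i<k. fps_nth (rev_roots_fps xs) i * power_sum xs (k - i) :: 'a::comm_ring_1)"
proof (cases k)
  case (Suc m)
  have "fps_nth (fps_X * fps_deriv (rev_roots_fps xs)) k = of_nat k * fps_nth (rev_roots_fps xs) k"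
    by (simp add: Suc)
  moreover have "fps_nth (- rev_roots_fps xs * power_sum_fps xs) k =
      - (\<Sum>i=0..k. fps_nth (rev_roots_fps xs) i * fps_nth (power_sum_fps xs) (k - i))"
    by (simp add: fps_mult_nth sum_negf)
  moreover have "(\<Sum>i=0..k. fps_nth (rev_roots_fps xs) i * fps_nth (power_sum_fps xs) (k - i)) =
     (\<Sum>i<k. fps_nth (rev_roots_fps xs) i * power_sum xs (k - i))"
    by (rule sum.mono_neutral_cong_right) (auto simp: power_sum_fps_def)
  ultimately show ?thesis by (simp add: newton_fps)
qed simp

text \<open>For positive \<open>m\<close> the term \<open>i = 0\<close> of the Newton identity is
  the power sum itself with coefficient 1, so the recursion determines it without division.\<close>

lemma power_sum_in_base:
  assumes "\<And>k. fps_nth (rev_roots_fps xs) k \<in> range (to_ac :: 'a::field \<Rightarrow> _)"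
  shows "power_sum xs m \<in> range to_ac"
proof (induction m rule: less_induct)
  case (less m)
  show ?case
  proof (cases m)
    case 0
    then show ?thesis by (auto intro!: sum_list_in_range_to_ac one_zero_in_range_to_ac)
  next
    case (Suc n)
    let ?q = "fps_nth (rev_roots_fps xs)"
    have "of_nat m * ?q m = - (\<Sum>i<Suc n. ?q i * power_sum xs (m - i))"
      unfolding newton_identity Suc ..
    also have "\<dots> = - (power_sum xs m + (\<Sum>i<n. ?q (Suc i) * power_sum xs (m - Suc i)))"
      unfolding sum.lessThan_Suc_shift by (simp add: rev_roots_fps_0)
    finally have "power_sum xs m = - (of_nat m * ?q m) - (\<Sum>i<n. ?q (Suc i) * power_sum xs (m - Suc i))"
      by (metis (no_types) add_diff_cancel_right' minus_minus)
    moreover have "(\<Sum>i<n. ?q (Suc i) * power_sum xs (m - Suc i)) \<in> range to_ac"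
      using less by (intro sum_in_range_to_ac range_to_ac_closed assms) (auto simp: Suc)
    ultimately show ?thesis
      by (simp add: range_to_ac_closed range_to_ac_closed' assms of_nat_in_range_to_ac)
  qed
qed

text \<open>Here the Newton identity is solved for the coefficient instead, which divides by
  \<open>k\<close>; this is where characteristic zero enters.\<close>

lemma rev_roots_fps_in_base:
  assumes "\<And>m. power_sum xs m \<in> range (to_ac :: 'a::field_char_0 \<Rightarrow> _)"
  shows "fps_nth (rev_roots_fps xs) k \<in> range to_ac"
proof (induction k rule: less_induct)
  case (less k)
  show ?case
  proof (cases "k = 0")
    case True
    then show ?thesis by (simp add: rev_roots_fps_0 one_zero_in_range_to_ac)
  next
    case False
    then have "fps_nth (rev_roots_fps xs) k =
        - (\<Sum>i<k. fps_nth (rev_roots_fps xs) i * power_sum xs (k - i)) / of_nat k"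
      by (simp flip: newton_identity)
    also have "\<dots> \<in> range to_ac"
      using less assms by (intro range_to_ac_closed(3,4) range_to_ac_closed' sum_in_range_to_ac of_nat_in_range_to_ac) auto
    finally show ?thesis .
  qed
qed

section \<open>From roots to coefficients, and sums over pairs of roots\<close>

definition roots_poly :: "'a::comm_ring_1 list \<Rightarrow> 'a poly" where
  "roots_poly xs = (\<Prod>x\<leftarrow>xs. [:-x, 1:])"

lemma degree_roots_poly: "degree (roots_poly xs) = length (xs :: 'a::idom list)"
proof (induction xs)
  case (Cons x xs)
  have "roots_poly xs \<noteq> 0" by (auto simp: roots_poly_def prod_list_zero_iff)
  then show ?case using Cons
    by (simp add: roots_poly_def degree_mult_eq del: mult_pCons_left)
qed (simp add: roots_poly_def)

lemma poly_roots_poly: "poly (roots_poly xs) z = (\<Prod>x\<leftarrow>xs. z - (x::'a::comm_ring_1))"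
  by (induction xs) (auto simp: roots_poly_def algebra_simps)

lemma rev_roots_fps_eq: "rev_roots_fps xs = fps_of_poly (reflect_poly (roots_poly (xs :: 'a::idom list)))"
proof (induction xs)
  case (Cons x xs)
  have "reflect_poly [:-x, 1:] = [:1, -x:]"
    by (cases "x = 0") (simp_all add: reflect_poly_def)
  then have "reflect_poly (roots_poly (x # xs)) = [:1, -x:] * reflect_poly (roots_poly xs)"
    by (simp add: roots_poly_def reflect_poly_mult del: mult_pCons_left)
  moreover have "fps_of_poly [:1, -x:] = 1 - fps_const x * fps_X"
    by (simp add: fps_of_poly_pCons mult.commute)
  ultimately show ?case
    using Cons by (simp only: rev_roots_fps_def list.map prod_list.Cons fps_of_poly_mult)
qed (simp add: rev_roots_fps_def roots_poly_def)

lemma rev_roots_fps_coeff: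
  "fps_nth (rev_roots_fps xs) k = (if k \<le> length xs then coeff (roots_poly xs) (length xs - k) else (0::'a::idom))"
  by (simp add: rev_roots_fps_eq coeff_reflect_poly degree_roots_poly)

text \<open>Pairs are pairs of positions, not of values: repeated roots keep their multiplicity, and
  a list of length \<open>n\<close> always gives \<open>n (n - 1) / 2\<close> entries.\<close>

fun pair_map :: "('a \<Rightarrow> 'a \<Rightarrow> 'b) \<Rightarrow> 'a list \<Rightarrow> 'b list" where
  "pair_map g [] = []"
| "pair_map g (x # xs) = map (g x) xs @ pair_map g xs"

lemma length_pair_map: "2 * length (pair_map g xs) = length xs * (length xs - 1)"
proof (induction xs)
  case (Cons x xs)
  then show ?case by (cases xs) (simp_all add: algebra_simps)
qed simp

lemma set_pair_map: "z \<in> set (pair_map g xs) \<Longrightarrow> \<exists>a\<in>set xs. \<exists>b\<in>set xs. z = g a b"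
  by (induction xs) auto

text \<open>The unrestricted double sum is the one that factors into power sums. By symmetry of
  \<open>h\<close> it counts each pair twice, so the sum over pairs is recovered by removing the
  diagonal and halving.\<close>

lemma sum_pair_map:
  fixes h :: "'a \<Rightarrow> 'a \<Rightarrow> 'b::comm_ring_1"
  assumes "\<And>a b. h a b = h b a"
  shows "(\<Sum>a\<leftarrow>xs. \<Sum>b\<leftarrow>xs. h a b) = 2 * sum_list (pair_map h xs) + (\<Sum>a\<leftarrow>xs. h a a)"
proof (induction xs)
  case (Cons x xs)
  have "(\<Sum>a\<leftarrow>xs. h a x) = (\<Sum>a\<leftarrow>xs. h x a)" using assms by simp
  then show ?case using Cons by (simp add: sum_list_addf algebra_simps)
qed simp

lemma map_pair_map: "map f (pair_map g xs) = pair_map (\<lambda>a b. f (g a b)) xs"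
  by (induction xs) auto

text \<open>Grouping the base as \<open>b (t a + 1) + a\<close> reduces the expansion to two nested
  binomial ones and leaves only monomials in \<open>a\<close> and \<open>b\<close>, whose sums over
  all roots are products of power sums.\<close>

lemma pair_power_expand:
  "(a + b + t * a * b) ^ m =
    (\<Sum>k\<le>m. \<Sum>l\<le>k. of_nat (m choose k) * of_nat (k choose l) * t ^ l * (a ^ (m - k + l) * (b ^ k :: 'a::comm_ring_1)))"
proof -
  have "(a + b + t * a * b) ^ m = (b * (t * a + 1) + a) ^ m" by (simp add: algebra_simps)
  also have "\<dots> = (\<Sum>k\<le>m. of_nat (m choose k) * (b * (t * a + 1)) ^ k * a ^ (m - k))"
    by (rule binomial_ring)
  also have "\<dots> = (\<Sum>k\<le>m. of_nat (m choose k) * (b ^ k * (\<Sum>l\<le>k. of_nat (k choose l) * (t * a) ^ l)) * a ^ (m - k))"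
    by (simp add: power_mult_distrib binomial_ring)
  also have "\<dots> = (\<Sum>k\<le>m. \<Sum>l\<le>k. of_nat (m choose k) * of_nat (k choose l) * t ^ l * (a ^ (m - k + l) * b ^ k))"
    by (simp only: sum_distrib_left sum_distrib_right power_mult_distrib power_add
        mult.assoc mult.commute mult.left_commute)
  finally show ?thesis .
qed

lemma sum_list_sum_swap: "(\<Sum>x\<leftarrow>xs. \<Sum>k\<in>A. f x k) = (\<Sum>k\<in>A. \<Sum>x\<leftarrow>xs. f x k :: 'b::comm_monoid_add)"
  by (induction xs) (auto simp: sum.distrib)

text \<open>This takes the place of the fundamental theorem on symmetric polynomials: the full
  double sum and the diagonal are both polynomials in the power sums of \<open>xs\<close>, and half
  their difference is the sum over pairs.\<close>

lemma power_sum_pairs_in_base: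
  assumes ps: "\<And>m. power_sum xs m \<in> range (to_ac :: 'a::field_char_0 \<Rightarrow> _)" and t: "t \<in> range to_ac"
  shows "power_sum (pair_map (\<lambda>a b. a + b + t * a * b) xs) m \<in> range to_ac"
proof -
  let ?h = "\<lambda>a b. (a + b + t * a * b) ^ m"
  let ?c = "\<lambda>k l. of_nat (m choose k) * of_nat (k choose l) * t ^ l"
  have c: "?c k l \<in> range to_ac" for k l
    by (intro range_to_ac_closed(3) range_to_ac_closed'(2) of_nat_in_range_to_ac t)
  have prod: "(\<Sum>a\<leftarrow>xs. \<Sum>b\<leftarrow>xs. c * (a ^ i * b ^ j)) = c * (power_sum xs i * power_sum xs j)" for c i j
    by (simp add: sum_list_const_mult sum_list_mult_const mult.assoc)
  have "(\<Sum>a\<leftarrow>xs. \<Sum>b\<leftarrow>xs. ?h a b) =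
      (\<Sum>k\<le>m. \<Sum>l\<le>k. ?c k l * (power_sum xs (m - k + l) * power_sum xs k))"
    unfolding pair_power_expand sum_list_sum_swap prod ..
  also have "\<dots> \<in> range to_ac"
    by (intro sum_in_range_to_ac range_to_ac_closed(3) c ps)
  finally have A: "(\<Sum>a\<leftarrow>xs. \<Sum>b\<leftarrow>xs. ?h a b) \<in> range to_ac" .
  have "(\<Sum>a\<leftarrow>xs. ?h a a) = (\<Sum>k\<le>m. \<Sum>l\<le>k. ?c k l * power_sum xs (m - k + l + k))"
    unfolding pair_power_expand sum_list_sum_swap
    by (simp only: sum_list_const_mult power_add[symmetric])
  also have "\<dots> \<in> range to_ac"
    by (intro sum_in_range_to_ac range_to_ac_closed(3) c ps)
  finally have B: "(\<Sum>a\<leftarrow>xs. ?h a a) \<in> range to_ac" .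
  have "sum_list (pair_map ?h xs) = ((\<Sum>a\<leftarrow>xs. \<Sum>b\<leftarrow>xs. ?h a b) - (\<Sum>a\<leftarrow>xs. ?h a a)) / of_nat 2"
    by (subst sum_pair_map) (auto simp: algebra_simps)
  also have "\<dots> \<in> range to_ac"
    by (intro range_to_ac_closed(2,4) A B of_nat_in_range_to_ac)
  finally show ?thesis by (simp add: map_pair_map)
qed


section \<open>Adjoining a square root of -1 to a real closed field\<close>

definition ac_i :: "'a::field alg_closure" where
  "ac_i = (SOME i. i ^ 2 = -1)"

lemma ac_i_squared: "(ac_i :: 'a::field alg_closure) * ac_i = -1"
  using someI_ex[OF nth_root_exists[of 2 "-1 :: 'a alg_closure"]]
  by (simp add: ac_i_def power2_eq_square)

definition ac_complex :: "'a::field alg_closure set" where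
  "ac_complex = {to_ac a + ac_i * to_ac b | a b. True}"

lemma ac_complexE:
  assumes "z \<in> ac_complex" obtains a b where "z = to_ac a + ac_i * to_ac b"
  using assms unfolding ac_complex_def by blast

lemma ac_complexI: "to_ac a + ac_i * to_ac b \<in> ac_complex"
  unfolding ac_complex_def by blast

lemma to_ac_in_ac_complex: "to_ac a \<in> ac_complex"
  using ac_complexI[of a 0] by simp

lemma ac_complex_closed:
  assumes "z \<in> ac_complex" "w \<in> ac_complex"
  shows "z + w \<in> ac_complex" "z - w \<in> ac_complex" "z * w \<in> ac_complex"
proof -
  obtain a b where z: "z = to_ac a + ac_i * to_ac b" using assms(1) by (rule ac_complexE)
  obtain c d where w: "w = to_ac c + ac_i * to_ac d" using assms(2) by (rule ac_complexE)
  have "z + w = to_ac (a + c) + ac_i * to_ac (b + d)" by (simp add: z w algebra_simps)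
  then show "z + w \<in> ac_complex" using ac_complexI by metis
  have "z - w = to_ac (a - c) + ac_i * to_ac (b - d)" by (simp add: z w algebra_simps)
  then show "z - w \<in> ac_complex" using ac_complexI by metis
  have "z * w = to_ac a * to_ac c + (ac_i * ac_i) * (to_ac b * to_ac d) + ac_i * (to_ac a * to_ac d + to_ac b * to_ac c)"
    by (simp add: z w algebra_simps)
  also have "\<dots> = to_ac (a * c - b * d) + ac_i * to_ac (a * d + b * c)"
    by (simp add: ac_i_squared)
  finally show "z * w \<in> ac_complex" using ac_complexI by metis
qed

lemma real_closedD:
  assumes "real_closed TYPE('a::linordered_field)"
  shows "0 \<le> (x::'a) \<Longrightarrow> \<exists>s\<ge>0. s * s = x" "odd (degree (p :: 'a poly)) \<Longrightarrow> \<exists>x. poly p x = 0"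
proof -
  assume "0 \<le> x"
  then obtain s where "s * s = x" using assms unfolding real_closed_def by blast
  then have "\<bar>s\<bar> * \<bar>s\<bar> = x" by simp
  then show "\<exists>s\<ge>0. s * s = x" using abs_ge_zero by blast
qed (use assms in \<open>auto simp: real_closed_def\<close>)

text \<open>The half-angle formulas: with \<open>r\<close> the modulus of \<open>z\<close>, the
  squares of the real and imaginary parts of a root are \<open>(r + a) / 2\<close> and
  \<open>(r - a) / 2\<close>. These determine their product up to sign only, so \<open>v\<close> may
  have to be replaced by \<open>- v\<close> to match \<open>b\<close>.\<close>

lemma ac_complex_sqrt:
  assumes rc: "real_closed TYPE('a::linordered_field)" and z: "(z :: 'a alg_closure) \<in> ac_complex"
  shows "\<exists>w\<in>ac_complex. w * w = z"
proof -
  obtain a b where z: "z = to_ac a + ac_i * to_ac b" using z by (rule ac_complexE)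
  obtain r where r: "r \<ge> 0" "r * r = a * a + b * b"
    using real_closedD(1)[OF rc, of "a * a + b * b"] by auto
  have "a * a \<le> r * r" using r by simp
  then have ar: "\<bar>a\<bar> \<le> r"
    using r(1) abs_le_square_iff[of a r] by (simp add: power2_eq_square)
  have "0 \<le> (r + a) / 2" "0 \<le> (r - a) / 2" using ar by auto
  then obtain u v where u: "u \<ge> 0" "u * u = (r + a) / 2" and v: "v \<ge> 0" "v * v = (r - a) / 2"
    using real_closedD(1)[OF rc] by meson
  have "(2 * (u * v)) * (2 * (u * v)) = 4 * (u * u) * (v * v)" by (simp add: algebra_simps)
  also have "\<dots> = r * r - a * a" unfolding u v by (simp add: field_simps)
  also have "\<dots> = b * b" using r by simp
  finally have "2 * (u * v) = b \<or> 2 * (u * v) = - b"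
    by (metis square_eq_iff)
  then obtain v' where v': "v' * v' = v * v" "2 * (u * v') = b"
    by (metis minus_minus minus_mult_minus mult_minus_right)
  have diff: "u * u - v' * v' = a" unfolding v' u v by (simp add: field_simps)
  have "(to_ac u + ac_i * to_ac v') * (to_ac u + ac_i * to_ac v') =
      to_ac u * to_ac u + (ac_i * ac_i) * (to_ac v' * to_ac v') + ac_i * (2 * (to_ac u * to_ac v'))"
    by (simp add: algebra_simps)
  also have "\<dots> = to_ac (u * u - v' * v') + ac_i * to_ac (2 * (u * v'))"
    by (simp add: ac_i_squared)
  also have "\<dots> = z" by (simp only: diff v'(2) z)
  finally show ?thesis using ac_complexI by blast
qed

text \<open>The square root \<open>w\<close> of the discriminant is \<open>x - y\<close> up to sign,
  and \<open>x\<close> is half of \<open>(x + y) + (x - y)\<close>.\<close>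

lemma ac_complex_vieta:
  assumes rc: "real_closed TYPE('a::linordered_field)"
    and s: "x + y \<in> ac_complex" and p: "x * y \<in> (ac_complex :: 'a alg_closure set)"
  shows "x \<in> ac_complex"
proof -
  have "(x + y) * (x + y) - to_ac 4 * (x * y) \<in> ac_complex"
    by (intro ac_complex_closed s p to_ac_in_ac_complex)
  then obtain w where w: "w \<in> ac_complex" "w * w = (x + y) * (x + y) - to_ac 4 * (x * y)"
    using ac_complex_sqrt[OF rc] by blast
  have "w * w = (x - y) * (x - y)" unfolding w(2) by (simp add: algebra_simps)
  then have "w = x - y \<or> w = - (x - y)" by (simp add: square_eq_iff)
  then have "x - y \<in> ac_complex"
    using w(1) ac_complex_closed(2)[OF to_ac_in_ac_complex[of 0] w(1)] by auto
  then have "to_ac (1/2) * ((x + y) + (x - y)) \<in> ac_complex"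
    by (intro ac_complex_closed(1,3) s to_ac_in_ac_complex)
  then show ?thesis by (simp add: field_simps)
qed

lemma map_poly_hom_add:
  assumes "h 0 = 0" "\<And>a b. h (a + b) = h a + h b"
  shows "map_poly h (p + q) = map_poly h p + map_poly h (q :: 'a::comm_ring_1 poly)"
  by (intro poly_eqI) (simp add: coeff_map_poly assms)

lemma map_poly_hom_mult:
  assumes "h 0 = 0" "\<And>a b. h (a + b) = h a + h b" "\<And>a b. h (a * b) = h a * h b"
  shows "map_poly h (p * q) = map_poly h p * map_poly h (q :: 'a::comm_ring_1 poly)"
proof -
  have "h (sum f A) = (\<Sum>x\<in>A. h (f x))" for f :: "nat \<Rightarrow> 'a" and A
    by (induction A rule: infinite_finite_induct) (simp_all add: assms)
  then show ?thesis
    by (intro poly_eqI) (simp add: coeff_map_poly coeff_mult assms)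
qed

lemma two_power_times_odd: "0 < n \<Longrightarrow> \<exists>k m. n = 2 ^ k * m \<and> odd (m::nat)"
proof (induction n rule: less_induct)
  case (less n)
  show ?case
  proof (cases "odd n")
    case True
    then show ?thesis by (intro exI[of _ 0] exI[of _ n]) simp
  next
    case False
    then obtain l where l: "n = 2 * l" by blast
    then obtain k m where "l = 2 ^ k * m" "odd m" using less.IH[of l] less.prems by auto
    then show ?thesis using l by (intro exI[of _ "Suc k"] exI[of _ m]) simp
  qed
qed

lemma poly_map_to_ac: "poly (map_poly to_ac p) (to_ac x) = to_ac (poly p (x::'a::field))"
  by (induction p) (auto simp: map_poly_pCons)

lemma coeffs_in_base_imp_map_poly:
  assumes "\<And>k. coeff q k \<in> range (to_ac :: 'a::field \<Rightarrow> _)"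
  obtains p where "q = map_poly to_ac p"
proof
  show "q = map_poly to_ac (map_poly of_ac q)"
    using assms by (intro poly_eqI) (simp add: coeff_map_poly to_ac_of_ac)
qed

lemma degree_map_to_ac: "degree (map_poly to_ac p) = degree (p :: 'a::field poly)"
  by (rule degree_map_poly) simp

text \<open>Laplace's argument: with the roots \<open>x\<^sub>i\<close> in the algebraic closure, the polynomial with roots \<open>x\<^sub>i + x\<^sub>j + t x\<^sub>i x\<^sub>j\<close>
  for \<open>i < j\<close> is again defined over the base field (by Newton's identities) and has a smaller power of \<open>2\<close> in its degree.
  Two values of \<open>t\<close> yield a root in \<open>K(\<i>)\<close> for the same pair, and then \<open>x\<^sub>i\<close> solves a quadratic equation over \<open>K(\<i>)\<close>.\<close>

theorem real_closed_root_in_ac_complex: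
  assumes rc: "real_closed TYPE('a::linordered_field)"
    and "degree (f :: 'a poly) = 2 ^ k * m" "odd m"
  shows "\<exists>z\<in>ac_complex. poly (map_poly to_ac f) z = 0"
  using assms(2,3)
proof (induction k arbitrary: f m)
  case 0
  then obtain x where "poly f x = 0" using real_closedD(2)[OF rc, of f] by auto
  then show ?case using poly_map_to_ac[of f x] to_ac_in_ac_complex by fastforce
next
  case (Suc k)
  let ?f = "map_poly to_ac f" and ?n = "degree f"
  have n0: "?n > 0" using Suc.prems by (auto simp: odd_pos)
  then have f0: "?f \<noteq> 0" using degree_map_to_ac[of f] by (metis degree_0 less_irrefl)
  obtain M where M: "size M = degree ?f" "?f = smult (lead_coeff ?f) (\<Prod>x\<in>#M. [:-x, 1:])"
    using alg_closed_imp_factorization[OF f0] by blast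
  obtain xs where xs: "mset xs = M" using ex_mset by blast
  let ?c = "lead_coeff ?f"
  have fxs: "?f = smult ?c (roots_poly xs)"
    using M(2) by (metis xs roots_poly_def mset_map prod_mset_prod_list)
  have len: "length xs = ?n" using M(1) xs degree_map_to_ac[of f] by (metis size_mset)
  have c0: "?c \<noteq> 0" using f0 by simp
  have root: "poly ?f x = 0" if "x \<in> set xs" for x
    using that by (subst fxs) (auto simp: poly_roots_poly prod_list_zero_iff)
  have "fps_nth (rev_roots_fps xs) j \<in> range to_ac" for j
  proof (cases "j \<le> length xs")
    case True
    have "coeff (roots_poly xs) i = coeff ?f i / ?c" for i
      using arg_cong[OF fxs, of "\<lambda>p. coeff p i"] c0 by (simp add: field_simps del: coeff_map_poly)
    also have "coeff ?f i / ?c \<in> range to_ac" for i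
      by (intro range_to_ac_closed(4)) (simp_all add: coeff_map_poly)
    finally show ?thesis using True by (simp add: rev_roots_fps_coeff)
  qed (simp add: rev_roots_fps_coeff one_zero_in_range_to_ac)
  then have ps: "power_sum xs j \<in> range to_ac" for j
    by (rule power_sum_in_base)
  define g where "g t = (\<lambda>a b :: 'a alg_closure. a + b + to_ac (of_nat t) * a * b)" for t :: nat
  have "\<exists>a\<in>set xs. \<exists>b\<in>set xs. g t a b \<in> ac_complex" for t
  proof -
    let ?ys = "pair_map (g t) xs"
    have psy: "power_sum ?ys j \<in> range to_ac" for j
      unfolding g_def by (rule power_sum_pairs_in_base) (auto intro: ps of_nat_in_range_to_ac)
    have "coeff (roots_poly ?ys) i \<in> range to_ac" for i
    proof (cases "i \<le> length ?ys")
      case True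
      then show ?thesis
        using rev_roots_fps_in_base[OF psy, of "length ?ys - i"] by (simp add: rev_roots_fps_coeff)
    next
      case False
      then show ?thesis
        by (simp add: coeff_eq_0 degree_roots_poly one_zero_in_range_to_ac)
    qed
    then obtain q where q: "roots_poly ?ys = map_poly to_ac q"
      by (rule coeffs_in_base_imp_map_poly)
    have "degree q = length ?ys"
      using degree_roots_poly[of ?ys] unfolding q degree_map_to_ac .
    \<comment> \<open>The degree of \<open>f\<close> is even, so \<open>?n - 1\<close> is odd and
      passing to pairs loses exactly one factor 2. The induction hypothesis is applied with odd part
      \<open>m * (?n - 1)\<close>.\<close>
    moreover have "2 * length ?ys = 2 * (2 ^ k * (m * (?n - 1)))"
      unfolding length_pair_map len using Suc.prems by simp
    ultimately have "degree q = 2 ^ k * (m * (?n - 1))" by simp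
    moreover have "odd (m * (?n - 1))" using Suc.prems n0 by simp
    ultimately obtain z where z: "z \<in> ac_complex" "poly (map_poly to_ac q) z = 0"
      using Suc.IH by blast
    then have "z \<in> set ?ys"
      unfolding q[symmetric] poly_roots_poly by (auto simp: prod_list_zero_iff)
    then show ?thesis using z(1) set_pair_map[of z "g t" xs] by blast
  qed
  then obtain A B where AB: "A t \<in> set xs" "B t \<in> set xs" "g t (A t) (B t) \<in> ac_complex" for t
    by metis
  have "\<not> inj (\<lambda>t. (A t, B t))"
  proof
    assume "inj (\<lambda>t. (A t, B t))"
    moreover have "range (\<lambda>t. (A t, B t)) \<subseteq> set xs \<times> set xs" using AB by auto
    ultimately show False
      using finite_subset[of "range (\<lambda>t. (A t, B t))" "set xs \<times> set xs"] finite_imageD by fastforce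
  qed
  then obtain t t' where tt: "t \<noteq> t'" "A t = A t'" "B t = B t'"
    unfolding inj_def by blast
  let ?a = "A t" and ?b = "B t"
  define d where "d = (of_nat t - of_nat t' :: 'a)"
  have d: "d \<noteq> 0" using tt by (simp add: d_def)
  have "g t ?a ?b - g t' ?a ?b \<in> ac_complex" using AB(3)[of t] AB(3)[of t'] tt
    by (metis ac_complex_closed(2))
  also have "g t ?a ?b - g t' ?a ?b = to_ac d * (?a * ?b)" by (simp add: g_def d_def algebra_simps)
  finally have "to_ac (inverse d) * (to_ac d * (?a * ?b)) \<in> ac_complex"
    by (rule ac_complex_closed(3)[OF to_ac_in_ac_complex])
  then have P: "?a * ?b \<in> ac_complex"
    using d by (simp add: mult.assoc[symmetric])
  have "g t ?a ?b - to_ac (of_nat t) * (?a * ?b) \<in> ac_complex"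
    by (intro ac_complex_closed to_ac_in_ac_complex P AB)
  then have "?a + ?b \<in> ac_complex" by (simp add: g_def mult.assoc)
  then have "?a \<in> ac_complex" using P by (rule ac_complex_vieta[OF rc])
  then show ?case using root AB by blast
qed

text \<open>A root with zero imaginary part splits off a linear factor. Otherwise \<open>f\<close>
  is divided with remainder by the real quadratic polynomial of the root; the remainder is linear
  and vanishes at a point outside the base field, so it is zero.\<close>

lemma real_closed_factor:
  assumes rc: "real_closed TYPE('a::linordered_field)" and "degree (f :: 'a poly) > 0"
  shows "\<exists>a b. b \<noteq> 0 \<and> ([:-a, 1:] dvd f \<or> ([:-a, 1:] ^ 2 + [:b ^ 2:]) dvd f)"
proof -
  obtain k m where "degree f = 2 ^ k * m" "odd m"
    using two_power_times_odd[OF assms(2)] by blast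
  then obtain z where z: "z \<in> ac_complex" "poly (map_poly to_ac f) z = 0"
    using real_closed_root_in_ac_complex[OF rc] by blast
  then obtain a b where ab: "z = to_ac a + ac_i * to_ac b" by (auto elim: ac_complexE)
  show ?thesis
  proof (cases "b = 0")
    case True
    then have "poly f a = 0" using z poly_map_to_ac[of f a] by (simp add: ab)
    then show ?thesis by (intro exI[of _ a] exI[of _ 1]) (simp add: poly_eq_0_iff_dvd)
  next
    case False
    let ?g = "[:-a, 1:] ^ 2 + [:b ^ 2:]"
    have g: "?g = [:a^2 + b^2, - 2 * a, 1:]" by (simp add: power2_eq_square)
    then have dg: "degree ?g = 2" by simp
    have hom: "poly (map_poly to_ac (p + q)) z = poly (map_poly to_ac p) z + poly (map_poly to_ac q) z"
      "poly (map_poly to_ac (p * q)) z = poly (map_poly to_ac p) z * poly (map_poly to_ac q) z" for p q :: "'a poly"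
      by (simp_all add: map_poly_hom_add map_poly_hom_mult)
    have gz: "poly (map_poly to_ac ?g) z = 0"
    proof -
      have "poly (map_poly to_ac ?g) z = (z - to_ac a) * (z - to_ac a) + to_ac b * to_ac b"
        unfolding g by (simp add: map_poly_pCons power2_eq_square algebra_simps)
      also have "\<dots> = (ac_i * ac_i) * (to_ac b * to_ac b) + to_ac b * to_ac b"
        unfolding ab by (simp add: algebra_simps)
      finally show ?thesis by (simp add: ac_i_squared)
    qed
    let ?r = "f mod ?g"
    have "poly (map_poly to_ac (?g * (f div ?g) + ?r)) z = 0"
      using z by simp
    then have rz: "poly (map_poly to_ac ?r) z = 0"
      unfolding hom(1)[of "?g * (f div ?g)"] hom(2)[of ?g] gz by simp
    have "degree ?r < 2 \<or> ?r = 0" using degree_mod_less[of ?g f] dg by (metis degree_0 zero_neq_numeral)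
    then have "degree ?r \<le> 1" by auto
    then have "?r = [:coeff ?r 0, coeff ?r 1:]"
      by (intro poly_eqI) (auto simp: coeff_pCons coeff_eq_0 split: nat.splits)
    then obtain r0 r1 where r: "?r = [:r0, r1:]" by blast
    have eq: "to_ac (r0 + r1 * a) = - (ac_i * to_ac (r1 * b))"
      using rz unfolding r by (simp add: map_poly_pCons ab algebra_simps eq_neg_iff_add_eq_0)
    \<comment> \<open>Squaring the relation eliminates \<open>ac_i\<close> and leaves a vanishing
      sum of two squares in the ordered base field. This replaces an argument on the linear
      independence of 1 and \<open>ac_i\<close>.\<close>
    have "to_ac ((r0 + r1 * a) * (r0 + r1 * a)) = (ac_i * ac_i) * to_ac ((r1 * b) * (r1 * b))"
      unfolding to_ac_mult[of "r0 + r1 * a" "r0 + r1 * a"] eq by (simp add: algebra_simps)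
    then have "to_ac ((r0 + r1 * a) * (r0 + r1 * a)) = to_ac (- ((r1 * b) * (r1 * b)))"
      by (simp add: ac_i_squared)
    then have "(r0 + r1 * a) * (r0 + r1 * a) + (r1 * b) * (r1 * b) = 0" by (metis to_ac_eq_iff add.left_inverse add.commute)
    then have "r0 + r1 * a = 0" "r1 * b = 0" by (simp_all add: sum_squares_eq_zero_iff)
    then have "?r = 0" using False r by auto
    then show ?thesis using False by (auto simp: mod_eq_0_iff_dvd)
  qed
qed

text \<open>The working form of the factorization. The quadratic factors are sums of squares,
  positive at every point and in every ordering, so signs depend on the linear factors
  alone.\<close>

lemma real_closed_poly_induct [consumes 2, case_names const linear quadratic]:
  fixes p :: "'a::linordered_field poly"
  assumes rc: "real_closed TYPE('a)" and "p \<noteq> 0"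
    and const: "\<And>c. c \<noteq> 0 \<Longrightarrow> P [:c:]"
    and linear: "\<And>a p. p \<noteq> 0 \<Longrightarrow> P p \<Longrightarrow> P ([:-a, 1:] * p)"
    and quadratic: "\<And>a b p. b \<noteq> 0 \<Longrightarrow> p \<noteq> 0 \<Longrightarrow> P p \<Longrightarrow> P (([:-a, 1:] ^ 2 + [:b ^ 2:]) * p)"
  shows "P p"
  using \<open>p \<noteq> 0\<close>
proof (induction "degree p" arbitrary: p rule: less_induct)
  case (less p)
  show ?case
  proof (cases "degree p = 0")
    case True
    then obtain c where "p = [:c:]" by (auto elim: degree_eq_zeroE)
    then show ?thesis using const less.prems by auto
  next
    case False
    then obtain a b where b: "b \<noteq> 0" and dvd: "[:-a, 1:] dvd p \<or> ([:-a, 1:] ^ 2 + [:b ^ 2:]) dvd p"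
      using real_closed_factor[OF rc] by blast
    have quad: "degree ([:-a, 1:] ^ 2 + [:b ^ 2:]) = 2" by (simp add: power2_eq_square)
    from dvd show ?thesis
    proof
      assume "[:-a, 1:] dvd p"
      then obtain q where q: "p = [:-a, 1:] * q" ..
      then have "q \<noteq> 0" using less.prems by auto
      moreover have "degree p = Suc (degree q)" unfolding q using \<open>q \<noteq> 0\<close> by (subst degree_mult_eq) auto
      ultimately show ?thesis using less.hyps[of q] linear q by auto
    next
      assume "([:-a, 1:] ^ 2 + [:b ^ 2:]) dvd p"
      then obtain q where q: "p = ([:-a, 1:] ^ 2 + [:b ^ 2:]) * q" ..
      then have "q \<noteq> 0" using less.prems by auto
      moreover have "degree p = 2 + degree q"
        unfolding q using \<open>q \<noteq> 0\<close> quad by (subst degree_mult_eq) (auto simp del: power2_eq_square)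
      ultimately show ?thesis using less.hyps[of q] quadratic[OF b] q by auto
    qed
  qed
qed

section \<open>Orderings of the rational function field\<close>

text \<open>Orderings are sets and not a class instance, because \<open>K(y)\<close> carries a
  different one for each cut and two of them often have to be compared.\<close>

locale ordered_by =
  fixes P :: "'k::field_char_0 set"
  assumes ordering: "field_ordering P"
begin

lemma P_add: "x \<in> P \<Longrightarrow> y \<in> P \<Longrightarrow> x + y \<in> P"
  and P_mult: "x \<in> P \<Longrightarrow> y \<in> P \<Longrightarrow> x * y \<in> P"
  using ordering unfolding field_ordering_def by blast+

lemma P_or_neg: "x \<in> P \<or> - x \<in> P"
proof -
  have "x \<in> P \<union> uminus ` P" using ordering unfolding field_ordering_def by blast
  then show ?thesis by auto
qed

lemma P_antisym: "x \<in> P \<Longrightarrow> - x \<in> P \<Longrightarrow> x = 0"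
proof -
  assume "x \<in> P" "- x \<in> P"
  then have "x \<in> P \<inter> uminus ` P" by (metis IntI image_eqI minus_minus)
  then show "x = 0" using ordering unfolding field_ordering_def by blast
qed

lemma P_square: "x * x \<in> P"
  using P_or_neg[of x] P_mult[of x x] P_mult[of "-x" "-x"] by auto

lemma P_0: "0 \<in> P" and P_1: "1 \<in> P"
  using P_square[of 0] P_square[of 1] by simp_all

lemma P_of_nat: "of_nat n \<in> P"
  by (induction n) (auto intro: P_0 P_add P_1)

lemma P_inverse: "x \<in> P \<Longrightarrow> inverse x \<in> P"
  using P_mult[OF _ P_square[of "inverse x"], of x] by (cases "x = 0") (auto simp flip: mult.assoc)

lemma P_divide: "x \<in> P \<Longrightarrow> y \<in> P \<Longrightarrow> x / y \<in> P"
  using P_mult[OF _ P_inverse] by (simp add: divide_inverse)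

lemma P_cancel: "x \<in> P \<Longrightarrow> x \<noteq> 0 \<Longrightarrow> x * y \<in> P \<Longrightarrow> y \<in> P"
  using P_divide[of "x * y" x] by simp

lemma P_of_rat: "of_rat q \<in> P \<longleftrightarrow> 0 \<le> q"
proof -
  have pos: "of_rat q \<in> P" if "0 \<le> q" for q
  proof -
    obtain a b where "quotient_of q = (a, b)" by (cases "quotient_of q")
    then have q: "q = of_int a / of_int b" "b > 0" using quotient_of_div quotient_of_denom_pos by auto
    then have "a \<ge> 0" using that by (simp add: zero_le_divide_iff)
    then have "of_rat q = (of_nat (nat a) / of_nat (nat b) :: 'k)"
      using q by (simp add: of_rat_divide)
    then show ?thesis using P_divide P_of_nat by simp
  qed
  show ?thesis
    using pos[of q] pos[of "-q"] P_antisym[of "of_rat q"] by (force simp: of_rat_minus)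
qed

lemma P_mult_iff: "x \<noteq> 0 \<Longrightarrow> y \<noteq> 0 \<Longrightarrow> x * y \<in> P \<longleftrightarrow> (x \<in> P \<longleftrightarrow> y \<in> P)"
  using P_or_neg[of x] P_or_neg[of y] P_mult[of x y] P_mult[of "-x" y] P_mult[of x "-y"] P_mult[of "-x" "-y"]
    P_antisym[of "x * y"] P_antisym[of x] P_antisym[of y]
  by auto

end

lemma field_ordering_subset_eq:
  assumes "field_ordering (P :: 'k::field_char_0 set)" "field_ordering Q" "P \<subseteq> Q"
  shows "P = Q"
proof -
  interpret P: ordered_by P by standard fact
  interpret Q: ordered_by Q by standard fact
  have "x \<in> P" if "x \<in> Q" for x
    using that P.P_or_neg[of x] Q.P_antisym[of x] assms(3) P.P_0 by auto
  then show ?thesis using assms(3) by blast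
qed

lemma rf_y_diff: "rf_y - rf_const z = Fract [:-z, 1:] 1"
  by (simp add: rf_y_def rf_const_def)

lemma Fract_mult_1: "Fract (p * q) 1 = Fract p 1 * Fract q (1::'a::field poly)"
  by simp

lemma Fract_zero_iff: "q \<noteq> 0 \<Longrightarrow> Fract p q = 0 \<longleftrightarrow> p = (0 :: 'a::idom)"
  by (simp add: Zero_fract_def eq_fract)

lemma rf_const_hom:
  "rf_const (a + b) = rf_const a + rf_const b" "rf_const (a - b) = rf_const a - rf_const b"
  "rf_const (a * b) = rf_const a * rf_const b" "rf_const (- a) = - rf_const a"
  "rf_const 0 = 0" "rf_const 1 = (1 :: 'a::field poly fract)"
  by (simp_all add: rf_const_def Zero_fract_def One_fract_def one_pCons mult.commute)

lemma rf_const_eq_0_iff: "rf_const a = 0 \<longleftrightarrow> a = (0::'a::field)"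
  by (simp add: rf_const_def Fract_zero_iff)

lemma rf_const_inverse: "rf_const (inverse a) = inverse (rf_const (a::'a::field))"
proof (cases "a = 0")
  case False
  then have "rf_const a * rf_const (inverse a) = 1" by (simp add: rf_const_hom(6) flip: rf_const_hom(3))
  then show ?thesis by (metis inverse_unique)
qed (simp add: rf_const_hom)

lemma rf_const_divide: "rf_const (a / b) = rf_const a / rf_const (b::'a::field)"
  by (simp add: divide_inverse rf_const_hom rf_const_inverse)

lemma rf_const_of_nat: "rf_const (of_nat n) = (of_nat n :: 'a::field poly fract)"
  by (induction n) (simp_all add: rf_const_hom)

locale rational_ordered_by = ordered_by P for P :: "'a::linordered_field poly fract set" +
  assumes rc: "real_closed TYPE('a)"
begin

text \<open>Nonnegative elements of a real closed field are squares, so every ordering of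
  \<open>K(y)\<close> induces the given one on the constants.\<close>

lemma const_in_P: "rf_const c \<in> P \<longleftrightarrow> 0 \<le> (c::'a)"
proof -
  have pos: "rf_const c \<in> P" if c: "0 \<le> (c::'a)" for c
  proof -
    obtain s where "s * s = c" using real_closedD(1)[OF rc c] by blast
    then show ?thesis using P_square[of "rf_const s"] by (simp flip: rf_const_hom)
  qed
  show ?thesis
    using pos[of c] pos[of "-c"] P_antisym[of "rf_const c"] by (force simp: rf_const_hom rf_const_eq_0_iff)
qed

text \<open>A quotient and the product of its numerator and denominator differ by a nonzero square,
  so sign questions reduce to polynomials.\<close>

lemma Fract_in_P: "q \<noteq> 0 \<Longrightarrow> Fract p q \<in> P \<longleftrightarrow> Fract (p * q) 1 \<in> P"
proof -
  assume q: "q \<noteq> 0"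
  have 1: "Fract (p * q) 1 = Fract p q * (Fract q 1 * Fract q 1)"
    using q by (simp add: eq_fract)
  have 2: "Fract p q = Fract (p * q) 1 * (inverse (Fract q 1) * inverse (Fract q 1))"
    using q by (simp add: eq_fract)
  show ?thesis using P_mult[OF _ P_square] 1 2 by metis
qed

definition cut_of :: "'a set \<times> 'a set" where
  "cut_of = ({d. rf_y - rf_const d \<in> P}, - {d. rf_y - rf_const d \<in> P})"

lemma cut_of_in_cuts: "cut_of \<in> cuts"
proof -
  have "d < x" if "rf_y - rf_const d \<in> P" "rf_y - rf_const x \<notin> P" for d x
  proof (rule ccontr)
    assume "\<not> d < x"
    then have "rf_const (d - x) \<in> P" by (simp add: const_in_P)
    then show False using P_add[OF that(1), of "rf_const (d - x)"] that(2) by (simp add: rf_const_hom)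
  qed
  then show ?thesis by (auto simp: cut_of_def cuts_def)
qed

lemma quadratic_in_P: "Fract ([:-a, 1:] ^ 2 + [:b ^ 2:]) 1 \<in> P"
proof -
  have "Fract ([:-a, 1:] ^ 2 + [:b ^ 2:]) 1 =
      Fract [:-a, 1:] 1 * Fract [:-a, 1:] 1 + rf_const b * rf_const b"
    by (simp add: rf_const_def power2_eq_square)
  then show ?thesis using P_add P_square by metis
qed

end

text \<open>Agreement is demanded at the roots of \<open>p\<close> only, not for the whole cut. That
  finitely many points decide the sign is what later makes sign conditions open in the space of
  cuts.\<close>

lemma ordering_sign_determined:
  assumes rc: "real_closed TYPE('a::linordered_field)"
    and P: "field_ordering P" and Q: "field_ordering (Q :: 'a poly fract set)"
    and "p \<noteq> 0" and "\<And>z. poly p z = 0 \<Longrightarrow> rf_y - rf_const z \<in> P \<longleftrightarrow> rf_y - rf_const z \<in> Q"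
  shows "Fract p 1 \<in> P \<longleftrightarrow> Fract p 1 \<in> Q"
proof -
  interpret P: rational_ordered_by P using P rc by unfold_locales
  interpret Q: rational_ordered_by Q using Q rc by unfold_locales
  show ?thesis
    using rc \<open>p \<noteq> 0\<close> assms(5)
  proof (induction p rule: real_closed_poly_induct)
    case (const c)
    then show ?case using P.const_in_P Q.const_in_P by (simp add: rf_const_def)
  next
    case (linear a p)
    have nz: "Fract [:-a, 1:] 1 \<noteq> 0" "Fract p 1 \<noteq> 0" using linear by (simp_all add: Fract_zero_iff)
    show ?case
      unfolding Fract_mult_1 P.P_mult_iff[OF nz] Q.P_mult_iff[OF nz]
      using linear.IH linear.prems[of a] linear.prems by (simp add: rf_y_diff)
  next
    case (quadratic a b p)
    let ?g = "[:-a, 1:] ^ 2 + [:b ^ 2:]"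
    have "degree ?g = 2" by (simp add: power2_eq_square)
    then have "?g \<noteq> 0" by (metis degree_0 zero_neq_numeral)
    then have nz: "Fract ?g 1 \<noteq> 0" "Fract p 1 \<noteq> 0" using quadratic by (simp_all add: Fract_zero_iff)
    show ?case
      unfolding Fract_mult_1 P.P_mult_iff[OF nz] Q.P_mult_iff[OF nz]
      using quadratic.IH quadratic.prems P.quadratic_in_P Q.quadratic_in_P by auto
  qed
qed

text \<open>The uniqueness half of the definition of \<open>chi\<close>.\<close>

lemma ordering_eqI:
  assumes rc: "real_closed TYPE('a::linordered_field)"
    and P: "field_ordering P" and Q: "field_ordering (Q :: 'a poly fract set)"
    and eq: "{d. rf_y - rf_const d \<in> P} = {d. rf_y - rf_const d \<in> Q}"
  shows "P = Q"
proof (rule field_ordering_subset_eq[OF P Q], rule subsetI)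
  interpret P: rational_ordered_by P using P rc by unfold_locales
  interpret Q: rational_ordered_by Q using Q rc by unfold_locales
  fix x assume x: "x \<in> P"
  obtain p q where pq: "x = Fract p q" "q \<noteq> 0" by (cases x)
  show "x \<in> Q"
  proof (cases "p * q = 0")
    case True
    then have "p = 0" using pq by simp
    then show ?thesis using pq Q.P_0 by (simp add: fract_collapse)
  next
    case False
    then show ?thesis
      using ordering_sign_determined[OF rc P Q False] eq x P.Fract_in_P[OF pq(2)] Q.Fract_in_P[OF pq(2)] pq(1)
      by auto
  qed
qed

text \<open>The ordering of a cut is obtained by evaluating rational functions at elements close to the cut.\<close>

definition near_cut :: "'a::linorder set \<times> 'a set \<Rightarrow> ('a \<Rightarrow> bool) \<Rightarrow> bool" where
  "near_cut C \<phi> \<longleftrightarrow> (\<exists>A B. finite A \<and> finite B \<and> A \<subseteq> fst C \<and> B \<subseteq> snd C \<and>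
     (\<forall>t. (\<forall>a\<in>A. a < t) \<and> (\<forall>b\<in>B. t < b) \<longrightarrow> \<phi> t))"

lemma near_cut_conj:
  assumes "near_cut C \<phi>" "near_cut C \<psi>" shows "near_cut C (\<lambda>t. \<phi> t \<and> \<psi> t)"
proof -
  obtain A B where A: "finite A" "finite B" "A \<subseteq> fst C" "B \<subseteq> snd C"
    "\<And>t. (\<forall>a\<in>A. a < t) \<and> (\<forall>b\<in>B. t < b) \<Longrightarrow> \<phi> t"
    using assms(1) unfolding near_cut_def by blast
  obtain A' B' where B: "finite A'" "finite B'" "A' \<subseteq> fst C" "B' \<subseteq> snd C"
    "\<And>t. (\<forall>a\<in>A'. a < t) \<and> (\<forall>b\<in>B'. t < b) \<Longrightarrow> \<psi> t"
    using assms(2) unfolding near_cut_def by blast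
  show ?thesis unfolding near_cut_def
    by (rule exI[of _ "A \<union> A'"], rule exI[of _ "B \<union> B'"]) (use A B in auto)
qed

lemma near_cut_mono: "near_cut C \<phi> \<Longrightarrow> (\<And>t. \<phi> t \<Longrightarrow> \<psi> t) \<Longrightarrow> near_cut C \<psi>"
  unfolding near_cut_def by meson

lemma near_cut_True: "(\<And>t. \<phi> t) \<Longrightarrow> near_cut C \<phi>"
  unfolding near_cut_def by blast

text \<open>The finite sets of bounds lie on opposite sides, and one or both may be empty at an
  improper cut. Density and the absence of endpoints provide a point between them, so statements
  true near a cut form a proper filter and contradictory ones cannot both hold.\<close>

lemma near_cut_ex:
  fixes C :: "'a::linordered_field set \<times> 'a set"
  assumes "C \<in> cuts" "near_cut C \<phi>" shows "\<exists>t. \<phi> t"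
proof -
  obtain A B where A: "finite A" "finite B" "A \<subseteq> fst C" "B \<subseteq> snd C"
    "\<And>t. (\<forall>a\<in>A. a < t) \<and> (\<forall>b\<in>B. t < b) \<Longrightarrow> \<phi> t"
    using assms(2) unfolding near_cut_def by blast
  have "\<forall>d\<in>fst C. \<forall>x\<in>snd C. d < x"
    using assms(1) by (auto simp: cuts_def split: prod.splits)
  then have less: "a < b" if "a \<in> A" "b \<in> B" for a b
    using A that by blast
  have "\<exists>t. (\<forall>a\<in>A. a < t) \<and> (\<forall>b\<in>B. t < b)"
  proof (cases "A = {}")
    case True
    then show ?thesis
    proof (cases "B = {}")
      case False
      obtain t where "t < Min B" using lt_ex by blast
      then show ?thesis using True A False by (auto intro!: exI[of _ t])
    qed simp
  next
    case nA: False
    show ?thesis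
    proof (cases "B = {}")
      case True
      obtain t where "Max A < t" using gt_ex by blast
      then show ?thesis using True A nA by (auto intro!: exI[of _ t])
    next
      case False
      then have "Max A < Min B" using less A nA by simp
      then obtain t where "Max A < t" "t < Min B" using dense by blast
      then show ?thesis using A nA False by (auto intro!: exI[of _ t])
    qed
  qed
  then show ?thesis using A by blast
qed

lemma near_cut_fst: "C \<in> cuts \<Longrightarrow> d \<in> fst C \<Longrightarrow> near_cut C (\<lambda>t. d < t)"
  unfolding near_cut_def by (rule exI[of _ "{d}"], rule exI[of _ "{}"]) auto

lemma near_cut_snd: "C \<in> cuts \<Longrightarrow> d \<notin> fst C \<Longrightarrow> near_cut C (\<lambda>t. t < d)"
  unfolding near_cut_def cuts_def by (rule exI[of _ "{}"], rule exI[of _ "{d}"]) auto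

text \<open>A linear factor has a constant sign on one side of its root, and the cut decides on
  which side evaluation takes place. This yields totality of the ordering defined by
  evaluation.\<close>

lemma near_cut_sign:
  fixes p :: "'a::linordered_field poly"
  assumes rc: "real_closed TYPE('a)" and C: "C \<in> cuts" and "p \<noteq> 0"
  shows "near_cut C (\<lambda>t. poly p t > 0) \<or> near_cut C (\<lambda>t. poly p t < 0)"
proof -
  have step: "near_cut C (\<lambda>t. poly (q * p) t > 0) \<or> near_cut C (\<lambda>t. poly (q * p) t < 0)"
    if "near_cut C (\<lambda>t. poly p t > 0) \<or> near_cut C (\<lambda>t. poly p t < 0)"
      "near_cut C (\<lambda>t. poly q t > 0) \<or> near_cut C (\<lambda>t. poly q t < 0)" for p q :: "'a poly"
  proof -
    have conj: "near_cut C \<theta>" if "near_cut C \<phi>" "near_cut C \<psi>" "\<And>t. \<phi> t \<Longrightarrow> \<psi> t \<Longrightarrow> \<theta> t" for \<phi> \<psi> \<theta>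
      using near_cut_mono[OF near_cut_conj[OF that(1,2)]] that(3) by blast
    note conj' = conj[where \<theta> = "\<lambda>t. poly (q * p) t > 0"] conj[where \<theta> = "\<lambda>t. poly (q * p) t < 0"]
    from that show ?thesis
      by (elim disjE) (rule disjI1, erule (1) conj', simp, rule disjI2, erule (1) conj', simp add: mult_neg_pos,
          rule disjI2, erule (1) conj', simp add: mult_pos_neg, rule disjI1, erule (1) conj', simp add: mult_neg_neg)
  qed
  show ?thesis
    using rc \<open>p \<noteq> 0\<close>
  proof (induction p rule: real_closed_poly_induct)
    case (const c)
    then show ?case
      using near_cut_True[of "\<lambda>t. poly [:c:] t > 0" C] near_cut_True[of "\<lambda>t. poly [:c:] t < 0" C]
      by (cases "c > 0") auto
  next
    case (linear a p)
    show ?case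
      by (rule step[OF linear(2)]) (use near_cut_fst[OF C, of a] near_cut_snd[OF C, of a] in auto)
  next
    case (quadratic a b p)
    have "poly ([:-a, 1:] ^ 2 + [:b ^ 2:]) t > 0" for t
      using quadratic by (simp add: add_nonneg_pos)
    then show ?case
      using step[OF quadratic(3)] near_cut_True[of _ C] by blast
  qed
qed

lemma near_cut_nonzero:
  fixes p :: "'a::linordered_field poly"
  assumes "real_closed TYPE('a)" "C \<in> cuts" "p \<noteq> 0"
  shows "near_cut C (\<lambda>t. poly p t \<noteq> 0)"
  using near_cut_sign[OF assms] by (auto elim!: near_cut_mono)

definition eval_ordering :: "'a::linordered_field set \<times> 'a set \<Rightarrow> 'a poly fract set" where
  "eval_ordering C = {x. \<exists>p q. q \<noteq> 0 \<and> x = Fract p q \<and> near_cut C (\<lambda>t. 0 \<le> poly p t / poly q t)}"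

text \<open>Independence of the representation: two fractions for the same element agree as
  functions away from the zeros of their denominators, and these are avoided near the cut.\<close>

lemma Fract_in_eval_ordering:
  fixes p q :: "'a::linordered_field poly"
  assumes "real_closed TYPE('a)" "C \<in> cuts" "q \<noteq> 0"
  shows "Fract p q \<in> eval_ordering C \<longleftrightarrow> near_cut C (\<lambda>t. 0 \<le> poly p t / poly q t)"
proof
  assume "Fract p q \<in> eval_ordering C"
  then obtain p' q' where *: "q' \<noteq> 0" "Fract p q = Fract p' q'" "near_cut C (\<lambda>t. 0 \<le> poly p' t / poly q' t)"
    unfolding eval_ordering_def by blast
  then have "p * q' = p' * q" using assms by (simp add: eq_fract)
  then have "poly p t * poly q' t = poly p' t * poly q t" for t by (metis poly_mult)
  then have eq: "poly p t / poly q t = poly p' t / poly q' t" if "poly q t \<noteq> 0" "poly q' t \<noteq> 0" for t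
    using that by (simp add: frac_eq_eq)
  have "near_cut C (\<lambda>t. 0 \<le> poly p' t / poly q' t \<and> poly q t \<noteq> 0 \<and> poly q' t \<noteq> 0)"
    by (intro near_cut_conj near_cut_nonzero assms *)
  then show "near_cut C (\<lambda>t. 0 \<le> poly p t / poly q t)"
    by (rule near_cut_mono) (metis eq)
qed (use assms in \<open>auto simp: eval_ordering_def\<close>)

lemma field_ordering_eval_ordering:
  assumes rc: "real_closed TYPE('a::linordered_field)" and C: "(C :: 'a set \<times> 'a set) \<in> cuts"
  shows "field_ordering (eval_ordering C)"
proof -
  note iff = Fract_in_eval_ordering[OF rc C] and nz = near_cut_nonzero[OF rc C]
  have add: "x + y \<in> eval_ordering C" and mult: "x * y \<in> eval_ordering C"
    if "x \<in> eval_ordering C" "y \<in> eval_ordering C" for x y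
  proof -
    obtain p q where x: "x = Fract p q" "q \<noteq> 0" by (cases x)
    obtain r s where y: "y = Fract r s" "s \<noteq> 0" by (cases y)
    have near: "near_cut C (\<lambda>t. (0 \<le> poly p t / poly q t \<and> 0 \<le> poly r t / poly s t) \<and> poly q t \<noteq> 0 \<and> poly s t \<noteq> 0)"
      using that x y by (intro near_cut_conj nz) (simp_all add: iff)
    have "near_cut C (\<lambda>t. 0 \<le> poly (p * s + r * q) t / poly (q * s) t)"
      using near
    proof (rule near_cut_mono)
      fix t assume t: "(0 \<le> poly p t / poly q t \<and> 0 \<le> poly r t / poly s t) \<and> poly q t \<noteq> 0 \<and> poly s t \<noteq> 0"
      then have "poly (p * s + r * q) t / poly (q * s) t = poly p t / poly q t + poly r t / poly s t"
        by (simp add: add_frac_eq)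
      then show "0 \<le> poly (p * s + r * q) t / poly (q * s) t" using t by simp
    qed
    then show "x + y \<in> eval_ordering C" using x y by (simp add: iff)
    have "near_cut C (\<lambda>t. 0 \<le> poly (p * r) t / poly (q * s) t)"
      using near
    proof (rule near_cut_mono)
      fix t assume "(0 \<le> poly p t / poly q t \<and> 0 \<le> poly r t / poly s t) \<and> poly q t \<noteq> 0 \<and> poly s t \<noteq> 0"
      then have "0 \<le> (poly p t / poly q t) * (poly r t / poly s t)" by (intro mult_nonneg_nonneg) auto
      then show "0 \<le> poly (p * r) t / poly (q * s) t" by simp
    qed
    then show "x * y \<in> eval_ordering C" using x y by (simp add: iff)
  qed
  have total: "x \<in> eval_ordering C \<or> - x \<in> eval_ordering C" for x
  proof -
    obtain p q where x: "x = Fract p q" "q \<noteq> 0" by (cases x)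
    show ?thesis
    proof (cases "p = 0")
      case True
      then show ?thesis using x by (auto simp: iff intro: near_cut_True)
    next
      case False
      then have "p * q \<noteq> 0" using x by simp
      then have "near_cut C (\<lambda>t. poly (p * q) t > 0) \<or> near_cut C (\<lambda>t. poly (p * q) t < 0)"
        by (rule near_cut_sign[OF rc C])
      then have "near_cut C (\<lambda>t. 0 \<le> poly p t / poly q t) \<or> near_cut C (\<lambda>t. 0 \<le> poly (- p) t / poly q t)"
      proof
        assume "near_cut C (\<lambda>t. poly (p * q) t > 0)"
        then have "near_cut C (\<lambda>t. 0 \<le> poly p t / poly q t)"
          by (rule near_cut_mono) (auto simp: zero_le_divide_iff zero_less_mult_iff)
        then show ?thesis ..
      next
        assume "near_cut C (\<lambda>t. poly (p * q) t < 0)"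
        then have "near_cut C (\<lambda>t. 0 \<le> poly (- p) t / poly q t)"
          by (rule near_cut_mono) (auto simp: divide_le_0_iff mult_less_0_iff)
        then show ?thesis ..
      qed
      then show ?thesis using x by (auto simp: iff)
    qed
  qed
  have anti: "x = 0" if "x \<in> eval_ordering C" "- x \<in> eval_ordering C" for x
  proof -
    obtain p q where x: "x = Fract p q" "q \<noteq> 0" by (cases x)
    have "near_cut C (\<lambda>t. 0 \<le> poly p t / poly q t)" "near_cut C (\<lambda>t. 0 \<le> poly (- p) t / poly q t)"
      using that x by (simp_all add: iff)
    moreover have "near_cut C (\<lambda>t. poly q t \<noteq> 0)" using nz x by blast
    ultimately have *: "near_cut C (\<lambda>t. (0 \<le> poly p t / poly q t \<and> 0 \<le> poly (- p) t / poly q t) \<and> poly q t \<noteq> 0)"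
      by (intro near_cut_conj)
    have "p = 0"
    proof (rule ccontr)
      assume "p \<noteq> 0"
      then have "near_cut C (\<lambda>t. ((0 \<le> poly p t / poly q t \<and> 0 \<le> poly (- p) t / poly q t) \<and> poly q t \<noteq> 0) \<and> poly p t \<noteq> 0)"
        by (intro near_cut_conj * nz)
      from near_cut_ex[OF C this] show False by (auto simp: zero_le_divide_iff divide_le_0_iff)
    qed
    then show ?thesis using x by (simp add: Fract_zero_iff)
  qed
  have zero: "0 \<in> eval_ordering C"
    using total[of 0] by simp
  have "x \<in> eval_ordering C \<union> uminus ` eval_ordering C" for x
    using total[of x] by (metis UnCI image_eqI minus_minus)
  moreover have "eval_ordering C \<inter> uminus ` eval_ordering C = {0}"
    using anti zero by (force simp: image_iff)
  ultimately show ?thesis unfolding field_ordering_def using add mult by blast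
qed

text \<open>\<open>chi\<close> is a definite description: evaluation near the cut gives existence
  and \<open>ordering_eqI\<close> uniqueness.\<close>

lemma chi:
  assumes rc: "real_closed TYPE('a::linordered_field)" and C: "(C :: 'a set \<times> 'a set) \<in> cuts"
  shows field_ordering_chi: "field_ordering (chi C)"
    and fst_chi: "fst C = {d. rf_y - rf_const d \<in> chi C}"
proof -
  have "d \<in> fst C \<longleftrightarrow> rf_y - rf_const d \<in> eval_ordering C" for d
  proof -
    have "near_cut C (\<lambda>t. d \<le> t) \<Longrightarrow> d \<in> fst C"
      using near_cut_snd[OF C, of d] near_cut_conj[of C "\<lambda>t. d \<le> t" "\<lambda>t. t < d"] near_cut_ex[OF C]
      by (metis (no_types, lifting) leD)
    moreover have "d \<in> fst C \<Longrightarrow> near_cut C (\<lambda>t. d \<le> t)"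
      by (auto dest!: near_cut_fst[OF C] elim!: near_cut_mono)
    ultimately show ?thesis unfolding rf_y_diff by (auto simp: Fract_in_eval_ordering[OF rc C])
  qed
  then have "field_ordering (eval_ordering C) \<and> fst C = {d. rf_y - rf_const d \<in> eval_ordering C}"
    using field_ordering_eval_ordering[OF rc C] by blast
  then have "field_ordering (chi C) \<and> fst C = {d. rf_y - rf_const d \<in> chi C}"
    unfolding chi_def
  proof (rule theI, goal_cases)
    case (1 P)
    then show ?case
      using \<open>field_ordering (eval_ordering C) \<and> fst C = {d. rf_y - rf_const d \<in> eval_ordering C}\<close>
      by (intro ordering_eqI[OF rc]) auto
  qed
  then show "field_ordering (chi C)" "fst C = {d. rf_y - rf_const d \<in> chi C}" by blast+
qed

lemma chi_eqI:
  assumes rc: "real_closed TYPE('a::linordered_field)" and "(C :: 'a set \<times> 'a set) \<in> cuts"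
    and "field_ordering P" "fst C = {d. rf_y - rf_const d \<in> P}"
  shows "chi C = P"
  using ordering_eqI[OF rc field_ordering_chi[OF rc] assms(3)] fst_chi[OF rc] assms by metis

lemma (in rational_ordered_by) chi_cut_of: "chi cut_of = P"
  by (rule chi_eqI[OF rc cut_of_in_cuts ordering]) (simp add: cut_of_def)

section \<open>The place of an ordering\<close>

context ordered_by
begin

text \<open>The Dedekind description of the value of \<open>lam P\<close>. It is symmetric under
  negation, unlike the supremum in \<open>lam\<close>, and leaves a rational equal to
  \<open>r\<close> undecided, since \<open>x\<close> may be infinitely close to it on either
  side.\<close>

definition real_value :: "'k \<Rightarrow> real \<Rightarrow> bool" where
  "real_value x r \<longleftrightarrow> (\<forall>q. of_rat q < r \<longrightarrow> x - of_rat q \<in> P) \<and> (\<forall>q. r < of_rat q \<longrightarrow> of_rat q - x \<in> P)"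

definition bounded_elem :: "'k \<Rightarrow> bool" where
  "bounded_elem x \<longleftrightarrow> (\<exists>n::nat. of_nat n - x \<in> P \<and> of_nat n + x \<in> P)"

lemma bounded_elem_rat_iff: "bounded_elem x \<longleftrightarrow> (\<exists>q q'. x - of_rat q \<in> P \<and> of_rat q' - x \<in> P)"
proof
  assume "bounded_elem x"
  then obtain n where "of_nat n - x \<in> P" "of_nat n + x \<in> P" unfolding bounded_elem_def by blast
  then show "\<exists>q q'. x - of_rat q \<in> P \<and> of_rat q' - x \<in> P"
    by (intro exI[of _ "- of_nat n"] exI[of _ "of_nat n"]) (simp add: of_rat_minus add.commute)
next
  assume "\<exists>q q'. x - of_rat q \<in> P \<and> of_rat q' - x \<in> P"
  then obtain q q' where q: "x - of_rat q \<in> P" "of_rat q' - x \<in> P" by blast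
  obtain n :: nat where n: "of_nat n \<ge> max q' (- q)" using real_arch_simple by blast
  have "of_rat (of_nat n - q') + (of_rat q' - x) \<in> P" "of_rat (of_nat n + q) + (x - of_rat q) \<in> P"
    using n by (intro P_add q, simp add: P_of_rat)+
  then show "bounded_elem x"
    unfolding bounded_elem_def by (intro exI[of _ n]) (simp add: of_rat_diff of_rat_add algebra_simps)
qed

lemma real_value_unique:
  assumes "real_value x r" "real_value x s" shows "r = s"
proof (rule ccontr)
  assume "r \<noteq> s"
  have False if lt: "r < s" and v: "real_value x r" "real_value x s" for r s
  proof -
    obtain q where q: "r < of_rat q" "of_rat q < s" using of_rat_dense[OF lt] by blast
    obtain q' where q': "real_of_rat q < of_rat q'" "of_rat q' < s" using of_rat_dense[OF q(2)] by blast
    then have "of_rat q - x \<in> P" "x - of_rat q' \<in> P" using v q q' unfolding real_value_def by blast+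
    then have "of_rat (q - q') \<in> P" using P_add by (fastforce simp: of_rat_diff)
    then show False using q'(1) by (simp add: P_of_rat of_rat_less)
  qed
  then show False using assms \<open>r \<noteq> s\<close> by (metis linorder_neqE)
qed

lemma real_value_imp_bounded: "real_value x r \<Longrightarrow> bounded_elem x"
  unfolding bounded_elem_rat_iff real_value_def by (metis of_rat_dense lt_ex gt_ex)

lemma lam_set_eq:
  "{real_of_int m / real n | m n. 0 < n \<and> of_nat n * x - of_int m \<in> P} = {of_rat q | q. x - of_rat q \<in> P}"
proof -
  have *: "of_nat n * x - of_int m \<in> P \<longleftrightarrow> x - of_rat (of_int m / of_nat n) \<in> P" if "0 < n" for m and n :: nat
  proof -
    have nz: "(of_nat n :: 'k) \<noteq> 0" using that by simp
    have eq: "of_nat n * x - of_int m = of_nat n * (x - of_rat (of_int m / of_nat n))"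
      using nz by (simp add: of_rat_divide right_diff_distrib)
    show ?thesis unfolding eq using P_mult[OF P_of_nat] P_cancel[OF P_of_nat nz] by blast
  qed
  show ?thesis
  proof (intro equalityI subsetI)
    fix y :: real assume "y \<in> {real_of_int m / real n | m n. 0 < n \<and> of_nat n * x - of_int m \<in> P}"
    then obtain m n where mn: "y = real_of_int m / real n" "0 < n" "of_nat n * x - of_int m \<in> P" by blast
    then have "y = of_rat (of_int m / of_nat n)" by (simp add: of_rat_divide)
    then show "y \<in> {of_rat q | q. x - of_rat q \<in> P}" using * mn by blast
  next
    fix y :: real assume "y \<in> {of_rat q | q. x - of_rat q \<in> P}"
    then obtain q where q: "y = of_rat q" "x - of_rat q \<in> P" by blast
    obtain a b where ab: "quotient_of q = (a, b)" by (cases "quotient_of q")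
    then have "b > 0" "q = of_int a / of_int b" using quotient_of_div quotient_of_denom_pos by auto
    then have q': "q = of_int a / of_nat (nat b)" "0 < nat b" by simp_all
    have "of_nat (nat b) * x - of_int a \<in> P" using *[OF q'(2)] q(2) unfolding q' by blast
    then show "y \<in> {real_of_int m / real n | m n. 0 < n \<and> of_nat n * x - of_int m \<in> P}"
      using q'(2) unfolding q(1) q'(1)
      by (intro CollectI exI[of _ a] exI[of _ "nat b"]) (auto simp: of_rat_divide)
  qed
qed

lemma real_value_Sup:
  assumes "bounded_elem x" shows "real_value x (Sup {of_rat q | q. x - of_rat q \<in> P})"
proof -
  let ?S = "{of_rat q :: real | q. x - of_rat q \<in> P}"
  obtain q0 q1 where q: "x - of_rat q0 \<in> P" "of_rat q1 - x \<in> P"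
    using assms unfolding bounded_elem_rat_iff by blast
  have ne: "?S \<noteq> {}" using q by blast
  have bdd: "bdd_above ?S"
  proof (rule bdd_aboveI)
    fix y assume "y \<in> ?S"
    then obtain q' where "y = of_rat q'" "x - of_rat q' \<in> P" by blast
    then have "of_rat (q1 - q') \<in> P" using P_add[OF q(2)] by (fastforce simp: of_rat_diff)
    then show "y \<le> of_rat q1" using \<open>y = of_rat q'\<close> by (simp add: P_of_rat of_rat_less_eq)
  qed
  show ?thesis unfolding real_value_def
  proof (intro conjI allI impI)
    fix q assume "of_rat q < Sup ?S"
    then obtain q' where q': "x - of_rat q' \<in> P" "(of_rat q :: real) < of_rat q'"
      using less_cSup_iff[OF ne bdd] by blast
    then have "of_rat (q' - q) \<in> P" unfolding P_of_rat by (simp add: of_rat_less)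
    then show "x - of_rat q \<in> P" using P_add[OF q'(1)] by (fastforce simp: of_rat_diff)
  next
    fix q assume "Sup ?S < of_rat q"
    then have "of_rat q \<notin> ?S" using cSup_upper[OF _ bdd] by fastforce
    then show "of_rat q - x \<in> P" using P_or_neg[of "x - of_rat q"] by auto
  qed
qed

lemma lam_eq_Some_iff: "lam P x = Some r \<longleftrightarrow> real_value x r"
proof (cases "bounded_elem x")
  case True
  then show ?thesis
    using real_value_Sup[OF True] real_value_unique
    unfolding lam_def bounded_elem_def[symmetric] lam_set_eq by auto
next
  case False
  then show ?thesis
    using real_value_imp_bounded unfolding lam_def bounded_elem_def[symmetric] by auto
qed

lemma lam_eq_None_iff: "lam P x = None \<longleftrightarrow> \<not> bounded_elem x"
  unfolding lam_def bounded_elem_def by auto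

lemma bounded_elem_real_value: "bounded_elem x \<Longrightarrow> \<exists>r. real_value x r"
  using real_value_Sup by blast

lemma real_value_minus: "real_value x r \<Longrightarrow> real_value (- x) (- r)"
  unfolding real_value_def
proof (intro conjI allI impI; elim conjE)
  fix q assume *: "\<forall>q. real_of_rat q < r \<longrightarrow> x - of_rat q \<in> P" "\<forall>q. r < real_of_rat q \<longrightarrow> of_rat q - x \<in> P"
  show "of_rat q < - r \<Longrightarrow> - x - of_rat q \<in> P"
  proof -
    assume "of_rat q < - r"
    then have "of_rat (- q) - x \<in> P" using *(2)[rule_format, of "-q"] by (simp add: of_rat_minus)
    also have "of_rat (- q) - x = - x - of_rat q" by (simp add: of_rat_minus)
    finally show ?thesis .
  qed
  show "- r < of_rat q \<Longrightarrow> of_rat q - - x \<in> P"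
    using *(1)[rule_format, of "-q"] by (simp add: of_rat_minus algebra_simps)
qed

lemma real_value_add_lower:
  assumes "real_value x r" "real_value y s" "of_rat q < r + s" shows "x + y - of_rat q \<in> P"
proof -
  have "of_rat q - s < r" using assms by simp
  then obtain q1 where q1: "of_rat q - s < of_rat q1" "of_rat q1 < r" using of_rat_dense by blast
  then have "of_rat (q - q1) < s" by (simp add: of_rat_diff)
  then have "(x - of_rat q1) + (y - of_rat (q - q1)) \<in> P"
    using assms q1 unfolding real_value_def by (intro P_add) blast+
  then show ?thesis by (simp add: of_rat_diff algebra_simps)
qed

lemma real_value_add: 
  assumes "real_value x r" "real_value y s" shows "real_value (x + y) (r + s)"
  unfolding real_value_def
proof (intro conjI allI impI)
  fix q show "of_rat q < r + s \<Longrightarrow> x + y - of_rat q \<in> P" by (rule real_value_add_lower[OF assms])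
  assume "r + s < of_rat q"
  then have "of_rat (- q) < - r + - s" by (simp add: of_rat_minus)
  from real_value_add_lower[OF real_value_minus[OF assms(1)] real_value_minus[OF assms(2)] this]
  show "of_rat q - (x + y) \<in> P" by (simp add: of_rat_minus algebra_simps)
qed

lemma real_value_of_rat: "real_value (of_rat q) (of_rat q)"
  unfolding real_value_def by (simp add: of_rat_less P_of_rat flip: of_rat_diff)

lemma real_value_scale:
  assumes "real_value x r" "0 < c" shows "real_value (of_rat c * x) (of_rat c * r)"
  unfolding real_value_def
proof (intro conjI allI impI)
  have c: "of_rat c \<in> P" using assms by (simp add: P_of_rat)
  have c': "0 < real_of_rat c" using assms by simp
  fix q
  { assume "of_rat q < of_rat c * r"
    then have "of_rat (q / c) < r" using c' by (simp add: of_rat_divide field_simps)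
    then have "of_rat c * (x - of_rat (q / c)) \<in> P" using assms c unfolding real_value_def by (intro P_mult) blast+
    then show "of_rat c * x - of_rat q \<in> P" using assms by (simp add: of_rat_divide right_diff_distrib) }
  { assume "of_rat c * r < of_rat q"
    then have "r < of_rat (q / c)" using c' by (simp add: of_rat_divide field_simps)
    then have "of_rat c * (of_rat (q / c) - x) \<in> P" using assms c unfolding real_value_def by (intro P_mult) blast+
    then show "of_rat q - of_rat c * x \<in> P" using assms by (simp add: of_rat_divide right_diff_distrib) }
qed

text \<open>Squares come before products to avoid sign cases for two factors. For nonnegative
  \<open>r\<close> both comparisons rest on factoring \<open>x * x - s * s\<close> with a rational
  \<open>s\<close> near \<open>r\<close>; a negative \<open>r\<close> is treated through
  \<open>- x\<close>. General products then follow by polarization.\<close>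

lemma real_value_square:
  assumes "real_value x r" shows "real_value (x * x) (r * r)"
proof -
  have nonneg: "real_value (x * x) (r * r)" if v: "real_value x r" and r: "0 \<le> r" for x r
    unfolding real_value_def
  proof (intro conjI allI impI)
    fix q
    { assume lt: "of_rat q < r * r"
      show "x * x - of_rat q \<in> P"
      proof (cases "q < 0")
        case True
        then have "of_rat (- q) \<in> P" by (simp add: P_of_rat)
        then show ?thesis using P_add[OF P_square[of x]] by (fastforce simp: of_rat_minus)
      next
        case False
        then have "sqrt (of_rat q) < r" using lt r by (intro real_less_lsqrt) (simp_all add: power2_eq_square)
        then obtain s where s: "sqrt (of_rat q) < of_rat s" "of_rat s < r" using of_rat_dense by blast
        have "0 \<le> sqrt (of_rat q)" using False by simp
        then have s0: "0 \<le> real_of_rat s" using s(1) by linarith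
        then have s0': "of_rat (2 * s) \<in> P" by (simp add: P_of_rat)
        have "real_of_rat q < of_rat s * of_rat s"
          using real_sqrt_less_iff[of "of_rat q" "of_rat s * of_rat s"] s(1) s0 by simp
        then have "q \<le> s * s" by (metis less_imp_le of_rat_less of_rat_mult)
        then have qs: "of_rat (s * s - q) \<in> P" by (simp add: P_of_rat)
        have xs: "x - of_rat s \<in> P" using v s unfolding real_value_def by blast
        have xs': "of_rat (2 * s) + (x - of_rat s) \<in> P" by (rule P_add[OF s0' xs])
        have "(x - of_rat s) * (of_rat (2 * s) + (x - of_rat s)) + of_rat (s * s - q) \<in> P"
          by (rule P_add[OF P_mult[OF xs xs'] qs])
        then show ?thesis by (simp add: of_rat_diff of_rat_mult algebra_simps)
      qed }
    { assume lt: "r * r < of_rat q"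
      then have "r < sqrt (of_rat q)" by (simp add: real_less_rsqrt power2_eq_square)
      then obtain s where s: "r < of_rat s" "of_rat s < sqrt (of_rat q)" using of_rat_dense by blast
      have s0: "0 \<le> real_of_rat s" using s r by linarith
      have "0 \<le> real_of_rat q" using lt by (meson less_imp_le order_trans zero_le_square)
      then have "of_rat s * of_rat s < real_of_rat q"
        using real_sqrt_less_iff[of "of_rat s * of_rat s" "of_rat q"] s(2) s0 by simp
      then have "s * s \<le> q" by (metis less_imp_le of_rat_less of_rat_mult)
      then have qs: "of_rat (q - s * s) \<in> P" by (simp add: P_of_rat)
      have "of_rat s - x \<in> P" using v s unfolding real_value_def by blast
      moreover have "x - of_rat (- s) \<in> P"
      proof -
        have "of_rat (- s) < r" using s r s0 by (simp add: of_rat_minus)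
        then show ?thesis using v unfolding real_value_def by blast
      qed
      ultimately have "(of_rat s - x) * (x - of_rat (- s)) + of_rat (q - s * s) \<in> P"
        by (intro P_add P_mult qs)
      then show "of_rat q - x * x \<in> P" by (simp add: of_rat_diff of_rat_mult of_rat_minus algebra_simps) }
  qed
  show ?thesis
  proof (cases "0 \<le> r")
    case False
    then show ?thesis using nonneg[OF real_value_minus[OF assms]] by simp
  qed (use nonneg assms in blast)
qed

lemma real_value_mult:
  assumes "real_value x r" "real_value y s" shows "real_value (x * y) (r * s)"
proof -
  have "real_value ((x + y) * (x + y) + (- (x * x) + - (y * y))) ((r + s) * (r + s) + (- (r * r) + - (s * s)))"
    by (intro real_value_add real_value_square real_value_minus assms)
  from real_value_scale[OF this, of "1/2"] show ?thesis
    by (simp add: of_rat_divide algebra_simps)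
qed

lemma real_value_inverse_bounded:
  assumes "real_value x r" "r \<noteq> 0" shows "bounded_elem (inverse x)"
proof -
  have pos: "bounded_elem (inverse x)" if v: "real_value x r" and r0: "0 < r" for x r
  proof -
    obtain q where q: "0 < real_of_rat q" "of_rat q < r" using of_rat_dense[OF r0] by blast
    then have xq: "x - of_rat q \<in> P" using v unfolding real_value_def by blast
    have qP: "of_rat q \<in> P" using q by (simp add: P_of_rat)
    then have xP: "x \<in> P" using P_add[OF xq qP] by simp
    have x0: "x \<noteq> 0" using P_antisym[OF qP] xq q by auto
    have "(x - of_rat q) / (x * of_rat q) \<in> P" by (intro P_divide P_mult xq xP qP)
    also have "(x - of_rat q) / (x * of_rat q) = of_rat (inverse q) - inverse x"
      using q x0 by (simp add: of_rat_inverse diff_frac_eq inverse_eq_divide of_rat_divide)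
    finally show ?thesis using P_inverse[OF xP] unfolding bounded_elem_rat_iff
      by (intro exI[of _ 0] exI[of _ "inverse q"]) simp
  qed
  have neg: "bounded_elem (- x)" if "bounded_elem x" for x
    using that unfolding bounded_elem_def by auto
  show ?thesis
  proof (cases "0 < r")
    case False
    then show ?thesis using pos[OF real_value_minus[OF assms(1)]] neg[of "inverse (- x)"] assms(2) by simp
  qed (use pos assms in blast)
qed

text \<open>Not being bounded by 1, the element or its negative is at least 1, and so its inverse
  lies between -1 and 1.\<close>

lemma not_bounded_inverse_bounded:
  assumes "\<not> bounded_elem x" shows "bounded_elem (inverse x)"
proof -
  have x0: "x \<noteq> 0" using assms unfolding bounded_elem_def using P_0 by (metis add_0 diff_zero of_nat_0)
  have "\<not> (1 - x \<in> P \<and> 1 + x \<in> P)" using assms unfolding bounded_elem_def by (metis of_nat_1)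
  then have "x - 1 \<in> P \<or> - x - 1 \<in> P"
    using P_or_neg[of "x - 1"] P_or_neg[of "- x - 1"] by auto
  then show ?thesis
  proof
    assume a: "x - 1 \<in> P"
    then have xP: "x \<in> P" using P_add[OF a P_1] by simp
    have "(x - 1) / x \<in> P" by (intro P_divide a xP)
    then have "1 - inverse x \<in> P" using x0 by (simp add: field_simps)
    moreover have "1 + inverse x \<in> P" by (intro P_add P_1 P_inverse xP)
    ultimately show ?thesis unfolding bounded_elem_def by (intro exI[of _ 1]) simp
  next
    assume a: "- x - 1 \<in> P"
    then have xP: "- x \<in> P" using P_add[OF a P_1] by simp
    have "(- x - 1) / (- x) \<in> P" by (intro P_divide a xP)
    moreover have "(- x - 1) / (- x) = 1 + inverse x" using x0 by (simp add: field_simps)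
    ultimately have "1 + inverse x \<in> P" by simp
    moreover have "1 + inverse (- x) \<in> P" by (intro P_add P_1 P_inverse xP)
    ultimately show ?thesis unfolding bounded_elem_def by (intro exI[of _ 1]) simp
  qed
qed

lemma real_value_0: "real_value 0 0" and real_value_1: "real_value 1 1"
  using real_value_of_rat[of 0] real_value_of_rat[of 1] by simp_all

theorem R_place_lam: "R_place (lam P)"
proof -
  have fin: "lam P x \<noteq> None \<longleftrightarrow> (\<exists>r. real_value x r)" for x
    by (metis lam_eq_Some_iff not_None_eq)
  have val: "real_value x r \<Longrightarrow> the (lam P x) = r" for x r by (metis lam_eq_Some_iff option.sel)
  have inv0: "\<not> (\<exists>s. real_value (inverse x) s)" if "real_value x 0" "x \<noteq> 0" for x
    using real_value_mult[OF that(1)] real_value_unique[OF real_value_1] that(2)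
    by (metis mult_zero_left right_inverse zero_neq_one)
  show ?thesis unfolding R_place_def Let_def mem_Collect_eq fin
  proof (intro conjI ballI allI impI)
    show "\<exists>r. real_value 0 r" "\<exists>r. real_value 1 r" "the (lam P 1) = 1"
      using real_value_0 real_value_1 val by blast+
  next
    fix a b assume "a \<in> {x. \<exists>r. real_value x r}" "b \<in> {x. \<exists>r. real_value x r}"
    then obtain r s where rs: "real_value a r" "real_value b s" by blast
    show "\<exists>r. real_value (a + b) r" "\<exists>r. real_value (a * b) r" "\<exists>r. real_value (- a) r"
      using real_value_add real_value_mult real_value_minus rs by blast+
    show "the (lam P (a + b)) = the (lam P a) + the (lam P b)"
      using val[OF real_value_add[OF rs]] val[OF rs(1)] val[OF rs(2)] by simp
    show "the (lam P (a * b)) = the (lam P a) * the (lam P b)"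
      using val[OF real_value_mult[OF rs]] val[OF rs(1)] val[OF rs(2)] by simp
  next
    fix x assume "\<not> (\<exists>r. real_value x r)"
    then show "\<exists>r. real_value (inverse x) r"
      using not_bounded_inverse_bounded bounded_elem_real_value by blast
  next
    fix x assume "x \<in> {x. \<exists>r. real_value x r}"
    then obtain r where r: "real_value x r" by blast
    show "the (lam P x) = 0 \<longleftrightarrow> x = 0 \<or> \<not> (\<exists>r. real_value (inverse x) r)"
      unfolding val[OF r]
      using inv0 real_value_inverse_bounded[OF r] bounded_elem_real_value real_value_unique[OF r] real_value_0 r
      by metis
  qed
qed

lemma lam_in_places: "lam P \<in> places"
  using R_place_lam by (simp add: places_def)

text \<open>Positivity of \<open>b\<close> alone does not suffice, since the place may send a
  positive \<open>b\<close> to 0 or to infinity; the rational bounds exclude both. The condition is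
  now a union of sign conditions, which is how \<open>H'\<close> is pulled back to cuts.\<close>

lemma lam_in_H'_iff: "lam P \<in> H' b \<longleftrightarrow> (\<exists>q>0. b - of_rat q \<in> P) \<and> (\<exists>q. of_rat q - b \<in> P)"
proof
  assume "lam P \<in> H' b"
  then obtain r where "lam P b = Some r" and r0: "r > 0" by (auto simp: H'_def)
  then have r: "real_value b r" by (simp add: lam_eq_Some_iff)
  then obtain q q' where "0 < real_of_rat q" "of_rat q < r" "r < of_rat q'"
    using of_rat_dense[OF r0] of_rat_dense[of r "r + 1"] by auto
  then show "(\<exists>q>0. b - of_rat q \<in> P) \<and> (\<exists>q. of_rat q - b \<in> P)"
    using r unfolding real_value_def by (metis zero_less_of_rat_iff)
next
  assume "(\<exists>q>0. b - of_rat q \<in> P) \<and> (\<exists>q. of_rat q - b \<in> P)"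
  then obtain q q' where q: "0 < q" "b - of_rat q \<in> P" "of_rat q' - b \<in> P" by blast
  then obtain r where r: "real_value b r" using bounded_elem_rat_iff bounded_elem_real_value by blast
  have "\<not> r \<le> 0"
  proof
    assume "r \<le> 0"
    then have "r < of_rat (q / 2)" using q by (meson half_gt_zero le_less_trans zero_less_of_rat_iff)
    then have "of_rat (q / 2) - b \<in> P" using r unfolding real_value_def by blast
    from P_add[OF q(2) this] have "of_rat (q / 2 - q) \<in> P" unfolding of_rat_diff by simp
    then show False using q by (simp add: P_of_rat)
  qed
  then show "lam P \<in> H' b" using r lam_in_places by (auto simp: H'_def lam_eq_Some_iff[THEN iffD2])
qed

end

section \<open>The space of places\<close>

locale real_place =
  fixes \<zeta> :: "'k::field_char_0 \<Rightarrow> real option"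
  assumes place: "R_place \<zeta>"
begin

lemma ev_0: "\<zeta> 0 = Some 0" and ev_1: "\<zeta> 1 = Some 1"
  using place unfolding R_place_def Let_def by auto

lemma ev_closed:
  "\<zeta> a \<noteq> None \<Longrightarrow> \<zeta> b \<noteq> None \<Longrightarrow> \<zeta> (a + b) \<noteq> None \<and> \<zeta> (a * b) \<noteq> None \<and> \<zeta> (- a) \<noteq> None"
  "\<zeta> a \<noteq> None \<Longrightarrow> \<zeta> b \<noteq> None \<Longrightarrow>
    the (\<zeta> (a + b)) = the (\<zeta> a) + the (\<zeta> b) \<and> the (\<zeta> (a * b)) = the (\<zeta> a) * the (\<zeta> b)"
  "\<zeta> a \<noteq> None \<Longrightarrow> the (\<zeta> a) = 0 \<longleftrightarrow> a = 0 \<or> \<zeta> (inverse a) = None"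
  "a \<noteq> 0 \<Longrightarrow> \<zeta> a = None \<Longrightarrow> \<zeta> (inverse a) \<noteq> None"
  using place unfolding R_place_def Let_def by (simp_all del: not_None_eq)

lemma ev_add: "\<zeta> x = Some a \<Longrightarrow> \<zeta> y = Some b \<Longrightarrow> \<zeta> (x + y) = Some (a + b)"
  using ev_closed(1,2)[of x y] by auto

lemma ev_mult: "\<zeta> x = Some a \<Longrightarrow> \<zeta> y = Some b \<Longrightarrow> \<zeta> (x * y) = Some (a * b)"
  using ev_closed(1,2)[of x y] by auto

lemma ev_minus: "\<zeta> x = Some a \<Longrightarrow> \<zeta> (- x) = Some (- a)"
proof -
  assume x: "\<zeta> x = Some a"
  then have "\<zeta> (- x) \<noteq> None"
    using ev_closed(1)[of x x] by simp
  then obtain b where b: "\<zeta> (- x) = Some b" by blast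
  then show ?thesis using ev_add[OF x b] ev_0 by simp
qed

lemma ev_diff: "\<zeta> x = Some a \<Longrightarrow> \<zeta> y = Some b \<Longrightarrow> \<zeta> (x - y) = Some (a - b)"
  using ev_add[OF _ ev_minus] by fastforce

lemma ev_inverse_None: "\<zeta> x = None \<Longrightarrow> \<zeta> (inverse x) = Some 0"
proof -
  assume x: "\<zeta> x = None"
  then have "x \<noteq> 0" using ev_0 by auto
  then have "\<zeta> (inverse x) \<noteq> None" using ev_closed(4)[of x] x by simp
  then obtain b where b: "\<zeta> (inverse x) = Some b" by blast
  moreover have "the (\<zeta> (inverse x)) = 0"
    using ev_closed(3)[of "inverse x"] b x by simp
  ultimately show ?thesis by simp
qed

lemma ev_inverse: "\<zeta> x = Some a \<Longrightarrow> a \<noteq> 0 \<Longrightarrow> \<zeta> (inverse x) = Some (inverse a)"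
proof -
  assume x: "\<zeta> x = Some a" and a: "a \<noteq> 0"
  then have x0: "x \<noteq> 0" using ev_0 by auto
  then have "\<zeta> (inverse x) \<noteq> None" using ev_closed(3)[of x] x a by auto
  then obtain b where b: "\<zeta> (inverse x) = Some b" by blast
  have "a * b = 1" using ev_mult[OF x b] x0 ev_1 by simp
  then show ?thesis using b by (metis inverse_unique)
qed

lemma ev_inverse_0: "\<zeta> x = Some 0 \<Longrightarrow> x \<noteq> 0 \<Longrightarrow> \<zeta> (inverse x) = None"
  using ev_mult[of x 0 "inverse x"] ev_1 by (cases "\<zeta> (inverse x)") auto

lemma ev_of_nat: "\<zeta> (of_nat n) = Some (of_nat n)"
  using ev_0 ev_add[OF ev_1] by (induction n) auto

lemma ev_of_int: "\<zeta> (of_int n) = Some (of_int n)"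
  using ev_of_nat ev_minus[OF ev_of_nat] by (cases n rule: int_cases2) auto

lemma ev_of_rat: "\<zeta> (of_rat q) = Some (of_rat q)"
proof -
  obtain a b where "quotient_of q = (a, b)" by (cases "quotient_of q")
  then have q: "q = of_int a / of_int b" "b > 0" using quotient_of_div quotient_of_denom_pos by auto
  have "\<zeta> (of_int a / of_int b) = Some (of_int a / of_int b)"
    unfolding divide_inverse using q(2) by (intro ev_mult ev_inverse ev_of_int) simp
  then show ?thesis using q by (simp add: of_rat_divide)
qed

lemma ev_None_mult: "\<zeta> x = None \<Longrightarrow> \<zeta> y = Some b \<Longrightarrow> b \<noteq> 0 \<Longrightarrow> \<zeta> (x * y) = None"
proof (cases "\<zeta> (x * y)")
  case (Some c)
  assume *: "\<zeta> x = None" "\<zeta> y = Some b" "b \<noteq> 0"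
  then have "y \<noteq> 0" using ev_0 by auto
  then show ?thesis using ev_mult[OF Some ev_inverse[OF *(2,3)]] *(1) by (simp add: mult.assoc)
qed simp

text \<open>A test function that is finite at every real place and vanishes exactly where
  \<open>x\<close> is infinite. It separates two places of which only one is infinite at
  \<open>x\<close>.\<close>

lemma ev_inverse_1_square:
  "\<zeta> (inverse (1 + x * x)) = Some (case \<zeta> x of None \<Rightarrow> 0 | Some r \<Rightarrow> inverse (1 + r * r))"
proof (cases "\<zeta> x")
  case None
  have x0: "x \<noteq> 0" using None ev_0 by auto
  let ?z = "inverse x"
  have z: "\<zeta> ?z = Some 0" by (rule ev_inverse_None[OF None])
  have "\<zeta> (?z * ?z * inverse (1 + ?z * ?z)) = Some (0 * 0 * inverse (1 + 0 * 0))"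
    by (intro ev_mult ev_inverse ev_add ev_1 z) simp
  moreover have "?z * ?z * inverse (1 + ?z * ?z) = inverse (1 + x * x)"
  proof -
    have "\<zeta> (1 + ?z * ?z) = Some (1 + 0 * 0)" by (intro ev_mult ev_add ev_1 z)
    then have "1 + ?z * ?z \<noteq> 0" using ev_0 by auto
    then have "inverse (?z * ?z * inverse (1 + ?z * ?z)) = x * x * (1 + ?z * ?z)"
      by simp
    also have "\<dots> = 1 + x * x" using x0 by (simp add: distrib_left) (simp add: field_simps)
    finally show ?thesis by (metis inverse_inverse_eq)
  qed
  ultimately show ?thesis using None by simp
next
  case (Some r)
  have "0 < 1 + r * r" by (simp add: add_pos_nonneg)
  then have "\<zeta> (inverse (1 + x * x)) = Some (inverse (1 + r * r))"
    by (intro ev_mult ev_inverse ev_add ev_1 Some) simp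
  then show ?thesis using Some by simp
qed

end

lemma places_separated_by_finite:
  assumes "\<zeta>1 \<in> places" "\<zeta>2 \<in> places" "\<zeta>1 \<noteq> (\<zeta>2 :: 'k::field_char_0 \<Rightarrow> _)"
  obtains z a b where "\<zeta>1 z = Some a" "\<zeta>2 z = Some b" "a \<noteq> b"
proof -
  interpret p1: real_place \<zeta>1 using assms by (simp add: places_def real_place_def)
  interpret p2: real_place \<zeta>2 using assms by (simp add: places_def real_place_def)
  obtain x where x: "\<zeta>1 x \<noteq> \<zeta>2 x" using assms by blast
  have pos: "inverse (1 + r * r) \<noteq> (0::real)" for r
    by (metis add_pos_nonneg inverse_zero_imp_zero less_irrefl zero_le_square zero_less_one)
  show thesis
  proof (cases "\<zeta>1 x = None \<or> \<zeta>2 x = None")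
    case True
    then show thesis
      using that[OF p1.ev_inverse_1_square[of x] p2.ev_inverse_1_square[of x]] x pos
      by (auto split: option.splits)
  next
    case False
    then show thesis using x that by auto
  qed
qed

text \<open>Subtracting a rational strictly between the two finite values gives them opposite
  signs.\<close>

lemma places_separated:
  assumes "\<zeta>1 \<in> places" "\<zeta>2 \<in> places" "\<zeta>1 \<noteq> (\<zeta>2 :: 'k::field_char_0 \<Rightarrow> _)"
  shows "\<exists>b. \<zeta>1 \<in> H' b \<and> \<zeta>2 \<in> H' (- b)"
proof -
  have sep: "\<exists>b. \<zeta>1 \<in> H' b \<and> \<zeta>2 \<in> H' (- b)"
    if pl: "\<zeta>1 \<in> places" "\<zeta>2 \<in> places" "\<zeta>1 z = Some r" "\<zeta>2 z = Some s" and lt: "s < r" for \<zeta>1 \<zeta>2 :: "'k \<Rightarrow> _" and z r s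
  proof -
    interpret p1: real_place \<zeta>1 using that by (simp add: places_def real_place_def)
    interpret p2: real_place \<zeta>2 using that by (simp add: places_def real_place_def)
    obtain q where q: "s < of_rat q" "of_rat q < r" using of_rat_dense[OF lt] by blast
    have "\<zeta>1 (z - of_rat q) = Some (r - of_rat q)" "\<zeta>2 (- (z - of_rat q)) = Some (- (s - of_rat q))"
      by (intro p1.ev_diff p2.ev_diff p2.ev_minus p1.ev_of_rat p2.ev_of_rat that)+
    then show ?thesis using that q unfolding H'_def by (intro exI[of _ "z - of_rat q"]) simp
  qed
  obtain z r s where z: "\<zeta>1 z = Some r" "\<zeta>2 z = Some s" "r \<noteq> s"
    using places_separated_by_finite[OF assms] by blast
  show ?thesis
  proof (cases "s < r")
    case True
    then show ?thesis using sep assms z by blast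
  next
    case False
    then have "\<exists>b. \<zeta>2 \<in> H' b \<and> \<zeta>1 \<in> H' (- b)" using sep[OF assms(2,1) z(2,1)] z(3) by simp
    then obtain b where "\<zeta>2 \<in> H' b" "\<zeta>1 \<in> H' (- b)" by blast
    then show ?thesis by (intro exI[of _ "-b"]) simp
  qed
qed

lemma H'_disjoint: "H' b \<inter> H' (- b) = {}"
proof -
  have False if z: "\<zeta> \<in> H' b" "\<zeta> \<in> H' (- b)" for \<zeta>
  proof -
    have "\<zeta> \<in> places" using z unfolding H'_def by blast
    then have *: "\<forall>a\<in>{x. \<zeta> x \<noteq> None}. \<forall>b\<in>{x. \<zeta> x \<noteq> None}. the (\<zeta> (a + b)) = the (\<zeta> a) + the (\<zeta> b)"
      unfolding places_def R_place_def Let_def by blast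
    have z0: "the (\<zeta> 0) = 0" using \<open>\<zeta> \<in> places\<close> unfolding places_def R_place_def Let_def by blast
    have "the (\<zeta> (b + - b)) = the (\<zeta> b) + the (\<zeta> (- b))" using * z unfolding H'_def by blast
    then show False using z z0 unfolding H'_def by simp
  qed
  then show ?thesis by blast
qed

lemma H'_1: "H' 1 = (places :: ('k::field_char_0 \<Rightarrow> real option) set)"
proof -
  have "\<zeta> \<in> H' 1" if "\<zeta> \<in> places" for \<zeta> :: "'k \<Rightarrow> real option"
  proof -
    interpret real_place \<zeta> using that by (simp add: places_def real_place_def)
    show ?thesis using that ev_1 by (simp add: H'_def)
  qed
  then show ?thesis by (auto simp: H'_def)
qed

lemma topspace_places_top: "topspace (places_top :: ('k::field_char_0 \<Rightarrow> real option) topology) = places"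
proof -
  have "\<Union> (range H') = (places :: ('k \<Rightarrow> real option) set)" using H'_1 by (auto simp: H'_def)
  then show ?thesis unfolding places_top_def by simp
qed

lemma openin_H': "openin places_top (H' b)"
  unfolding places_top_def by (rule topology_generated_by_Basis) blast

lemma Hausdorff_places_top: "Hausdorff_space (places_top :: ('k::field_char_0 \<Rightarrow> real option) topology)"
  unfolding Hausdorff_space_def topspace_places_top
  using places_separated openin_H' H'_disjoint by (metis disjnt_def)

section \<open>Preorderings, and orderings inducing a given place\<close>

definition preordering :: "'k::field set \<Rightarrow> bool" where
  "preordering T \<longleftrightarrow> (\<forall>x\<in>T. \<forall>y\<in>T. x + y \<in> T \<and> x * y \<in> T) \<and> (\<forall>x. x * x \<in> T) \<and> -1 \<notin> T"

text \<open>The point is that -1 stays outside: from \<open>-1 = a + x * b\<close> follows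
  \<open>- x = (1 + a) / b\<close>, and dividing by \<open>b\<close> amounts to multiplying by
  \<open>b\<close> and by the square of its inverse.\<close>

lemma preordering_adjoin:
  assumes T: "preordering (T :: 'k::field set)" and neg: "- x \<notin> T"
  shows "preordering {a + x * b | a b. a \<in> T \<and> b \<in> T}" (is "preordering ?T'")
proof -
  note add = T[unfolded preordering_def, THEN conjunct1, rule_format, THEN conjunct1]
  note mult = T[unfolded preordering_def, THEN conjunct1, rule_format, THEN conjunct2]
  note sq = T[unfolded preordering_def, THEN conjunct2, THEN conjunct1, rule_format]
  have zero: "0 \<in> T" and one: "1 \<in> T" using sq[of 0] sq[of 1] by simp_all
  show ?thesis unfolding preordering_def
  proof (intro conjI ballI allI)
    fix u v assume "u \<in> ?T'" "v \<in> ?T'"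
    then obtain a b c d where u: "u = a + x * b" "a \<in> T" "b \<in> T" and v: "v = c + x * d" "c \<in> T" "d \<in> T" by blast
    have "u + v = (a + c) + x * (b + d)" by (simp add: u v algebra_simps)
    then show "u + v \<in> ?T'" using add[OF u(2) v(2)] add[OF u(3) v(3)] by blast
    have "u * v = (a * c + (x * x) * (b * d)) + x * (a * d + b * c)" by (simp add: u v algebra_simps)
    moreover have "a * c + (x * x) * (b * d) \<in> T" "a * d + b * c \<in> T"
      by (intro add mult sq u v)+
    ultimately show "u * v \<in> ?T'" by blast
  next
    fix u have "u * u = u * u + x * 0" by simp
    then show "u * u \<in> ?T'" using sq[of u] zero by blast
  next
    show "-1 \<notin> ?T'"
    proof
      assume "-1 \<in> ?T'"
      then obtain a b where ab: "-1 = a + x * b" "a \<in> T" "b \<in> T" by blast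
      have b0: "b \<noteq> 0" using ab T unfolding preordering_def by auto
      have "x * b = - 1 - a" using ab(1) by (metis add_diff_cancel_left')
      then have "1 + a = - (x * b)" by simp
      then have "- x = (1 + a) * b * (inverse b * inverse b)"
        using b0 by (simp add: mult.assoc[symmetric])
      then show False using neg add[OF one ab(2)] mult sq ab(3) by metis
    qed
  qed
qed

text \<open>A maximal preordering exists by Zorn's lemma and is total by
  \<open>preordering_adjoin\<close>. If it contained both \<open>x\<close> and \<open>- x\<close>
  with \<open>x\<close> nonzero, their product divided by the square of \<open>x\<close> would be
  -1.\<close>

lemma preordering_extends_to_ordering:
  assumes T0: "preordering (T0 :: 'k::field set)"
  obtains P where "field_ordering P" "T0 \<subseteq> P"
proof -
  define AA where "AA = {T. preordering T \<and> T0 \<subseteq> T}"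
  have "\<exists>N\<in>AA. \<forall>Y\<in>AA. N \<subseteq> Y \<longrightarrow> Y = N"
  proof (rule subset_Zorn_nonempty)
    show "AA \<noteq> {}" using T0 AA_def by blast
    fix CC assume ne: "CC \<noteq> {}" and chain: "subset.chain AA CC"
    have sub: "C \<in> CC \<Longrightarrow> preordering C \<and> T0 \<subseteq> C" for C
      using chain unfolding subset_chain_def AA_def by blast
    have common: "\<exists>C\<in>CC. x \<in> C \<and> y \<in> C" if xy: "x \<in> \<Union>CC" "y \<in> \<Union>CC" for x y
    proof -
      obtain C D where CD: "C \<in> CC" "x \<in> C" "D \<in> CC" "y \<in> D" using xy by blast
      then have "C \<subseteq> D \<or> D \<subseteq> C" using chain unfolding subset_chain_def by blast
      then show ?thesis using CD by blast
    qed
    have "preordering (\<Union>CC)"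
      unfolding preordering_def
    proof (intro conjI ballI allI)
      fix x y assume "x \<in> \<Union>CC" "y \<in> \<Union>CC"
      then obtain C where C: "C \<in> CC" "x \<in> C" "y \<in> C" using common by blast
      then have "x + y \<in> C" "x * y \<in> C" using sub unfolding preordering_def by blast+
      then show "x + y \<in> \<Union>CC" "x * y \<in> \<Union>CC" using C by blast+
    next
      obtain C where C: "C \<in> CC" using ne by blast
      then show "x * x \<in> \<Union>CC" for x using sub unfolding preordering_def by blast
      show "-1 \<notin> \<Union>CC" using sub unfolding preordering_def by blast
    qed
    then show "\<Union>CC \<in> AA" using sub ne unfolding AA_def by blast
  qed
  then obtain P where P: "preordering P" "T0 \<subseteq> P" "\<And>Y. preordering Y \<Longrightarrow> P \<subseteq> Y \<Longrightarrow> Y = P"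
    unfolding AA_def by (smt (verit) mem_Collect_eq subset_trans)
  have sq: "x * x \<in> P" for x using P(1) unfolding preordering_def by blast
  have zero: "0 \<in> P" and one: "1 \<in> P" using sq[of 0] sq[of 1] by simp_all
  have total: "x \<in> P \<or> - x \<in> P" for x
  proof (rule ccontr)
    assume n: "\<not> (x \<in> P \<or> - x \<in> P)"
    let ?P' = "{a + x * b | a b. a \<in> P \<and> b \<in> P}"
    have "a \<in> ?P'" if "a \<in> P" for a
      using that zero by (intro CollectI exI[of _ a] exI[of _ 0]) simp
    then have "?P' = P" using P(3)[OF preordering_adjoin[OF P(1)]] n by blast
    moreover have "x \<in> ?P'" using zero one by (intro CollectI exI[of _ 0] exI[of _ 1]) simp
    ultimately show False using n by blast
  qed
  have anti: "x = 0" if x: "x \<in> P" "- x \<in> P" for x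
  proof (rule ccontr)
    assume "x \<noteq> 0"
    have "x * - x * (inverse x * inverse x) \<in> P" using P(1) x sq[of "inverse x"] unfolding preordering_def by blast
    also have "x * - x * (inverse x * inverse x) = -1" using \<open>x \<noteq> 0\<close> by (simp add: field_simps)
    finally show False using P(1) unfolding preordering_def by blast
  qed
  have "x \<in> P \<union> uminus ` P" for x using total[of x] by (metis UnCI image_eqI minus_minus)
  moreover have "P \<inter> uminus ` P = {0}" using anti zero by (force simp: image_iff)
  ultimately have "field_ordering P"
    using P(1) unfolding field_ordering_def preordering_def by blast
  then show thesis using that P(2) by blast
qed

text \<open>The preordering generated by the units with positive residue. No sums are needed: if \<open>f s\<^sup>2\<close> and \<open>g t\<^sup>2\<close>
  are such units and \<open>s / t\<close> is finite, then so is \<open>(f + g) s\<^sup>2\<close>.\<close>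

definition place_cone :: "('k::field \<Rightarrow> real option) \<Rightarrow> 'k set" where
  "place_cone \<zeta> = {f. f = 0 \<or> (\<exists>s r. \<zeta> (f * (s * s)) = Some r \<and> 0 < r)}"

lemma (in real_place) preordering_place_cone: "preordering (place_cone \<zeta>)"
  unfolding preordering_def
proof (intro conjI ballI allI)
  fix f g assume fg: "f \<in> place_cone \<zeta>" "g \<in> place_cone \<zeta>"
  show "f + g \<in> place_cone \<zeta>"
  proof (cases "f = 0 \<or> g = 0")
    case False
    then obtain s r t r' where s: "\<zeta> (f * (s * s)) = Some r" "0 < r" and t: "\<zeta> (g * (t * t)) = Some r'" "0 < r'"
      using fg unfolding place_cone_def by blast
    have st: "s \<noteq> 0" "t \<noteq> 0" using s t ev_0 by auto
    have sum: "f + g \<in> place_cone \<zeta>"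
      if "\<zeta> (f * (s * s)) = Some r" "0 < r" "\<zeta> (g * (t * t)) = Some r'" "0 < r'" "\<zeta> (s / t) = Some c" "t \<noteq> 0"
      for f g s t r r' c
    proof -
      have "\<zeta> (f * (s * s) + g * (t * t) * (s / t * (s / t))) = Some (r + r' * (c * c))"
        by (intro ev_add ev_mult that)
      moreover have "f * (s * s) + g * (t * t) * (s / t * (s / t)) = (f + g) * (s * s)"
        using that by (simp add: field_simps)
      moreover have "0 < r + r' * (c * c)" using that by (simp add: add_pos_nonneg)
      ultimately show ?thesis unfolding place_cone_def by auto
    qed
    show ?thesis
    proof (cases "\<zeta> (s / t)")
      case (Some c)
      then show ?thesis using sum s t st by blast
    next
      case None
      then have "\<zeta> (t / s) = Some 0" using ev_inverse_None[OF None] by simp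
      then have "g + f \<in> place_cone \<zeta>" using sum s t st by blast
      then show ?thesis by (simp add: add.commute)
    qed
  qed (use fg in auto)
  show "f * g \<in> place_cone \<zeta>"
  proof (cases "f = 0 \<or> g = 0")
    case False
    then obtain s r t r' where s: "\<zeta> (f * (s * s)) = Some r" "0 < r" and t: "\<zeta> (g * (t * t)) = Some r'" "0 < r'"
      using fg unfolding place_cone_def by blast
    have "\<zeta> (f * (s * s) * (g * (t * t))) = Some (r * r')" by (intro ev_mult s t)
    moreover have "f * (s * s) * (g * (t * t)) = f * g * ((s * t) * (s * t))" by (simp add: algebra_simps)
    moreover have "0 < r * r'" using s t by simp
    ultimately show ?thesis unfolding place_cone_def by auto
  qed (auto simp: place_cone_def)
next
  fix x show "x * x \<in> place_cone \<zeta>"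
  proof (cases "x = 0")
    case False
    then have "x * x * (inverse x * inverse x) = 1" by (simp add: field_simps)
    then show ?thesis using ev_1 unfolding place_cone_def by (metis (mono_tags, lifting) mem_Collect_eq zero_less_one)
  qed (simp add: place_cone_def)
next
  show "-1 \<notin> place_cone \<zeta>"
  proof
    assume "-1 \<in> place_cone \<zeta>"
    then obtain s r where s: "\<zeta> (- (s * s)) = Some r" "0 < r" unfolding place_cone_def by auto
    then have ss: "\<zeta> (s * s) = Some (- r)" using ev_minus by fastforce
    \<comment> \<open>If \<open>s\<close> is finite, its value would have the negative square
      \<open>- r\<close>. If \<open>s\<close> is infinite, the product of \<open>s * s\<close>,
      which is finite, with the infinitesimal \<open>inverse s\<close> would make \<open>s\<close>
      finite.\<close>
    show False
    proof (cases "\<zeta> s")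
      case None
      have "\<zeta> (inverse s * (s * s)) = Some (0 * - r)" by (rule ev_mult[OF ev_inverse_None[OF None] ss])
      moreover have "inverse s * (s * s) = s" by (cases "s = 0") (simp_all add: mult.assoc[symmetric])
      ultimately show False using None by simp
    next
      case (Some c)
      then have "c * c = - r" using ev_mult[OF Some Some] ss by simp
      then show False using s(2) by (metis neg_less_0_iff_less not_less zero_le_square)
    qed
  qed
qed

text \<open>Baer--Krull: an ordering positive on the units with positive residue induces the given place.\<close>

theorem (in real_place) place_from_ordering:
  obtains P where "field_ordering P" "\<zeta> = lam P"
proof -
  obtain P where P: "field_ordering P" "place_cone \<zeta> \<subseteq> P"
    using preordering_extends_to_ordering[OF preordering_place_cone] by blast
  interpret ord: ordered_by P by standard fact
  interpret lamP: real_place "lam P" using ord.R_place_lam by unfold_locales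
  have unit: "x \<in> P" if "\<zeta> x = Some r" "0 < r" for x r
    using that P(2) unfolding place_cone_def by (smt (verit) mem_Collect_eq mult.right_neutral subsetD)
  have fin: "lam P x = Some r" if "\<zeta> x = Some r" for x r
    unfolding ord.lam_eq_Some_iff ord.real_value_def
    using unit[OF ev_diff[OF that ev_of_rat]] unit[OF ev_diff[OF ev_of_rat that]] by simp
  have inf: "lam P x = None" if "\<zeta> x = None" for x
  proof -
    have "x \<noteq> 0" using that ev_0 by auto
    then show ?thesis using lamP.ev_inverse_0[OF fin[OF ev_inverse_None[OF that]]] by simp
  qed
  have "\<zeta> x = lam P x" for x using fin inf by (cases "\<zeta> x") auto
  then show thesis using that P(1) by blast
qed

text \<open>Surjectivity of the passage from cuts to places: a place comes from an ordering by
  Baer--Krull, and an ordering of \<open>K(y)\<close> from its cut. From here on statements on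
  places are proved on cuts.\<close>

lemma places_eq_lam_chi:
  assumes rc: "real_closed TYPE('a::linordered_field)"
  shows "places = (\<lambda>C. lam (chi C)) ` (cuts :: ('a set \<times> 'a set) set)"
proof (intro equalityI subsetI)
  fix \<zeta> :: "'a poly fract \<Rightarrow> real option" assume "\<zeta> \<in> places"
  then interpret real_place \<zeta> by (simp add: places_def real_place_def)
  obtain P where P: "field_ordering P" "\<zeta> = lam P" by (rule place_from_ordering)
  interpret ord: rational_ordered_by P using P rc by unfold_locales
  show "\<zeta> \<in> (\<lambda>C. lam (chi C)) ` cuts"
    by (rule image_eqI[OF _ ord.cut_of_in_cuts]) (simp add: ord.chi_cut_of P(2))
next
  fix \<zeta> :: "'a poly fract \<Rightarrow> real option" assume "\<zeta> \<in> (\<lambda>C. lam (chi C)) ` cuts"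
  then obtain C where C: "C \<in> cuts" "\<zeta> = lam (chi C)" by blast
  interpret ord: ordered_by "chi C" using field_ordering_chi[OF rc C(1)] by unfold_locales
  show "\<zeta> \<in> places" using ord.lam_in_places C by simp
qed

section \<open>Balls and cuts\<close>

text \<open>The empty set is allowed on purpose: it is the gap between two equal cuts.\<close>

definition reflection_closed :: "'a::linordered_field set \<Rightarrow> bool" where
  "reflection_closed B \<longleftrightarrow> (\<forall>a\<in>B. \<forall>b\<in>B. 2 * b - a \<in> B) \<and> (\<forall>a\<in>B. \<forall>b\<in>B. \<forall>c. a \<le> c \<and> c \<le> b \<longrightarrow> c \<in> B)"

lemma cval_ring_mult: "x \<in> cval_ring \<Longrightarrow> y \<in> cval_ring \<Longrightarrow> x * y \<in> (cval_ring :: 'a::linordered_field set)"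
proof -
  assume "x \<in> cval_ring" "y \<in> cval_ring"
  then obtain m n where "\<bar>x\<bar> \<le> of_nat m" "\<bar>y\<bar> \<le> of_nat n" unfolding cval_ring_def by blast
  then have "\<bar>x * y\<bar> \<le> of_nat (m * n)" by (simp add: abs_mult mult_mono)
  then show ?thesis unfolding cval_ring_def by blast
qed

lemma cval_ring_1: "1 \<in> (cval_ring :: 'a::linordered_field set)"
  unfolding cval_ring_def by (auto intro: exI[of _ 1])

lemma cval_units_mult: "x \<in> cval_units \<Longrightarrow> y \<in> cval_units \<Longrightarrow> x * y \<in> (cval_units :: 'a::linordered_field set)"
  unfolding cval_units_def using cval_ring_mult by auto

lemma cval_units_inverse: "x \<in> cval_units \<Longrightarrow> inverse x \<in> (cval_units :: 'a::linordered_field set)"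
  unfolding cval_units_def by auto

lemma cval_units_1: "1 \<in> (cval_units :: 'a::linordered_field set)"
  unfolding cval_units_def using cval_ring_1 by auto

lemma cval_eq_iff: "cval x = cval y \<longleftrightarrow> (\<exists>u\<in>cval_units. y = x * (u :: 'a::linordered_field))"
proof
  assume "cval x = cval y"
  then have "y \<in> cval x" unfolding cval_def using cval_units_1 by force
  then show "\<exists>u\<in>cval_units. y = x * u" unfolding cval_def by blast
next
  assume "\<exists>u\<in>cval_units. y = x * u"
  then obtain u where u: "u \<in> cval_units" "y = x * u" by blast
  then have u0: "u \<noteq> 0" unfolding cval_units_def by simp
  show "cval x = cval y" unfolding cval_def
  proof (intro equalityI subsetI)
    fix z assume "z \<in> {x * w | w. w \<in> cval_units}"
    then obtain w where w: "w \<in> cval_units" "z = x * w" by blast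
    have "z = y * (inverse u * w)" using u0 by (simp add: u w)
    then show "z \<in> {y * w | w. w \<in> cval_units}" using cval_units_mult[OF cval_units_inverse[OF u(1)] w(1)] by blast
  next
    fix z assume "z \<in> {y * w | w. w \<in> cval_units}"
    then obtain w where w: "w \<in> cval_units" "z = y * w" by blast
    have "z = x * (u * w)" by (simp add: u w)
    then show "z \<in> {x * w | w. w \<in> cval_units}" using cval_units_mult[OF u(1) w(1)] by blast
  qed
qed

text \<open>A larger value means a smaller absolute value, up to an integer factor. This removes the
  cosets from all later estimates.\<close>

lemma val_le_cval_iff:
  assumes "x \<noteq> 0" "y \<noteq> (0 :: 'a::linordered_field)"
  shows "val_le (cval x) (cval y) \<longleftrightarrow> (\<exists>n::nat. \<bar>y\<bar> \<le> of_nat n * \<bar>x\<bar>)"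
proof
  assume "val_le (cval x) (cval y)"
  then obtain u w where uw: "u \<in> cval_units" "w \<in> cval_units" "(y * w) / (x * u) \<in> cval_ring"
    unfolding val_le_def cval_def by blast
  have "y / x = (y * w) / (x * u) * (u * inverse w)"
    using uw assms unfolding cval_units_def by simp
  also have "\<dots> \<in> cval_ring" using uw unfolding cval_units_def by (intro cval_ring_mult) auto
  finally obtain n where "\<bar>y / x\<bar> \<le> of_nat n" unfolding cval_ring_def by blast
  then have "\<bar>y\<bar> \<le> of_nat n * \<bar>x\<bar>" using assms by (simp add: abs_divide divide_le_eq)
  then show "\<exists>n::nat. \<bar>y\<bar> \<le> of_nat n * \<bar>x\<bar>" by blast
next
  assume "\<exists>n::nat. \<bar>y\<bar> \<le> of_nat n * \<bar>x\<bar>"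
  then have "y / x \<in> cval_ring" unfolding cval_ring_def using assms by (simp add: abs_divide divide_le_eq)
  moreover have "x \<in> cval x" "y \<in> cval y" unfolding cval_def using cval_units_1 by force+
  ultimately show "val_le (cval x) (cval y)" unfolding val_le_def using assms by blast
qed

lemma cval_eqI:
  assumes "x \<noteq> 0" "\<bar>y\<bar> \<le> of_nat m * \<bar>x\<bar>" "\<bar>x\<bar> \<le> of_nat n * \<bar>y :: 'a::linordered_field\<bar>"
  shows "cval x = cval y"
proof -
  have y0: "y \<noteq> 0" using assms by auto
  have "y / x \<in> cval_ring" "x / y \<in> cval_ring"
    unfolding cval_ring_def using assms y0 by (auto simp: abs_divide divide_le_eq)
  then have "y / x \<in> cval_units" unfolding cval_units_def using assms(1) y0 by simp
  moreover have "y = x * (y / x)" using assms(1) by simp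
  ultimately show ?thesis unfolding cval_eq_iff by blast
qed

lemma cval_eqD:
  assumes "cval x = cval (y :: 'a::linordered_field)"
  shows "\<exists>n::nat. \<bar>y\<bar> \<le> of_nat n * \<bar>x\<bar>"
proof -
  obtain u where u: "u \<in> cval_units" "y = x * u" using assms unfolding cval_eq_iff by blast
  then obtain n :: nat where "\<bar>u\<bar> \<le> of_nat n" unfolding cval_units_def cval_ring_def by blast
  then have "\<bar>u\<bar> * \<bar>x\<bar> \<le> of_nat n * \<bar>x\<bar>" by (rule mult_right_mono) simp
  then have "\<bar>y\<bar> \<le> of_nat n * \<bar>x\<bar>" unfolding u by (simp add: abs_mult mult.commute)
  then show ?thesis by blast
qed

lemma is_ball_imp_reflection_closed:
  assumes "is_ball (B :: 'a::linordered_field set)"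
  shows "reflection_closed B" "B \<noteq> {}"
proof -
  obtain S c where S: "final_segment S" and B: "B = ballS S c" using assms unfolding is_ball_def by blast
  have mem: "b \<in> B \<longleftrightarrow> c = b \<or> cval (c - b) \<in> S" for b unfolding B ballS_def by auto
  have dom: "b \<in> B" if x: "x \<in> B" and le: "\<bar>c - b\<bar> \<le> of_nat n * \<bar>c - x\<bar>" for x b and n :: nat
  proof (cases "c = b")
    case False
    then have "c \<noteq> x" using le by auto
    then have "val_le (cval (c - x)) (cval (c - b))" using False le by (subst val_le_cval_iff) auto
    moreover have "cval (c - x) \<in> S" using x \<open>c \<noteq> x\<close> mem by blast
    moreover have "cval (c - b) \<in> value_group" using False unfolding value_group_def by force
    ultimately show ?thesis using S mem unfolding final_segment_def by blast
  qed (use mem in blast)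
  show "reflection_closed B" unfolding reflection_closed_def
  proof (intro conjI ballI allI impI)
    fix a b assume ab: "a \<in> B" "b \<in> B"
    show "2 * b - a \<in> B"
    proof (cases "\<bar>c - a\<bar> \<le> \<bar>c - b\<bar>")
      case True
      \<comment> \<open>The distance from \<open>c\<close> to \<open>2 * b - a\<close> is at most
        twice that to \<open>b\<close> plus that to \<open>a\<close>, which explains the factor
        3.\<close>
      then have "\<bar>c - (2 * b - a)\<bar> \<le> of_nat 3 * \<bar>c - b\<bar>" by (simp add: abs_if split: if_splits)
      then show ?thesis using dom ab by blast
    next
      case False
      then have "\<bar>c - (2 * b - a)\<bar> \<le> of_nat 3 * \<bar>c - a\<bar>" by (simp add: abs_if split: if_splits)
      then show ?thesis using dom ab by blast
    qed
    fix x assume "a \<le> x \<and> x \<le> b"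
    then have "\<bar>c - x\<bar> \<le> of_nat 1 * \<bar>c - a\<bar> \<or> \<bar>c - x\<bar> \<le> of_nat 1 * \<bar>c - b\<bar>" by (auto simp: abs_if)
    then show "x \<in> B" using dom ab by blast
  qed
  show "B \<noteq> {}" using mem by blast
qed

lemma reflection_closedD:
  assumes "reflection_closed B"
  shows "a \<in> B \<Longrightarrow> b \<in> B \<Longrightarrow> 2 * b - a \<in> B" "a \<in> B \<Longrightarrow> b \<in> B \<Longrightarrow> a \<le> c \<Longrightarrow> c \<le> b \<Longrightarrow> c \<in> B"
  using assms unfolding reflection_closed_def by blast+

text \<open>Reflecting \<open>c\<close> at \<open>c + y\<close> gives \<open>c + 2 y\<close>, and
  reflecting \<open>c + y\<close> at \<open>c\<close> gives \<open>c - y\<close>. After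
  \<open>n\<close> doublings the factor \<open>2 ^ n\<close> exceeds \<open>n\<close>, and convexity
  fills in the rest.\<close>

lemma reflection_closed_scale:
  assumes B: "reflection_closed B" and c: "c \<in> B" "x \<in> B" and le: "\<bar>b - c\<bar> \<le> of_nat n * \<bar>x - (c :: 'a::linordered_field)\<bar>"
  shows "b \<in> B"
proof -
  have neg: "c + - y \<in> B" if "c + y \<in> B" for y
    using reflection_closedD(1)[OF B that c(1)] by simp
  have pow: "c + 2 ^ k * y \<in> B" if "c + y \<in> B" for y k
  proof (induction k)
    case (Suc k)
    have "2 * (c + 2 ^ k * y) - c \<in> B" by (rule reflection_closedD(1)[OF B c(1) Suc])
    then show ?case by (simp add: algebra_simps)
  qed (use that in simp)
  have "c + (x - c) \<in> B" using c by simp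
  then have P: "c + 2 ^ n * (x - c) \<in> B" by (rule pow)
  then have N: "c + - (2 ^ n * (x - c)) \<in> B" by (rule neg)
  have "of_nat n \<le> (2 ^ n :: 'a)" using less_exp[of n] by (metis less_imp_le of_nat_le_iff of_nat_numeral of_nat_power)
  then have "of_nat n * \<bar>x - c\<bar> \<le> 2 ^ n * \<bar>x - c\<bar>" by (intro mult_right_mono) auto
  then have le': "\<bar>b - c\<bar> \<le> \<bar>2 ^ n * (x - c)\<bar>" using le by (simp add: abs_mult)
  show ?thesis
  proof (cases "0 \<le> 2 ^ n * (x - c)")
    case True
    then show ?thesis using le' reflection_closedD(2)[OF B N P, of b] by (simp add: abs_le_iff)
  next
    case False
    then show ?thesis using le' reflection_closedD(2)[OF B P N, of b] by (simp add: abs_le_iff)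
  qed
qed

text \<open>\<open>S\<close> collects the values of the distances from a chosen centre. Both that
  \<open>S\<close> is final and that its ball is no larger than \<open>B\<close> are instances of
  \<open>reflection_closed_scale\<close>.\<close>

lemma reflection_closed_imp_is_ball:
  assumes B: "reflection_closed (B :: 'a::linordered_field set)" and ne: "B \<noteq> {}"
  shows "is_ball B"
proof -
  obtain c where c: "c \<in> B" using ne by blast
  define S where "S = {cval (c - b) | b. b \<in> B \<and> b \<noteq> c}"
  have fs: "final_segment S" unfolding final_segment_def
  proof (intro conjI ballI impI)
    show "S \<subseteq> value_group" unfolding S_def value_group_def by force
    fix g h assume "g \<in> S" "h \<in> value_group" "val_le g h"
    then obtain x y where x: "g = cval (c - x)" "x \<in> B" "x \<noteq> c" and y: "h = cval y" "y \<noteq> 0"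
      unfolding S_def value_group_def by blast
    then obtain n :: nat where n: "\<bar>y\<bar> \<le> of_nat n * \<bar>c - x\<bar>"
      using \<open>val_le g h\<close> by (auto simp: val_le_cval_iff)
    have "c - y \<in> B" by (rule reflection_closed_scale[OF B c x(2), of _ n]) (use n in \<open>simp add: abs_minus_commute\<close>)
    then show "h \<in> S" unfolding S_def using y by (auto intro!: exI[of _ "c - y"])
  qed
  have "ballS S c = B"
  proof (intro equalityI subsetI)
    fix b assume "b \<in> ballS S c"
    then consider "c = b" | "c \<noteq> b" "cval (c - b) \<in> S" unfolding ballS_def by blast
    then show "b \<in> B"
    proof cases
      case 2
      then obtain x where x: "x \<in> B" "cval (c - x) = cval (c - b)" unfolding S_def by force
      then obtain n :: nat where "\<bar>c - b\<bar> \<le> of_nat n * \<bar>c - x\<bar>" using cval_eqD by blast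
      then show ?thesis using reflection_closed_scale[OF B c x(1), of b n] by (simp add: abs_minus_commute)
    qed (use c in simp)
  next
    fix b assume "b \<in> B"
    then show "b \<in> ballS S c" unfolding ballS_def S_def by blast
  qed
  then show ?thesis unfolding is_ball_def using fs by blast
qed

lemma is_ball_iff: "is_ball B \<longleftrightarrow> reflection_closed B \<and> B \<noteq> {}"
  using is_ball_imp_reflection_closed reflection_closed_imp_is_ball by blast

lemma cutsD: "C \<in> cuts \<Longrightarrow> a \<in> fst C \<Longrightarrow> b \<le> a \<Longrightarrow> b \<in> fst C"
  unfolding cuts_def by (force simp: not_le[symmetric])

lemma snd_cut: "C \<in> cuts \<Longrightarrow> snd C = - fst C"
  unfolding cuts_def by force

lemma cutI: "(\<And>a b. a \<in> D \<Longrightarrow> b \<le> a \<Longrightarrow> b \<in> D) \<Longrightarrow> (D, - D) \<in> cuts"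
  unfolding cuts_def by (auto simp: not_le[symmetric])

lemma cut_eqI: "C \<in> cuts \<Longrightarrow> C' \<in> cuts \<Longrightarrow> fst C = fst C' \<Longrightarrow> C = C'"
  using snd_cut by (metis prod.collapse)

lemma cuts_linear: "C \<in> cuts \<Longrightarrow> C' \<in> cuts \<Longrightarrow> fst C \<subseteq> fst C' \<or> fst C' \<subseteq> fst C"
  using cutsD by (metis linear subsetI)

locale rcf =
  fixes ty :: "'a::linordered_field itself"
  assumes rc: "real_closed TYPE('a)"
begin

lemma ord_chi: "C \<in> cuts \<Longrightarrow> rational_ordered_by (chi C :: 'a poly fract set)"
  using field_ordering_chi[OF rc] rc by unfold_locales auto

lemma lower_mem: "C \<in> cuts \<Longrightarrow> (d::'a) \<in> fst C \<Longrightarrow> rf_y - rf_const d \<in> chi C"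
  using fst_chi[OF rc] by blast

lemma upper_mem: 
  assumes C: "C \<in> cuts" and "(d::'a) \<notin> fst C" shows "rf_const d - rf_y \<in> chi C"
proof -
  interpret rational_ordered_by "chi C" by (rule ord_chi[OF C])
  have "rf_y - rf_const d \<notin> chi C" using assms fst_chi[OF rc] by blast
  then show ?thesis using P_or_neg[of "rf_y - rf_const d"] by auto
qed

lemma equal_places_imp_reflection_closed:
  assumes C: "C1 \<in> cuts" "C2 \<in> cuts" and sub: "fst C1 \<subseteq> fst C2"
    and eq: "lam (chi C1) = lam (chi C2)"
  shows "reflection_closed (fst C2 - fst C1 :: 'a set)"
proof -
  interpret o1: rational_ordered_by "chi C1" by (rule ord_chi[OF C(1)])
  interpret o2: rational_ordered_by "chi C2" by (rule ord_chi[OF C(2)])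
  have "2 * b - a \<in> fst C2 - fst C1" if a: "a \<in> fst C2 - fst C1" and b: "b \<in> fst C2 - fst C1" for a b
  proof (rule ccontr)
    assume n: "2 * b - a \<notin> fst C2 - fst C1"
    then have "a \<noteq> b" using a by auto
    \<comment> \<open>\<open>f\<close> takes the values 0 at \<open>a\<close>, 1 at \<open>b\<close>
      and 2 at the reflected point. At the cut lying between \<open>b\<close> and that point it has
      a value in \<open>[1, 2]\<close>, whereas at the other cut it is at most 0. The order of
      \<open>a\<close> and \<open>b\<close> decides which cut is which.\<close>
    define f where "f = (rf_y - rf_const a) / rf_const (b - a)"
    have nz: "rf_const (b - a) \<noteq> 0" using \<open>a \<noteq> b\<close> by (simp add: rf_const_eq_0_iff)
    have f1: "f - of_rat 1 = (rf_y - rf_const b) / rf_const (b - a)"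
      unfolding f_def using nz by (simp add: field_simps rf_const_hom)
    have f2: "of_rat 2 - f = (rf_const (2 * b - a) - rf_y) / rf_const (b - a)"
      unfolding f_def using nz rf_const_of_nat[where 'a = 'a, of 2] by (simp add: field_simps rf_const_hom)
    have f1': "f - of_rat 1 = (rf_const b - rf_y) / rf_const (a - b)"
      unfolding f1 by (metis minus_diff_eq minus_divide_divide rf_const_hom(4))
    have f2': "of_rat 2 - f = (rf_y - rf_const (2 * b - a)) / rf_const (a - b)"
      unfolding f2 by (metis minus_diff_eq minus_divide_divide rf_const_hom(4))
    have mf: "- f = (rf_const a - rf_y) / rf_const (b - a)" "- f = (rf_y - rf_const a) / rf_const (a - b)"
      unfolding f_def by (metis minus_diff_eq minus_divide_left, metis minus_diff_eq minus_divide_right rf_const_hom(4))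
    show False
    proof (cases "a < b")
      case True
      then have "2 * b - a \<notin> fst C2" using n b cutsD[OF C(1), of "2 * b - a" b] by auto
      then have "f - of_rat 1 \<in> chi C2" "of_rat 2 - f \<in> chi C2" unfolding f1 f2
        using True a b by (auto intro!: o2.P_divide lower_mem upper_mem C simp: o2.const_in_P)
      then have "lam (chi C2) \<in> H' f" unfolding o2.lam_in_H'_iff using zero_less_one by blast
      then obtain q where "q > 0" "f - of_rat q \<in> chi C1" using eq o1.lam_in_H'_iff by metis
      moreover have "- f \<in> chi C1" unfolding mf(1) using True a
        by (auto intro!: o1.P_divide upper_mem C simp: o1.const_in_P)
      ultimately have "of_rat (- q) \<in> chi C1" "q > 0" using o1.P_add by (force simp: of_rat_minus)+
      then show False by (simp add: o1.P_of_rat)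
    next
      case False
      then have ba: "b < a" using \<open>a \<noteq> b\<close> by simp
      then have "2 * b - a \<in> fst C1" using n b cutsD[OF C(2), of b "2 * b - a"] by auto
      then have "f - of_rat 1 \<in> chi C1" "of_rat 2 - f \<in> chi C1" unfolding f1' f2'
        using ba a b by (auto intro!: o1.P_divide lower_mem upper_mem C simp: o1.const_in_P)
      then have "lam (chi C1) \<in> H' f" unfolding o1.lam_in_H'_iff using zero_less_one by blast
      then obtain q where "q > 0" "f - of_rat q \<in> chi C2" using eq o2.lam_in_H'_iff by metis
      moreover have "- f \<in> chi C2" unfolding mf(2) using ba a
        by (auto intro!: o2.P_divide lower_mem C simp: o2.const_in_P)
      ultimately have "of_rat (- q) \<in> chi C2" "q > 0" using o2.P_add by (force simp: of_rat_minus)+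
      then show False by (simp add: o2.P_of_rat)
    qed
  qed
  moreover have "c \<in> fst C2 - fst C1" if "a \<in> fst C2 - fst C1" "b \<in> fst C2 - fst C1" "a \<le> c" "c \<le> b" for a b c
    using that cutsD C by blast
  ultimately show ?thesis unfolding reflection_closed_def by blast
qed

end

section \<open>Places at the edges of a ball\<close>

text \<open>The substitute for the intermediate value theorem, in contrapositive form.\<close>

lemma real_closed_no_root_sign:
  assumes rc: "real_closed TYPE('a::linordered_field)" and "p \<noteq> (0 :: 'a poly)" and "\<And>t. poly p t \<noteq> 0"
  shows "(\<forall>t. poly p t > 0) \<or> (\<forall>t. poly p t < 0)"
  using assms
proof (induction p rule: real_closed_poly_induct)
  case (const c)
  then show ?case by auto
next
  case (linear a p)
  show ?case using linear.prems[of a] by simp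
next
  case (quadratic a b p)
  have pos: "poly ([:-a, 1:] ^ 2 + [:b ^ 2:]) t > 0" for t
    using quadratic by (simp add: add_nonneg_pos)
  have "poly p t \<noteq> 0" for t using quadratic.prems[of t] by auto
  then have "(\<forall>t. poly p t > 0) \<or> (\<forall>t. poly p t < 0)" by (rule quadratic.IH)
  then show ?case using pos by (metis mult_pos_pos mult_pos_neg poly_mult)
qed

lemma real_closed_nth_root:
  assumes rc: "real_closed TYPE('a::linordered_field)" and "0 < (x::'a)" "0 < m"
  obtains s where "0 < s" "s ^ m = x"
proof -
  let ?p = "monom 1 m - [:x:]"
  have p: "poly ?p t = t ^ m - x" for t by (simp add: poly_monom)
  \<comment> \<open>The sign change is sought between \<open>0\<close> and \<open>x + 1\<close>; the
    base is at least 1, so its power exceeds \<open>x\<close>.\<close>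
  have "x + 1 \<le> (x + 1) ^ m" using assms by (intro self_le_power) auto
  then have "0 < poly ?p (x + 1)" unfolding p by linarith
  moreover have "poly ?p 0 < 0" unfolding p using assms by (simp add: zero_power)
  moreover have "?p \<noteq> 0" using calculation by auto
  ultimately obtain s where "poly ?p s = 0" using real_closed_no_root_sign[OF rc] by (meson less_asym)
  then have "s ^ m = x" unfolding p by simp
  then have "\<bar>s\<bar> ^ m = x" using assms by (simp flip: power_abs)
  moreover have "\<bar>s\<bar> > 0" using \<open>s ^ m = x\<close> assms by (auto simp: zero_power)
  ultimately show thesis using that by blast
qed

lemma (in ordered_by) real_value_infinitesimal:
  assumes "\<And>n::nat. w - of_nat n * x \<in> P" "\<And>n::nat. w + of_nat n * x \<in> P" "w \<noteq> 0"
  shows "real_value (x / w) 0"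
proof -
  have w: "w \<in> P" using assms(1)[of 0] by simp
  have bound: "of_rat q - x / w \<in> P \<and> x / w - of_rat (- q) \<in> P" if q0: "0 < q" for q
  proof -
    obtain n where n: "inverse (of_nat (Suc n)) < q" using reals_Archimedean[OF q0] by blast
    then have q: "of_rat (q - inverse (of_nat (Suc n))) \<in> P" by (simp add: P_of_rat)
    have N: "(of_nat (Suc n) :: 'k) \<noteq> 0" by (rule of_nat_neq_0)
    have "(w - of_nat (Suc n) * x) / (of_nat (Suc n) * w) \<in> P" "(w + of_nat (Suc n) * x) / (of_nat (Suc n) * w) \<in> P"
      by (intro P_divide P_mult P_of_nat w assms)+
    then have "inverse (of_nat (Suc n)) - x / w \<in> P" "inverse (of_nat (Suc n)) + x / w \<in> P"
      using N assms(3) by (simp_all add: diff_divide_distrib add_divide_distrib inverse_eq_divide del: of_nat_Suc)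
    from P_add[OF q this(1)] P_add[OF q this(2)] show ?thesis
      by (simp add: of_rat_diff of_rat_minus of_rat_inverse of_rat_add add.commute)
  qed
  show ?thesis unfolding real_value_def
  proof (intro conjI allI impI)
    fix q :: rat
    show "x / w - of_rat q \<in> P" if "of_rat q < (0::real)" using bound[of "-q"] that by simp
    show "of_rat q - x / w \<in> P" if "(0::real) < of_rat q" using bound[of "q"] that by simp
  qed
qed

text \<open>With respect to \<open>\<zeta>\<close>, the group \<open>G\<close> consists exactly of the constants infinitely smaller than \<open>z\<close>, and all
  other constants are infinitely larger.\<close>

definition edge_place :: "'a::linordered_field set \<Rightarrow> 'a poly fract \<Rightarrow> ('a poly fract \<Rightarrow> real option) \<Rightarrow> bool" where
  "edge_place G z \<zeta> \<longleftrightarrow> R_place \<zeta> \<and> z \<noteq> 0 \<and>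
     (\<forall>g\<in>G. \<zeta> (rf_const g / z) = Some 0) \<and> (\<forall>g. g \<notin> G \<longrightarrow> \<zeta> (z / rf_const g) = Some 0) \<and>
     (\<forall>c. \<bar>c\<bar> \<le> 1 \<longrightarrow> \<zeta> (rf_const c) \<noteq> None)"

text \<open>The ball in question is \<open>y0 + G\<close>, and \<open>z\<close> is the variable
  shifted to its centre \<open>y0\<close>.\<close>

locale edge_group =
  fixes G :: "'a::linordered_field set" and y0 :: 'a and z :: "'a poly fract"
  assumes rc: "real_closed TYPE('a)"
    and zero: "0 \<in> G"
    and convex: "\<And>x y. x \<in> G \<Longrightarrow> \<bar>y\<bar> \<le> \<bar>x\<bar> \<Longrightarrow> y \<in> G"
    and z: "z = rf_y - rf_const y0" and z0: "z \<noteq> 0"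
begin

text \<open>The quantifier over all edge places of \<open>G\<close> makes \<open>c\<close> and
  \<open>k\<close> common to both edges of the ball, which is what allows the two places to be
  compared.\<close>

definition monomial_like :: "'a poly fract \<Rightarrow> 'a \<Rightarrow> nat \<Rightarrow> bool" where
  "monomial_like f c k \<longleftrightarrow> c \<noteq> 0 \<and> (\<forall>\<zeta>. edge_place G z \<zeta> \<longrightarrow> \<zeta> (f / (rf_const c * z ^ k)) = Some 1)"

lemma monomial_like_mult:
  assumes "monomial_like f c k" "monomial_like g d l" shows "monomial_like (f * g) (c * d) (k + l)"
  unfolding monomial_like_def
proof (intro conjI allI impI)
  fix \<zeta> assume \<zeta>: "edge_place G z \<zeta>"
  then interpret real_place \<zeta> by (simp add: edge_place_def real_place_def)
  have "f * g / (rf_const (c * d) * z ^ (k + l)) = f / (rf_const c * z ^ k) * (g / (rf_const d * z ^ l))"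
    by (simp add: rf_const_hom power_add)
  also have "\<zeta> \<dots> = Some (1 * 1)" using assms \<zeta> unfolding monomial_like_def by (intro ev_mult) auto
  finally show "\<zeta> (f * g / (rf_const (c * d) * z ^ (k + l))) = Some 1" by simp
qed (use assms in \<open>simp add: monomial_like_def\<close>)

lemma monomial_like_const: "c \<noteq> 0 \<Longrightarrow> monomial_like (rf_const c) c 0"
  unfolding monomial_like_def
proof (intro conjI allI impI)
  fix \<zeta> assume "c \<noteq> 0" and \<zeta>: "edge_place G z \<zeta>"
  then interpret real_place \<zeta> by (simp add: edge_place_def real_place_def)
  show "\<zeta> (rf_const c / (rf_const c * z ^ 0)) = Some 1"
    using \<open>c \<noteq> 0\<close> ev_1 by (simp add: rf_const_eq_0_iff)
qed

lemma monomial_like_linear: "\<exists>c k. monomial_like (z - rf_const d) c k"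
proof (cases "d \<in> G")
  case True
  have "monomial_like (z - rf_const d) 1 1" unfolding monomial_like_def
  proof (intro conjI allI impI)
    fix \<zeta> assume \<zeta>: "edge_place G z \<zeta>"
    then interpret real_place \<zeta> by (simp add: edge_place_def real_place_def)
    have "\<zeta> (rf_const d / z) = Some 0" using \<zeta> True unfolding edge_place_def by blast
    from ev_diff[OF ev_1 this] show "\<zeta> ((z - rf_const d) / (rf_const 1 * z ^ 1)) = Some 1"
      using z0 by (simp add: rf_const_hom diff_divide_distrib)
  qed simp
  then show ?thesis by blast
next
  case False
  then have d0: "d \<noteq> 0" using zero by auto
  have "monomial_like (z - rf_const d) (- d) 0" unfolding monomial_like_def
  proof (intro conjI allI impI)
    fix \<zeta> assume \<zeta>: "edge_place G z \<zeta>"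
    then interpret real_place \<zeta> by (simp add: edge_place_def real_place_def)
    have "\<zeta> (z / rf_const d) = Some 0" using \<zeta> False unfolding edge_place_def by blast
    from ev_diff[OF ev_1 this] show "\<zeta> ((z - rf_const d) / (rf_const (- d) * z ^ 0)) = Some 1"
      using d0 by (simp add: rf_const_hom diff_divide_distrib rf_const_eq_0_iff)
  qed (use d0 in simp)
  then show ?thesis by blast
qed

lemma monomial_like_quadratic:
  assumes b: "b \<noteq> 0"
  shows "\<exists>c k. monomial_like ((z - rf_const d) * (z - rf_const d) + rf_const b * rf_const b) c k"
    (is "\<exists>c k. monomial_like ?f c k")
proof (cases "d \<in> G \<and> b \<in> G")
  case True
  have "monomial_like ?f 1 2" unfolding monomial_like_def
  proof (intro conjI allI impI)
    fix \<zeta> assume \<zeta>: "edge_place G z \<zeta>"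
    then interpret real_place \<zeta> by (simp add: edge_place_def real_place_def)
    have *: "\<zeta> (rf_const d / z) = Some 0" "\<zeta> (rf_const b / z) = Some 0"
      using \<zeta> True unfolding edge_place_def by blast+
    have "?f / (rf_const 1 * z ^ 2) =
        (1 - rf_const d / z) * (1 - rf_const d / z) + rf_const b / z * (rf_const b / z)"
      using z0 by (simp add: rf_const_hom field_simps power2_eq_square)
    moreover have "\<zeta> \<dots> = Some ((1 - 0) * (1 - 0) + 0 * 0)"
      by (intro ev_add ev_mult ev_diff ev_1 *)
    ultimately show "\<zeta> (?f / (rf_const 1 * z ^ 2)) = Some 1" by simp
  qed simp
  then show ?thesis by blast
next
  case False
  \<comment> \<open>One of \<open>d\<close> and \<open>b\<close> lies outside \<open>G\<close>,
    hence by convexity so does the one of larger absolute value, and \<open>z\<close> is infinitely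
    small against it. Both \<open>m * m / c\<close> and \<open>d * m / c\<close> are bounded by 1
    and so have finite values; after division by \<open>c\<close> only 1 plus infinitesimals
    remain.\<close>
  define m where "m = (if \<bar>d\<bar> \<le> \<bar>b\<bar> then b else d)"
  have m: "\<bar>d\<bar> \<le> \<bar>m\<bar>" "\<bar>b\<bar> \<le> \<bar>m\<bar>" "m * m \<le> d * d + b * b" unfolding m_def by auto
  have mG: "m \<notin> G" using False convex m by blast
  have m0: "m \<noteq> 0" using mG zero by auto
  define c where "c = d * d + b * b"
  have c: "c > 0" unfolding c_def using b by (simp add: add_nonneg_pos zero_less_mult_iff linorder_neq_iff[symmetric])
  have b1: "\<bar>m * m / c\<bar> \<le> 1" using m c unfolding c_def by (simp add: abs_divide divide_le_eq)
  have "\<bar>d * m\<bar> \<le> \<bar>m\<bar> * \<bar>m\<bar>" unfolding abs_mult by (rule mult_right_mono[OF m(1)]) simp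
  also have "\<dots> \<le> c" using m unfolding c_def by simp
  finally have b2: "\<bar>d * m / c\<bar> \<le> 1" using c by (simp add: abs_divide divide_le_eq)
  have "monomial_like ?f c 0" unfolding monomial_like_def
  proof (intro conjI allI impI)
    fix \<zeta> assume \<zeta>: "edge_place G z \<zeta>"
    then interpret real_place \<zeta> by (simp add: edge_place_def real_place_def)
    have zm: "\<zeta> (z / rf_const m) = Some 0" using \<zeta> mG unfolding edge_place_def by blast
    obtain r1 r2 where r: "\<zeta> (rf_const (m * m / c)) = Some r1" "\<zeta> (rf_const (d * m / c)) = Some r2"
      using \<zeta> b1 b2 unfolding edge_place_def by blast
    have nz: "rf_const c \<noteq> 0" "rf_const m \<noteq> 0" using c m0 by (auto simp: rf_const_eq_0_iff)
    have eq: "?f = rf_const c + (z * z - (rf_const d + rf_const d) * z)"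
      unfolding c_def by (simp add: rf_const_hom algebra_simps)
    have "?f / (rf_const c * z ^ 0) =
        1 + (z / rf_const m * (z / rf_const m) * rf_const (m * m / c) -
          (z / rf_const m * rf_const (d * m / c) + z / rf_const m * rf_const (d * m / c)))"
      unfolding eq using nz by (simp add: rf_const_divide rf_const_hom field_simps)
    moreover have "\<zeta> \<dots> = Some (1 + (0 * 0 * r1 - (0 * r2 + 0 * r2)))"
      by (intro ev_add ev_mult ev_diff ev_1 zm r)
    ultimately show "\<zeta> (?f / (rf_const c * z ^ 0)) = Some 1" by simp
  qed (use c in simp)
  then show ?thesis by blast
qed

lemma monomial_like_poly: "p \<noteq> 0 \<Longrightarrow> \<exists>c k. monomial_like (Fract p 1) c k"
  using rc
proof (induction p rule: real_closed_poly_induct)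
  case (const c)
  then show ?case using monomial_like_const[of c] by (auto simp: rf_const_def)
next
  case (linear a p)
  have "Fract [:-a, 1:] 1 = z - rf_const (a - y0)"
    unfolding z rf_y_diff[symmetric] by (simp add: rf_const_hom)
  then show ?case
    unfolding Fract_mult_1 using linear.IH monomial_like_linear[of "a - y0"] monomial_like_mult by metis
next
  case (quadratic a b p)
  have lin: "Fract [:-a, 1:] 1 = z - rf_const (a - y0)"
    unfolding z rf_y_diff[symmetric] by (simp add: rf_const_hom)
  have "Fract ([:-a, 1:] ^ 2 + [:b ^ 2:]) 1 = Fract [:-a, 1:] 1 * Fract [:-a, 1:] 1 + rf_const b * rf_const b"
    by (simp add: rf_const_def power2_eq_square)
  then have "Fract ([:-a, 1:] ^ 2 + [:b ^ 2:]) 1 =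
      (z - rf_const (a - y0)) * (z - rf_const (a - y0)) + rf_const b * rf_const b"
    unfolding lin .
  then show ?case
    unfolding Fract_mult_1 using quadratic.IH monomial_like_quadratic[OF quadratic(1)] monomial_like_mult by metis
qed

text \<open>With \<open>s\<close> an \<open>m\<close>-th root of the inverse of the absolute value
  of \<open>c\<close>, the monomial becomes a sign times the \<open>m\<close>-th power of
  \<open>z / s\<close>. It is infinite if \<open>s\<close> lies in \<open>G\<close> and has value 0
  otherwise. Neither outcome sees the sign of \<open>z\<close>, in which the two edges
  differ.\<close>

lemma edge_places_monomial:
  assumes "edge_place G z \<zeta>1" "edge_place G z \<zeta>2" and c: "c \<noteq> 0" and m: "0 < m"
  defines "u \<equiv> rf_const c * z ^ m"
  shows "\<zeta>1 u = None \<and> \<zeta>2 u = None \<or> \<zeta>1 u = Some 0 \<and> \<zeta>2 u = Some 0"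
proof -
  obtain s where s: "0 < s" "s ^ m = inverse \<bar>c\<bar>" using real_closed_nth_root[OF rc, of "inverse \<bar>c\<bar>" m] c m by auto
  define \<epsilon> where "\<epsilon> = sgn c"
  have pow: "rf_const (a ^ n) = rf_const a ^ n" for a :: 'a and n by (induction n) (simp_all add: rf_const_hom)
  have "c = \<epsilon> * inverse (s ^ m)" unfolding s \<epsilon>_def by (simp add: sgn_mult_abs)
  then have u: "u = rf_const \<epsilon> * (z / rf_const s) ^ m"
    unfolding u_def by (simp add: rf_const_hom rf_const_inverse pow power_mult_distrib power_inverse divide_inverse mult_ac)
  have eps: "\<bar>\<epsilon>\<bar> \<le> 1" "\<epsilon> \<noteq> 0" "inverse \<epsilon> = \<epsilon>" unfolding \<epsilon>_def using c by (auto simp: sgn_if)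
  have s0: "rf_const s \<noteq> 0" using s by (simp add: rf_const_eq_0_iff)
  have u0: "u \<noteq> 0" unfolding u using eps s0 z0 by (simp add: rf_const_eq_0_iff)
  have zero: "\<zeta> ((rf_const \<epsilon>) * x ^ m) = Some 0" if \<zeta>: "edge_place G z \<zeta>" and x: "\<zeta> x = Some 0" for \<zeta> x
  proof -
    interpret real_place \<zeta> using \<zeta> by (simp add: edge_place_def real_place_def)
    have "\<zeta> (x ^ k) = Some (0 ^ k)" for k using ev_1 ev_mult[OF x] by (induction k) auto
    moreover obtain r where "\<zeta> (rf_const \<epsilon>) = Some r" using \<zeta> eps unfolding edge_place_def by blast
    ultimately show ?thesis using ev_mult m by (fastforce simp: zero_power)
  qed
  have "\<zeta> u = None" if \<zeta>: "edge_place G z \<zeta>" and sG: "s \<in> G" for \<zeta>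
  proof -
    interpret real_place \<zeta> using \<zeta> by (simp add: edge_place_def real_place_def)
    have "inverse u = rf_const \<epsilon> * (rf_const s / z) ^ m"
      unfolding u inverse_mult_distrib power_inverse[symmetric] rf_const_inverse[symmetric] eps(3) by simp
    also have "\<zeta> \<dots> = Some 0" by (rule zero[OF \<zeta>]) (use \<zeta> sG in \<open>simp add: edge_place_def\<close>)
    finally show ?thesis using ev_inverse_0[of "inverse u"] u0 by simp
  qed
  moreover have "\<zeta> u = Some 0" if \<zeta>: "edge_place G z \<zeta>" and sG: "s \<notin> G" for \<zeta>
    unfolding u by (rule zero[OF \<zeta>]) (use \<zeta> sG in \<open>simp add: edge_place_def\<close>)
  ultimately show ?thesis using assms(1,2) by blast
qed

text \<open>Every nonzero \<open>f\<close> is a monomial \<open>u\<close> times a factor of value 1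
  at both places. For equal exponents \<open>u\<close> is a constant, where the places agree by
  assumption; otherwise \<open>edge_places_monomial\<close> applies to \<open>u\<close> or to its
  inverse.\<close>

lemma edge_places_equal:
  assumes e1: "edge_place G z \<zeta>1" and e2: "edge_place G z \<zeta>2" and const: "\<And>c. \<zeta>1 (rf_const c) = \<zeta>2 (rf_const c)"
  shows "\<zeta>1 = \<zeta>2"
proof (rule ext)
  fix f :: "'a poly fract"
  interpret p1: real_place \<zeta>1 using e1 by (simp add: edge_place_def real_place_def)
  interpret p2: real_place \<zeta>2 using e2 by (simp add: edge_place_def real_place_def)
  obtain p q where f: "f = Fract p q" "q \<noteq> 0" by (cases f)
  show "\<zeta>1 f = \<zeta>2 f"
  proof (cases "p = 0")
    case True
    then have "f = 0" using f by (simp add: Fract_zero_iff)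
    then show ?thesis using p1.ev_0 p2.ev_0 by simp
  next
    case False
    obtain c k where c: "monomial_like (Fract p 1) c k" using monomial_like_poly[OF False] by blast
    obtain d l where d: "monomial_like (Fract q 1) d l" using monomial_like_poly[OF f(2)] by blast
    have cd: "c \<noteq> 0" "d \<noteq> 0" using c d unfolding monomial_like_def by blast+
    define u where "u = rf_const (c / d) * z ^ k / z ^ l"
    have nz: "rf_const c \<noteq> 0" "rf_const d \<noteq> 0" "Fract q 1 \<noteq> 0" "u \<noteq> 0"
      using cd f z0 by (auto simp: u_def rf_const_eq_0_iff Fract_zero_iff)
    have fpq: "f = Fract p 1 / Fract q 1" using f by simp
    have quot: "f / u = Fract p 1 / (rf_const c * z ^ k) * inverse (Fract q 1 / (rf_const d * z ^ l))"
    proof -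
      have gen: "A / Q / (C / D * Z / W) = A / (C * Z) * inverse (Q / (D * W))"
        if "Q \<noteq> 0" "C \<noteq> 0" "D \<noteq> 0" "Z \<noteq> 0" "W \<noteq> 0" for A Q C D Z W :: "'a poly fract"
        using that by (simp add: field_simps)
      show ?thesis unfolding fpq u_def rf_const_divide by (rule gen) (use nz z0 in auto)
    qed
    have one: "\<zeta> (f / u) = Some 1" if "edge_place G z \<zeta>" for \<zeta>
    proof -
      interpret real_place \<zeta> using that by (simp add: edge_place_def real_place_def)
      have "\<zeta> (Fract p 1 / (rf_const c * z ^ k) * inverse (Fract q 1 / (rf_const d * z ^ l))) = Some (1 * inverse 1)"
        using c d that unfolding monomial_like_def by (intro ev_mult ev_inverse) auto
      then show ?thesis unfolding quot by simp
    qed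
    have u_eq: "\<zeta>1 u = \<zeta>2 u"
    proof (cases k l rule: linorder_cases)
      case equal
      then have "u = rf_const (c / d)" using z0 by (simp add: u_def)
      then show ?thesis using const by simp
    next
      case greater
      then have "u = rf_const (c / d) * z ^ (k - l)" using z0 by (simp add: u_def power_diff)
      then show ?thesis using edge_places_monomial[OF e1 e2, of "c / d" "k - l"] cd greater by auto
    next
      case less
      then have "inverse u = rf_const (d / c) * z ^ (l - k)"
        using z0 nz by (simp add: u_def power_diff rf_const_divide field_simps)
      then have "\<zeta>1 (inverse u) = None \<and> \<zeta>2 (inverse u) = None \<or> \<zeta>1 (inverse u) = Some 0 \<and> \<zeta>2 (inverse u) = Some 0"
        using edge_places_monomial[OF e1 e2, of "d / c" "l - k"] cd less by auto
      then show ?thesis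
        using p1.ev_inverse_None[of "inverse u"] p2.ev_inverse_None[of "inverse u"]
          p1.ev_inverse_0[of "inverse u"] p2.ev_inverse_0[of "inverse u"] nz by auto
    qed
    have fu: "u * (f / u) = f" using nz by simp
    show ?thesis
    proof (cases "\<zeta>1 u")
      case None
      then show ?thesis
        using p1.ev_None_mult[OF None one[OF e1]] p2.ev_None_mult[of u, OF _ one[OF e2]] None u_eq fu by simp
    next
      case (Some r)
      then show ?thesis
        using p1.ev_mult[OF Some one[OF e1]] p2.ev_mult[of u r, OF _ one[OF e2]] Some u_eq fu by simp
    qed
  qed
qed

end


context rcf
begin

lemma lam_const:
  assumes "field_ordering P" "field_ordering (Q :: 'a poly fract set)"
  shows "lam P (rf_const c) = lam Q (rf_const c)"
proof -
  interpret p: rational_ordered_by P using assms rc by unfold_locales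
  interpret q: rational_ordered_by Q using assms rc by unfold_locales
  have "of_nat n * rf_const c - of_int m = rf_const (of_nat n * c - of_int m)" for n m
    by (cases m rule: int_cases2) (simp_all add: rf_const_hom rf_const_of_nat)
  moreover have "of_nat n - rf_const c = rf_const (of_nat n - c)" "of_nat n + rf_const c = rf_const (of_nat n + c)" for n
    by (simp_all add: rf_const_hom rf_const_of_nat)
  ultimately show ?thesis unfolding lam_def by (simp add: p.const_in_P q.const_in_P)
qed

text \<open>Here \<open>w\<close> is plus or minus \<open>y - y0\<close>, so that it is positive at the cut in question.\<close>

lemma edge_place_lam:
  assumes ord: "field_ordering P" and z0: "z \<noteq> 0" and w: "w = z \<or> w = - z"
    and G: "\<And>g n. g \<in> G \<Longrightarrow> of_nat n * g \<in> G" "\<And>g. g \<in> G \<Longrightarrow> - g \<in> G" "0 \<in> G"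
    and small: "\<And>g. g \<in> G \<Longrightarrow> w - rf_const g \<in> P"
    and large: "\<And>g. g \<notin> G \<Longrightarrow> 0 < g \<Longrightarrow> rf_const g - w \<in> P"
  shows "edge_place G (z :: 'a poly fract) (lam P)"
proof -
  interpret rational_ordered_by P using ord rc by unfold_locales
  interpret pl: real_place "lam P" using R_place_lam by unfold_locales
  have w0: "w \<noteq> 0" using z0 w by auto
  have wP: "w \<in> P" using small[OF G(3)] by (simp add: rf_const_hom)
  have A: "lam P (rf_const g / z) = Some 0" if "g \<in> G" for g
  proof -
    have "real_value (rf_const g / w) 0"
    proof (rule real_value_infinitesimal)
      fix n :: nat
      show "w - of_nat n * rf_const g \<in> P" using small[OF G(1)[OF that, of n]] by (simp add: rf_const_hom rf_const_of_nat)
      show "w + of_nat n * rf_const g \<in> P" using small[OF G(2)[OF G(1)[OF that, of n]]] by (simp add: rf_const_hom rf_const_of_nat)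
    qed (rule w0)
    then show ?thesis using real_value_minus[of "rf_const g / w" 0] w by (auto simp: lam_eq_Some_iff)
  qed
  have B: "lam P (z / rf_const g) = Some 0" if g: "g \<notin> G" for g
  proof -
    have "real_value (w / rf_const \<bar>g\<bar>) 0"
    proof (rule real_value_infinitesimal)
      have g0: "g \<noteq> 0" using g G(3) by auto
      then show "rf_const \<bar>g\<bar> \<noteq> 0" by (simp add: rf_const_eq_0_iff)
      fix n :: nat
      \<comment> \<open>\<open>G\<close> is closed under integer multiples, so its complement is
        closed under division by positive integers. \<open>Suc n\<close> keeps the divisor nonzero;
        the surplus \<open>w\<close> is added back below.\<close>
      have "\<bar>g\<bar> / of_nat (Suc n) \<notin> G"
      proof
        assume "\<bar>g\<bar> / of_nat (Suc n) \<in> G"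
        from G(1)[OF this, of "Suc n"] have "\<bar>g\<bar> \<in> G" by (simp del: of_nat_Suc)
        then show False using g G(2)[of "\<bar>g\<bar>"] by (auto simp: abs_if split: if_splits)
      qed
      moreover have "0 < \<bar>g\<bar> / of_nat (Suc n)" using g0 by (simp del: of_nat_Suc)
      ultimately have "rf_const (\<bar>g\<bar> / of_nat (Suc n)) - w \<in> P" by (rule large)
      then have "of_nat (Suc n) * (rf_const (\<bar>g\<bar> / of_nat (Suc n)) - w) \<in> P" by (intro P_mult P_of_nat)
      also have "of_nat (Suc n) * (rf_const (\<bar>g\<bar> / of_nat (Suc n)) - w) = rf_const \<bar>g\<bar> - of_nat (Suc n) * w"
        by (simp add: right_diff_distrib rf_const_divide rf_const_of_nat del: of_nat_Suc)
      finally have S: "rf_const \<bar>g\<bar> - of_nat (Suc n) * w \<in> P" .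
      show "rf_const \<bar>g\<bar> - of_nat n * w \<in> P" using P_add[OF S wP] by (simp add: algebra_simps)
      show "rf_const \<bar>g\<bar> + of_nat n * w \<in> P"
        by (intro P_add P_mult P_of_nat wP) (simp add: const_in_P)
    qed
    then have "real_value (w / rf_const g) 0"
      using real_value_minus[of "w / rf_const \<bar>g\<bar>" 0] by (cases "0 \<le> g") (auto simp: rf_const_hom)
    then show ?thesis using real_value_minus[of "w / rf_const g" 0] w by (auto simp: lam_eq_Some_iff)
  qed
  have "lam P (rf_const c) \<noteq> None" if "\<bar>c\<bar> \<le> 1" for c
  proof -
    have "of_nat 1 - rf_const c = rf_const (1 - c)" "of_nat 1 + rf_const c = rf_const (1 + c)"
      by (simp_all add: rf_const_hom)
    then have "bounded_elem (rf_const c)"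
      unfolding bounded_elem_def using that const_in_P by (intro exI[of _ 1]) (simp add: abs_le_iff)
    then show ?thesis using lam_eq_None_iff by blast
  qed
  then show ?thesis unfolding edge_place_def using R_place_lam z0 A B by blast
qed

text \<open>With \<open>y0\<close> in the ball, \<open>z = y - y0\<close> exceeds all of
  \<open>G\<close> at the upper edge, and \<open>- z\<close> does so at the lower edge. Both places
  are therefore edge places of the same \<open>G\<close>, and on constants all orderings
  agree.\<close>

lemma reflection_closed_imp_equal_places:
  assumes C: "C1 \<in> cuts" "C2 \<in> cuts" and sub: "fst C1 \<subseteq> fst C2"
    and refl: "reflection_closed (fst C2 - fst C1 :: 'a set)"
  shows "lam (chi C1) = lam (chi C2)"
proof (cases "fst C2 - fst C1 = {}")
  case True
  then have "fst C1 = fst C2" using sub by blast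
  then show ?thesis using cut_eqI[OF C] by simp
next
  case False
  let ?B = "fst C2 - fst C1"
  obtain y0 where y0: "y0 \<in> ?B" using False by blast
  define G where "G = {g. y0 + g \<in> ?B}"
  define z where "z = rf_y - rf_const y0"
  have z0: "z \<noteq> 0" unfolding z_def rf_y_diff by (simp add: Fract_zero_iff)
  note scale = reflection_closed_scale[OF refl y0]
  have zero: "0 \<in> G" using y0 by (simp add: G_def)
  have G1: "of_nat n * g \<in> G" if "g \<in> G" for g n
    using that scale[of "y0 + g" "y0 + of_nat n * g" n] unfolding G_def by (simp add: abs_mult)
  have G2: "y \<in> G" if "x \<in> G" "\<bar>y\<bar> \<le> \<bar>x\<bar>" for x y
    using that scale[of "y0 + x" "y0 + y" 1] unfolding G_def by simp
  have G3: "- g \<in> G" if "g \<in> G" for g using G2[OF that, of "- g"] by simp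
  interpret eg: edge_group G y0 z
    using rc zero G2 z0 by unfold_locales (simp_all add: z_def)
  have e2: "edge_place G z (lam (chi C2))"
  proof (rule edge_place_lam[OF field_ordering_chi[OF rc C(2)] z0 disjI1[OF HOL.refl] G1 G3 zero])
    show "z - rf_const g \<in> chi C2" if "g \<in> G" for g
      using lower_mem[OF C(2), of "y0 + g"] that by (simp add: G_def z_def rf_const_hom algebra_simps)
    show "rf_const g - z \<in> chi C2" if "g \<notin> G" "0 < g" for g
    proof -
      have "y0 + g \<notin> fst C1" using y0 that cutsD[OF C(1), of "y0 + g" y0] by auto
      then have "y0 + g \<notin> fst C2" using that by (simp add: G_def)
      then show ?thesis using upper_mem[OF C(2), of "y0 + g"] by (simp add: z_def rf_const_hom algebra_simps)
    qed
  qed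
  have e1: "edge_place G z (lam (chi C1))"
  proof (rule edge_place_lam[OF field_ordering_chi[OF rc C(1)] z0 disjI2[OF HOL.refl] G1 G3 zero])
    show "- z - rf_const g \<in> chi C1" if "g \<in> G" for g
      using upper_mem[OF C(1), of "y0 - g"] G3[OF that] by (simp add: G_def z_def rf_const_hom algebra_simps)
    show "rf_const g - - z \<in> chi C1" if "g \<notin> G" "0 < g" for g
    proof -
      have "y0 - g \<in> fst C2" using y0 that cutsD[OF C(2), of y0 "y0 - g"] by auto
      moreover have "- g \<notin> G" using G3 that by fastforce
      ultimately have "y0 - g \<in> fst C1" by (simp add: G_def)
      then show ?thesis using lower_mem[OF C(1), of "y0 - g"] by (simp add: z_def rf_const_hom algebra_simps)
    qed
  qed
  show ?thesis
    using eg.edge_places_equal[OF e1 e2] lam_const field_ordering_chi[OF rc] C by blast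
qed

lemma equal_places_iff:
  assumes "C1 \<in> cuts" "C2 \<in> cuts" "fst C1 \<subseteq> fst C2"
  shows "lam (chi C1) = lam (chi C2 :: 'a poly fract set) \<longleftrightarrow> reflection_closed (fst C2 - fst C1)"
  using equal_places_imp_reflection_closed[OF assms] reflection_closed_imp_equal_places[OF assms] by blast

end

section \<open>Equivalence of cuts and equality of places\<close>

lemma cut_less_if_mem: "C \<in> cuts \<Longrightarrow> a \<in> fst C \<Longrightarrow> b \<notin> fst C \<Longrightarrow> a < b"
  using cutsD not_le by metis

lemma lower_upper_cut:
  assumes C: "C1 \<in> cuts" "C2 \<in> cuts" and ne: "fst C2 - fst C1 \<noteq> {}"
  shows "lower_cut (fst C2 - fst C1) = C1" "upper_cut (fst C2 - fst C1) = C2"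
proof -
  obtain a where a: "a \<in> fst C2" "a \<notin> fst C1" using ne by blast
  have "- {t. \<exists>a\<in>fst C2 - fst C1. a \<le> t} = fst C1"
  proof (intro equalityI subsetI)
    fix t assume "t \<in> - {t. \<exists>a\<in>fst C2 - fst C1. a \<le> t}"
    then show "t \<in> fst C1" using a cut_less_if_mem[OF C(2) a(1), of t]
      by (metis (mono_tags, lifting) ComplD DiffI less_imp_le mem_Collect_eq order_refl)
  qed (use cutsD[OF C(1)] in blast)
  then show "lower_cut (fst C2 - fst C1) = C1"
    unfolding lower_cut_def using snd_cut[OF C(1)] by (metis double_complement prod.collapse)
  have "{t. \<exists>a\<in>fst C2 - fst C1. t \<le> a} = fst C2"
  proof (intro equalityI subsetI)
    fix t assume "t \<in> fst C2"
    then show "t \<in> {t. \<exists>a\<in>fst C2 - fst C1. t \<le> a}" using a cut_less_if_mem[OF C(1) _ a(2), of t]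
      by (metis (mono_tags, lifting) DiffI less_imp_le mem_Collect_eq order_refl)
  qed (use cutsD[OF C(2)] in blast)
  then show "upper_cut (fst C2 - fst C1) = C2"
    unfolding upper_cut_def using snd_cut[OF C(2)] by (metis prod.collapse)
qed

lemma lower_upper_cut_ball:
  assumes B: "is_ball B"
  shows "lower_cut B \<in> cuts" "upper_cut B \<in> cuts" "fst (upper_cut B) - fst (lower_cut B) = B"
    "fst (lower_cut B) \<subseteq> fst (upper_cut B)"
proof -
  have refl: "reflection_closed B" and ne: "B \<noteq> {}" using B is_ball_iff by blast+
  show "lower_cut B \<in> cuts" "upper_cut B \<in> cuts"
    unfolding lower_cut_def upper_cut_def cuts_def by (auto simp: not_le[symmetric] intro: order_trans)
  show "fst (upper_cut B) - fst (lower_cut B) = B"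
    using reflection_closedD(2)[OF refl] by (auto simp: lower_cut_def upper_cut_def)
  show "fst (lower_cut B) \<subseteq> fst (upper_cut B)"
    using ne by (auto simp: lower_cut_def upper_cut_def) (metis linear)
qed

text \<open>A nonempty gap between cuts with the same place is a ball having these cuts as its
  edges. Full sets are thus the saturated sets of the map from cuts to places.\<close>

lemma (in rcf) cut_equiv_iff:
  assumes C: "C1 \<in> cuts" "(C2 :: 'a set \<times> 'a set) \<in> cuts"
  shows "cut_equiv C1 C2 \<longleftrightarrow> lam (chi C1) = lam (chi C2)"
proof
  assume "cut_equiv C1 C2"
  moreover have "lam (chi (lower_cut B)) = lam (chi (upper_cut B))" if "is_ball B" for B :: "'a set"
    using lower_upper_cut_ball[OF that] that is_ball_iff equal_places_iff by metis
  ultimately show "lam (chi C1) = lam (chi C2)" unfolding cut_equiv_def by auto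
next
  assume eq: "lam (chi C1) = lam (chi C2)"
  have main: "cut_equiv C1 C2 \<and> cut_equiv C2 C1"
    if "C1 \<in> cuts" "C2 \<in> cuts" "lam (chi C1) = lam (chi C2)" "fst C1 \<subseteq> fst C2" for C1 C2 :: "'a set \<times> 'a set"
  proof (cases "fst C2 - fst C1 = {}")
    case True
    then have "C1 = C2" using cut_eqI[OF that(1,2)] that(4) by blast
    then show ?thesis by (simp add: cut_equiv_def)
  next
    case False
    then have "is_ball (fst C2 - fst C1)"
      using equal_places_iff that is_ball_iff by blast
    then show ?thesis
      using lower_upper_cut[OF that(1,2) False] unfolding cut_equiv_def by metis
  qed
  show "cut_equiv C1 C2" using main C eq cuts_linear[OF C] by metis
qed

section \<open>The interval topology\<close>

text \<open>Neighbourhoods are split into two halves because later arguments approach a cut from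
  each side separately. A half is vacuous at an improper cut, and contains only the cut itself when
  the extremum on that side is taken as the bound.\<close>

definition cut_nbhd :: "('a::linorder set \<times> 'a set) set \<Rightarrow> 'a set \<times> 'a set \<Rightarrow> bool" where
  "cut_nbhd W C \<longleftrightarrow>
     (fst C \<noteq> {} \<longrightarrow> (\<exists>a\<in>fst C. \<forall>C'\<in>cuts. a \<in> fst C' \<and> fst C' \<subseteq> fst C \<longrightarrow> C' \<in> W)) \<and>
     (fst C \<noteq> UNIV \<longrightarrow> (\<exists>b. b \<notin> fst C \<and> (\<forall>C'\<in>cuts. fst C \<subseteq> fst C' \<and> b \<notin> fst C' \<longrightarrow> C' \<in> W)))"

lemma cut_nbhdD:
  assumes "cut_nbhd W C"
  shows "fst C \<noteq> {} \<Longrightarrow> \<exists>a\<in>fst C. \<forall>C'\<in>cuts. a \<in> fst C' \<and> fst C' \<subseteq> fst C \<longrightarrow> C' \<in> W"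
    "fst C \<noteq> UNIV \<Longrightarrow> \<exists>b. b \<notin> fst C \<and> (\<forall>C'\<in>cuts. fst C \<subseteq> fst C' \<and> b \<notin> fst C' \<longrightarrow> C' \<in> W)"
  using assms unfolding cut_nbhd_def by blast+

lemma cut_nbhd_mono: "cut_nbhd W C \<Longrightarrow> W \<subseteq> W' \<Longrightarrow> cut_nbhd W' C"
  unfolding cut_nbhd_def by (meson subsetD)

lemma cut_nbhd_Int:
  assumes C: "C \<in> (cuts :: ('a::linorder set \<times> 'a set) set)" and W: "cut_nbhd W C" "cut_nbhd W' C"
  shows "cut_nbhd (W \<inter> W') C"
  unfolding cut_nbhd_def
proof (intro conjI impI)
  assume ne: "fst C \<noteq> {}"
  obtain a where a: "a \<in> fst C" "\<And>C'. C' \<in> cuts \<Longrightarrow> a \<in> fst C' \<and> fst C' \<subseteq> fst C \<Longrightarrow> C' \<in> W"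
    using cut_nbhdD(1)[OF W(1) ne] by blast
  obtain a' where a': "a' \<in> fst C" "\<And>C'. C' \<in> cuts \<Longrightarrow> a' \<in> fst C' \<and> fst C' \<subseteq> fst C \<Longrightarrow> C' \<in> W'"
    using cut_nbhdD(1)[OF W(2) ne] by blast
  have "max a a' \<in> fst C" using a a' by (simp add: max_def)
  moreover have "C' \<in> W \<inter> W'" if "C' \<in> cuts" "max a a' \<in> fst C' \<and> fst C' \<subseteq> fst C" for C'
  proof -
    have "a \<in> fst C'" "a' \<in> fst C'" using that cutsD[OF that(1), of "max a a'"] by auto
    then show ?thesis using a a' that by blast
  qed
  ultimately show "\<exists>a\<in>fst C. \<forall>C'\<in>cuts. a \<in> fst C' \<and> fst C' \<subseteq> fst C \<longrightarrow> C' \<in> W \<inter> W'" by blast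
next
  assume ne: "fst C \<noteq> UNIV"
  obtain b where b: "b \<notin> fst C" "\<And>C'. C' \<in> cuts \<Longrightarrow> fst C \<subseteq> fst C' \<and> b \<notin> fst C' \<Longrightarrow> C' \<in> W"
    using cut_nbhdD(2)[OF W(1) ne] by blast
  obtain b' where b': "b' \<notin> fst C" "\<And>C'. C' \<in> cuts \<Longrightarrow> fst C \<subseteq> fst C' \<and> b' \<notin> fst C' \<Longrightarrow> C' \<in> W'"
    using cut_nbhdD(2)[OF W(2) ne] by blast
  have "min b b' \<notin> fst C" using b b' by (simp add: min_def)
  moreover have "C' \<in> W \<inter> W'" if "C' \<in> cuts" "fst C \<subseteq> fst C' \<and> min b b' \<notin> fst C'" for C'
  proof -
    have "b \<notin> fst C'" "b' \<notin> fst C'" using that(2) cutsD[OF that(1) _ min.cobounded1] cutsD[OF that(1) _ min.cobounded2] by blast+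
    then show ?thesis using b b' that by blast
  qed
  ultimately show "\<exists>b. b \<notin> fst C \<and> (\<forall>C'\<in>cuts. fst C \<subseteq> fst C' \<and> b \<notin> fst C' \<longrightarrow> C' \<in> W \<inter> W')" by blast
qed

lemma cut_nbhd_above:
  assumes "C1 \<in> cuts" "C \<in> cuts" "cut_less C1 C" shows "cut_nbhd {C \<in> cuts. cut_less C1 C} C"
proof -
  obtain a where a: "a \<in> fst C" "a \<notin> fst C1" using assms unfolding cut_less_def by blast
  have "cut_less C1 C'" if "C' \<in> cuts" "a \<in> fst C'" for C'
    using cuts_linear[OF assms(1) that(1)] a that unfolding cut_less_def by blast
  moreover obtain b where "b \<notin> fst C" if "fst C \<noteq> UNIV" by blast
  ultimately show ?thesis unfolding cut_nbhd_def using a by blast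
qed

lemma cut_nbhd_below:
  assumes "C2 \<in> cuts" "C \<in> cuts" "cut_less C C2" shows "cut_nbhd {C \<in> cuts. cut_less C C2} C"
proof -
  obtain b where b: "b \<in> fst C2" "b \<notin> fst C" using assms unfolding cut_less_def by blast
  have "cut_less C' C2" if "C' \<in> cuts" "b \<notin> fst C'" for C'
    using cuts_linear[OF assms(1) that(1)] b that unfolding cut_less_def by blast
  moreover obtain a where "a \<in> fst C" if "fst C \<noteq> {}" by blast
  ultimately show ?thesis unfolding cut_nbhd_def using b by blast
qed

definition lt_cut :: "'a::linorder \<Rightarrow> 'a set \<times> 'a set" where "lt_cut a = ({..<a}, - {..<a})"
definition le_cut :: "'a::linorder \<Rightarrow> 'a set \<times> 'a set" where "le_cut a = ({..a}, - {..a})"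

lemma lt_le_cut_in_cuts: "lt_cut a \<in> cuts" "le_cut a \<in> cuts"
  unfolding lt_cut_def le_cut_def cuts_def by auto

lemma openin_interval_mem: "openin interval_topology {C \<in> cuts. (a::'a::linorder) \<in> fst C}"
proof -
  have "{C \<in> cuts. a \<in> fst C} = {C \<in> cuts. cut_less (lt_cut a) C}"
    unfolding cut_less_def lt_cut_def using cutsD by (fastforce simp: psubset_eq not_less[symmetric])
  then show ?thesis unfolding interval_topology_def
    by (intro topology_generated_by_Basis) (use lt_le_cut_in_cuts in blast)
qed

lemma openin_interval_not_mem: "openin interval_topology {C \<in> cuts. (a::'a::linorder) \<notin> fst C}"
proof -
  have "{C \<in> cuts. a \<notin> fst C} = {C \<in> cuts. cut_less C (le_cut a)}"
    unfolding cut_less_def le_cut_def using cutsD by (fastforce simp: psubset_eq not_less[symmetric] not_le)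
  then show ?thesis unfolding interval_topology_def
    by (intro topology_generated_by_Basis) (use lt_le_cut_in_cuts in blast)
qed

lemma topspace_interval_topology: "topspace interval_topology = (cuts :: ('a::linorder set \<times> 'a set) set)"
proof
  have "openin interval_topology ({C \<in> cuts. a \<in> fst C} \<union> {C \<in> cuts. (a::'a) \<notin> fst C})" for a
    by (intro openin_Un openin_interval_mem openin_interval_not_mem)
  moreover have "{C \<in> cuts. a \<in> fst C} \<union> {C \<in> cuts. (a::'a) \<notin> fst C} = cuts" for a by blast
  ultimately show "cuts \<subseteq> topspace (interval_topology :: ('a set \<times> 'a set) topology)"
    using openin_subset by metis
  show "topspace interval_topology \<subseteq> (cuts :: ('a set \<times> 'a set) set)"
    unfolding interval_topology_def topology_generated_by_topspace by blast
qed

lemma openin_interval_iff: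
  "openin interval_topology W \<longleftrightarrow> W \<subseteq> cuts \<and> (\<forall>C\<in>W. cut_nbhd W (C :: 'a::linorder set \<times> 'a set))"
proof
  assume "openin interval_topology W"
  then show "W \<subseteq> cuts \<and> (\<forall>C\<in>W. cut_nbhd W C)"
    unfolding interval_topology_def openin_topology_generated_by_iff
  proof (induction W rule: generate_topology_on.induct)
    case (Int a b)
    then show ?case using cut_nbhd_Int by (metis Int_iff le_infI1 subsetD)
  next
    case (UN K)
    then show ?case by (meson Sup_upper UnionE Union_least cut_nbhd_mono)
  next
    case (Basis W)
    have *: "{C \<in> cuts. cut_less C1 C \<and> cut_less C C2} = {C \<in> cuts. cut_less C1 C} \<inter> {C \<in> cuts. cut_less C C2}"
      for C1 C2 :: "'a set \<times> 'a set" by blast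
    from Basis show ?case
      unfolding * using cut_nbhd_above cut_nbhd_below cut_nbhd_Int by blast
  qed auto
next
  assume W: "W \<subseteq> cuts \<and> (\<forall>C\<in>W. cut_nbhd W C)"
  show "openin interval_topology W"
  proof (subst openin_subopen, intro ballI)
    fix C assume C: "C \<in> W"
    then have Cc: "C \<in> cuts" and nb: "cut_nbhd W C" using W by blast+
    have all: "openin interval_topology (cuts :: ('a set \<times> 'a set) set)"
      by (metis openin_topspace topspace_interval_topology)
    \<comment> \<open>\<open>U\<close> controls the cuts below \<open>C\<close> and \<open>V\<close>
      those above; every cut is comparable with \<open>C\<close>, so the intersection lies in
      \<open>W\<close>.\<close>
    obtain U where U: "openin interval_topology U" "C \<in> U" "\<And>C'. C' \<in> U \<Longrightarrow> C' \<in> cuts \<and> (fst C' \<subseteq> fst C \<longrightarrow> C' \<in> W)"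
    proof (cases "fst C = {}")
      case True
      have "C' \<in> W" if "C' \<in> cuts" "fst C' \<subseteq> fst C" for C'
        using cut_eqI[OF that(1) Cc] that(2) True C by simp
      then show thesis using that[OF all Cc] by blast
    next
      case False
      then obtain a where "a \<in> fst C" "\<forall>C'\<in>cuts. a \<in> fst C' \<and> fst C' \<subseteq> fst C \<longrightarrow> C' \<in> W"
        using cut_nbhdD(1)[OF nb] by blast
      then show thesis using that[OF openin_interval_mem[of a]] Cc by blast
    qed
    obtain V where V: "openin interval_topology V" "C \<in> V" "\<And>C'. C' \<in> V \<Longrightarrow> C' \<in> cuts \<and> (fst C \<subseteq> fst C' \<longrightarrow> C' \<in> W)"
    proof (cases "fst C = UNIV")
      case True
      have "C' \<in> W" if "C' \<in> cuts" "fst C \<subseteq> fst C'" for C'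
        using cut_eqI[OF that(1) Cc] that(2) True C by (metis top.extremum_uniqueI)
      then show thesis using that[OF all Cc] by blast
    next
      case False
      then obtain b where "b \<notin> fst C" "\<forall>C'\<in>cuts. fst C \<subseteq> fst C' \<and> b \<notin> fst C' \<longrightarrow> C' \<in> W"
        using cut_nbhdD(2)[OF nb] by blast
      then show thesis using that[OF openin_interval_not_mem[of b]] Cc by blast
    qed
    have "U \<inter> V \<subseteq> W"
    proof
      fix C' assume "C' \<in> U \<inter> V"
      then show "C' \<in> W" using U(3)[of C'] V(3)[of C'] cuts_linear[OF Cc, of C'] by auto
    qed
    moreover have "openin interval_topology (U \<inter> V)" by (rule openin_Int[OF U(1) V(1)])
    ultimately show "\<exists>T. openin interval_topology T \<and> C \<in> T \<and> T \<subseteq> W"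
      using U(2) V(2) by (intro exI[of _ "U \<inter> V"]) simp
  qed
qed

text \<open>A Heine--Borel argument: \<open>S\<close> is the union of all initial segments up to
  which finitely many members suffice. If \<open>S\<close> were proper, the member containing the
  cut at \<open>S\<close> would extend the cover to some \<open>{..<b}\<close> with \<open>b\<close>
  outside \<open>S\<close>. Reaching \<open>{..b}\<close> costs one further cut, so \<open>b\<close>
  would belong to \<open>S\<close>.\<close>

lemma compact_interval_topology: "compact_space (interval_topology :: ('a::linorder set \<times> 'a set) topology)"
  unfolding compact_space_alt topspace_interval_topology
proof (intro allI impI; elim conjE)
  fix \<U> :: "('a set \<times> 'a set) set set"
  assume op: "\<forall>U\<in>\<U>. openin interval_topology U" and cover: "cuts \<subseteq> \<Union>\<U>"
  define covered where "covered D \<longleftrightarrow> (\<exists>\<F>. finite \<F> \<and> \<F> \<subseteq> \<U> \<and> {C \<in> cuts. fst C \<subseteq> D} \<subseteq> \<Union>\<F>)" for D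
  have insert: "covered D'" if D: "covered D" and U: "U \<in> \<U>" "\<And>C. C \<in> cuts \<Longrightarrow> fst C \<subseteq> D' \<Longrightarrow> C \<in> U \<or> fst C \<subseteq> D" for D D' U
  proof -
    obtain \<F> where F: "finite \<F>" "\<F> \<subseteq> \<U>" "{C \<in> cuts. fst C \<subseteq> D} \<subseteq> \<Union>\<F>" using D unfolding covered_def by blast
    have "{C \<in> cuts. fst C \<subseteq> D'} \<subseteq> \<Union>(insert U \<F>)"
    proof (intro subsetI)
      fix C assume "C \<in> {C \<in> cuts. fst C \<subseteq> D'}"
      then have "C \<in> U \<or> C \<in> {C \<in> cuts. fst C \<subseteq> D}" using U(2) by blast
      then show "C \<in> \<Union>(insert U \<F>)" using F(3) by blast
    qed
    then show ?thesis unfolding covered_def using U(1) F(1,2) by (intro exI[of _ "insert U \<F>"]) simp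
  qed
  define S where "S = \<Union>{fst C | C. C \<in> cuts \<and> covered (fst C)}"
  define C0 where "C0 = (S, - S)"
  have C0: "C0 \<in> cuts" unfolding C0_def S_def by (rule cutI) (use cutsD in blast)
  then obtain U where U: "U \<in> \<U>" "C0 \<in> U" using cover by blast
  have nb: "cut_nbhd U C0" using op U openin_interval_iff by blast
  have fst0: "fst C0 = S" by (simp add: C0_def)
  have covS: "covered S"
  proof (cases "S = {}")
    case True
    have "C \<in> U" if "C \<in> cuts" "fst C \<subseteq> S" for C using cut_eqI[OF that(1) C0] that True U fst0 by simp
    then show ?thesis unfolding covered_def using U by (intro exI[of _ "{U}"]) auto
  next
    case False
    then obtain a where a: "a \<in> S" "\<And>C'. C' \<in> cuts \<Longrightarrow> a \<in> fst C' \<and> fst C' \<subseteq> S \<Longrightarrow> C' \<in> U"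
      using cut_nbhdD(1)[OF nb] fst0 by auto
    then obtain C1 where C1: "C1 \<in> cuts" "covered (fst C1)" "a \<in> fst C1" unfolding S_def by blast
    show ?thesis using C1(2) U(1)
    proof (rule insert)
      fix C assume "C \<in> cuts" "fst C \<subseteq> S"
      then show "C \<in> U \<or> fst C \<subseteq> fst C1" using a(2) C1 cuts_linear by blast
    qed
  qed
  have "S = UNIV"
  proof (rule ccontr)
    assume "S \<noteq> UNIV"
    then obtain b where b: "b \<notin> S" "\<And>C'. C' \<in> cuts \<Longrightarrow> S \<subseteq> fst C' \<and> b \<notin> fst C' \<Longrightarrow> C' \<in> U"
      using cut_nbhdD(2)[OF nb] fst0 by auto
    have cov: "covered {..<b}" using covS U(1)
    proof (rule insert)
      fix C assume "C \<in> cuts" "fst C \<subseteq> {..<b}"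
      moreover from this have "b \<notin> fst C" by blast
      ultimately show "C \<in> U \<or> fst C \<subseteq> S" using b(2) cuts_linear[OF C0] fst0 by blast
    qed
    obtain V where V: "V \<in> \<U>" "le_cut b \<in> V" using cover lt_le_cut_in_cuts by blast
    have "covered {..b}" using cov V(1)
    proof (rule insert)
      fix C assume C: "C \<in> cuts" "fst C \<subseteq> {..b}"
      show "C \<in> V \<or> fst C \<subseteq> {..<b}"
      proof (cases "b \<in> fst C")
        case True
        then have "fst C = {..b}" using C cutsD[OF C(1) True] by auto
        then have "C = le_cut b" using cut_eqI[OF C(1) lt_le_cut_in_cuts(2)] by (simp add: le_cut_def)
        then show ?thesis using V by simp
      next
        case False
        then show ?thesis using C(2) by (auto simp: less_le)
      qed
    qed
    then have "b \<in> S" unfolding S_def using lt_le_cut_in_cuts(2)[of b]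
      by (intro UnionI[of "{..b}"]) (auto simp: le_cut_def intro!: exI[of _ "le_cut b"])
    then show False using b by blast
  qed
  then show "\<exists>\<F>. finite \<F> \<and> \<F> \<subseteq> \<U> \<and> cuts \<subseteq> \<Union>\<F>" using covS unfolding covered_def by auto
qed

section \<open>Places as a quotient of the space of cuts\<close>

context rcf
begin

text \<open>The sign of \<open>f\<close> is fixed by the position of the cut relative to the
  finitely many roots of numerator and denominator. For a given root both containing it and not
  containing it are open conditions on cuts.\<close>

lemma openin_interval_chi:
  "openin interval_topology {C \<in> cuts. (f :: 'a poly fract) \<in> chi C}"
proof -
  obtain p q where f: "f = Fract p q" "q \<noteq> 0" by (cases f)
  show ?thesis
  proof (cases "p * q = 0")
    case True
    then have "f = 0" using f by (simp add: Fract_zero_iff)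
    moreover have "0 \<in> chi C" if "C \<in> cuts" for C :: "'a set \<times> 'a set"
      using ordered_by.P_0 ord_chi[OF that] rational_ordered_by.axioms(1) by blast
    ultimately have "{C \<in> cuts. f \<in> chi C} = topspace interval_topology"
      unfolding topspace_interval_topology by blast
    then show ?thesis by simp
  next
    case False
    let ?Z = "{z. poly (p * q) z = 0}"
    have fin: "finite ?Z" using poly_roots_finite[OF False] by simp
    show ?thesis
    proof (subst openin_subopen, intro ballI)
      fix C assume "C \<in> {C \<in> cuts. f \<in> chi C}"
      then have C: "C \<in> cuts" "f \<in> chi C" by blast+
      let ?U = "(\<Inter>z\<in>?Z. if z \<in> fst C then {C \<in> cuts. z \<in> fst C} else {C \<in> cuts. z \<notin> fst C}) \<inter> topspace interval_topology"
      have "openin interval_topology ?U"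
        by (intro openin_INT fin) (auto intro: openin_interval_mem openin_interval_not_mem)
      moreover have "C \<in> ?U" using C unfolding topspace_interval_topology by auto
      moreover have "?U \<subseteq> {C \<in> cuts. f \<in> chi C}"
      proof
        fix C' assume "C' \<in> ?U"
        then have "C' \<in> cuts" and *: "\<And>z. z \<in> ?Z \<Longrightarrow> C' \<in> (if z \<in> fst C then {C \<in> cuts. z \<in> fst C} else {C \<in> cuts. z \<notin> fst C})"
          unfolding topspace_interval_topology by blast+
        then have C': "C' \<in> cuts" "\<And>z. poly (p * q) z = 0 \<Longrightarrow> z \<in> fst C \<longleftrightarrow> z \<in> fst C'"
          by (metis (mono_tags, lifting) mem_Collect_eq)+
        have "Fract (p * q) 1 \<in> chi C \<longleftrightarrow> Fract (p * q) 1 \<in> chi C'"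
          using field_ordering_chi[OF rc] C(1) C' fst_chi[OF rc]
          by (intro ordering_sign_determined[OF rc _ _ False]) auto
        then have "f \<in> chi C'"
          using C rational_ordered_by.Fract_in_P[OF ord_chi f(2)] C'(1) f(1) by metis
        then show "C' \<in> {C \<in> cuts. f \<in> chi C}" using C' by blast
      qed
      ultimately show "\<exists>T. openin interval_topology T \<and> C \<in> T \<and> T \<subseteq> {C \<in> cuts. f \<in> chi C}" by blast
    qed
  qed
qed

lemma openin_interval_H':
  "openin interval_topology {C \<in> cuts. lam (chi C) \<in> H' (b :: 'a poly fract)}"
proof -
  have "{C \<in> cuts. lam (chi C) \<in> H' b} =
      (\<Union>q\<in>{q. 0 < q}. {C \<in> cuts. b - of_rat q \<in> chi C}) \<inter> (\<Union>q. {C \<in> cuts. of_rat q - b \<in> chi C})"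
    using ordered_by.lam_in_H'_iff[OF rational_ordered_by.axioms(1)[OF ord_chi]] by auto
  then show ?thesis
    using openin_interval_chi by (auto intro!: openin_Int openin_Union)
qed

theorem quotient_map_places:
  "quotient_map interval_topology places_top (\<lambda>C. lam (chi C) :: 'a poly fract \<Rightarrow> real option)"
proof (rule continuous_closed_imp_quotient_map)
  show img: "(\<lambda>C. lam (chi C)) ` topspace interval_topology = topspace (places_top :: ('a poly fract \<Rightarrow> real option) topology)"
    unfolding topspace_interval_topology topspace_places_top places_eq_lam_chi[OF rc] ..
  show cont: "continuous_map interval_topology places_top (\<lambda>C. lam (chi C) :: 'a poly fract \<Rightarrow> real option)"
    unfolding places_top_def
  proof (rule continuous_on_generated_topo)
    fix U :: "('a poly fract \<Rightarrow> real option) set" assume "U \<in> range H'"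
    then obtain b where "U = H' b" by blast
    moreover have "(\<lambda>C. lam (chi C)) -` H' b \<inter> topspace interval_topology = {C \<in> cuts. lam (chi C) \<in> H' b}"
      unfolding topspace_interval_topology by blast
    ultimately show "openin interval_topology ((\<lambda>C. lam (chi C)) -` U \<inter> topspace interval_topology)"
      using openin_interval_H' by simp
  next
    show "(\<lambda>C. lam (chi C) :: 'a poly fract \<Rightarrow> real option) ` topspace interval_topology \<subseteq> \<Union> (range H')"
      using img unfolding places_top_def topology_generated_by_topspace by simp
  qed
  show "closed_map interval_topology places_top (\<lambda>C. lam (chi C) :: 'a poly fract \<Rightarrow> real option)"
    unfolding closed_map_def
    using closedin_compact_space[OF compact_interval_topology] image_compactin[OF _ cont]
      compactin_imp_closedin[OF Hausdorff_places_top] by blast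
qed

lemma full_iff:
  "full U \<longleftrightarrow> U \<subseteq> cuts \<and> (\<forall>C1\<in>U. \<forall>C2\<in>cuts. lam (chi C1) = lam (chi (C2 :: 'a set \<times> 'a set)) \<longrightarrow> C2 \<in> U)"
  unfolding full_def using cut_equiv_iff by (meson subsetD)

text \<open>A full set is a union of fibres of the quotient map, hence the preimage of its own
  image.\<close>

lemma openin_places_image_full:
  assumes V: "openin interval_topology V" "full (V :: ('a set \<times> 'a set) set)"
  shows "openin places_top ((\<lambda>C. lam (chi C)) ` V)"
    and "C \<in> cuts \<Longrightarrow> lam (chi C) \<in> (\<lambda>C. lam (chi C)) ` V \<longleftrightarrow> C \<in> V"
proof -
  show mem: "lam (chi C) \<in> (\<lambda>C. lam (chi C)) ` V \<longleftrightarrow> C \<in> V" if "C \<in> cuts" for C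
    using V(2) that unfolding full_iff by (metis (no_types, lifting) image_iff)
  let ?U = "(\<lambda>C. lam (chi C)) ` V"
  have sub: "?U \<subseteq> topspace places_top"
    using V(2) unfolding topspace_places_top places_eq_lam_chi[OF rc] full_iff by blast
  have pre: "{C \<in> topspace interval_topology. lam (chi C) \<in> ?U} = V"
    unfolding topspace_interval_topology using mem V(2) full_def by blast
  have gen: "U \<subseteq> topspace places_top \<Longrightarrow>
      openin interval_topology {C \<in> topspace interval_topology. lam (chi C) \<in> U} \<longleftrightarrow> openin places_top U"
    for U :: "('a poly fract \<Rightarrow> real option) set"
    using quotient_map_places unfolding quotient_map_def by blast
  show "openin places_top ?U" using gen[OF sub] V(1) unfolding pre by blast
qed

lemma topspace_full_topology: "topspace full_topology = (cuts :: ('a set \<times> 'a set) set)"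
proof -
  have "openin interval_topology (cuts :: ('a set \<times> 'a set) set)"
    using openin_topspace[of interval_topology] unfolding topspace_interval_topology .
  moreover have "full (cuts :: ('a set \<times> 'a set) set)" unfolding full_def by blast
  moreover have "U \<subseteq> cuts" if "full U" for U :: "('a set \<times> 'a set) set" using that unfolding full_def by blast
  ultimately show ?thesis unfolding full_topology_def topology_generated_by_topspace by blast
qed

end

section \<open>Extensions of real closed fields\<close>

text \<open>A gap ending at \<open>x\<close> and closed under reflection is too rigid to be larger:
  above \<open>x\<close>, reflecting \<open>u\<close> at the midpoint of \<open>u\<close> and
  \<open>x\<close> would give \<open>x\<close>; below, reflecting \<open>u\<close> at
  \<open>x\<close> would leave the gap. This pins down the lifts of the cuts at single elements,
  used below as approximants.\<close>

lemma (in rcf) le_cut_equal_places: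
  assumes C: "C \<in> cuts" and eq: "lam (chi C) = lam (chi (le_cut x :: 'a set \<times> 'a set))"
  shows "fst C = {..x} \<or> fst C = {..<x}"
proof -
  have le: "le_cut x \<in> cuts" "fst (le_cut x) = {..x}" using lt_le_cut_in_cuts by (auto simp: le_cut_def)
  show ?thesis
  proof (cases "{..x} \<subseteq> fst C")
    case True
    then have refl: "reflection_closed (fst C - {..x})"
      using equal_places_iff[OF le(1) C] eq le(2) by simp
    have "u \<le> x" if u: "u \<in> fst C" for u
    proof (rule ccontr)
      assume ux: "\<not> u \<le> x"
      then have "x < (u + x) / 2" "(u + x) / 2 \<le> u" by (simp_all add: field_simps)
      then have "(u + x) / 2 \<in> fst C - {..x}" using cutsD[OF C u, of "(u + x) / 2"] by simp
      moreover have "2 * ((u + x) / 2) - u = x" by (simp add: field_simps)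
      ultimately show False using reflection_closedD(1)[OF refl, of u "(u + x) / 2"] u ux by simp
    qed
    then show ?thesis using True by blast
  next
    case False
    then have sub: "fst C \<subseteq> {..x}" using cuts_linear[OF C le(1)] le(2) by blast
    then have refl: "reflection_closed ({..x} - fst C)"
      using equal_places_iff[OF C le(1)] eq le(2) by simp
    have x: "x \<notin> fst C" using False cutsD[OF C, of x] by blast
    have "u \<in> fst C" if u: "u < x" for u
      using reflection_closedD(1)[OF refl, of u x] u x by force
    then have "fst C = {..<x}" using sub x by (auto simp: less_le)
    then show ?thesis ..
  qed
qed

lemma (in rcf) is_ball_singleton: "is_ball {a :: 'a}"
  unfolding is_ball_iff reflection_closed_def by auto

text \<open>Nonemptiness is included so that \<open>({}, UNIV)\<close> counts as a cut without a
  minimum above, and \<open>(UNIV, {})\<close> as one without a maximum below; each then has only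
  one admissible side of approach.\<close>

definition has_no_max :: "'a::linorder set \<Rightarrow> bool" where
  "has_no_max D \<longleftrightarrow> D \<noteq> {} \<and> (\<forall>d\<in>D. \<exists>d'\<in>D. d < d')"

definition has_no_min :: "'a::linorder set \<Rightarrow> bool" where
  "has_no_min E \<longleftrightarrow> E \<noteq> {} \<and> (\<forall>b\<in>E. \<exists>b'\<in>E. b' < b)"

lemma not_has_no_max_cut:
  assumes C: "C \<in> cuts" and "fst C \<noteq> {}" "\<not> has_no_max (fst C)"
  obtains m where "fst C = {..m}"
proof -
  obtain m where m: "m \<in> fst C" "\<And>d. d \<in> fst C \<Longrightarrow> d \<le> m"
    using assms unfolding has_no_max_def by (meson not_less)
  then have "fst C = {..m}" using cutsD[OF C m(1)] by blast
  then show thesis using that by blast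
qed

lemma not_has_no_min_cut:
  assumes C: "C \<in> cuts" and "fst C \<noteq> UNIV" "\<not> has_no_min (- fst C)"
  obtains m where "fst C = {..<m}"
proof -
  have "- fst C \<noteq> {}" using assms by auto
  then obtain m where m: "m \<notin> fst C" "\<And>d. d \<notin> fst C \<Longrightarrow> m \<le> d"
    using assms(3) unfolding has_no_min_def by (metis ComplD ComplI not_less)
  then have "fst C = {..<m}" using cut_less_if_mem[OF C _ m(1)] by (force simp: not_less[symmetric])
  then show thesis using that by blast
qed

lemma cut_no_max_or_no_min:
  fixes C :: "'a::linordered_field set \<times> 'a set"
  assumes C: "C \<in> cuts"
  shows "has_no_max (fst C) \<or> has_no_min (- fst C)"
proof (cases "fst C = {}")
  case True
  then show ?thesis unfolding has_no_min_def by (auto intro: lt_ex)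
next
  case ne: False
  show ?thesis
  proof (rule ccontr)
    assume n: "\<not> (has_no_max (fst C) \<or> has_no_min (- fst C))"
    then obtain m where m: "fst C = {..m}" using not_has_no_max_cut[OF C ne] by blast
    obtain u where "m < u" using gt_ex by blast
    have "has_no_min (- fst C)" unfolding has_no_min_def m
      using \<open>m < u\<close> dense by (auto simp: not_le)
    then show False using n by blast
  qed
qed

section \<open>The embedding and its effect on places and cuts\<close>

locale rcf_extension = R: rcf tyR + F: rcf tyF
  for tyR :: "'r::linordered_field itself" and tyF :: "'f::linordered_field itself" +
  fixes e :: "'r \<Rightarrow> 'f"
  assumes hom: "field_hom e"
begin

lemma e_1: "e 1 = 1" and e_add: "e (a + b) = e a + e b" and e_mult: "e (a * b) = e a * e b"
  using hom unfolding field_hom_def by blast+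

lemma e_0: "e 0 = 0" using e_add[of 0 0] by simp

lemma e_minus: "e (- a) = - e a" using e_add[of a "- a"] by (simp add: e_0 eq_neg_iff_add_eq_0 add.commute)

lemma e_diff: "e (a - b) = e a - e b" using e_add[of a "- b"] by (simp add: e_minus)

lemma e_of_nat: "e (of_nat n) = of_nat n" by (induction n) (simp_all add: e_0 e_1 e_add)

lemma e_eq_0_iff: "e a = 0 \<longleftrightarrow> a = 0"
proof
  assume "e a = 0"
  show "a = 0"
  proof (rule ccontr)
    assume "a \<noteq> 0"
    then have "e a * e (inverse a) = 1" by (simp add: e_1 flip: e_mult)
    then show False using \<open>e a = 0\<close> by simp
  qed
qed (simp add: e_0)

lemma e_inverse: "e (inverse a) = inverse (e a)"
proof (cases "a = 0")
  case False
  then have "e a * e (inverse a) = 1" by (simp add: e_1 flip: e_mult)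
  then show ?thesis by (metis inverse_unique)
qed (simp add: e_0)

lemma e_divide: "e (a / b) = e a / e b" by (simp add: divide_inverse e_mult e_inverse)

text \<open>Positive elements of \<open>R\<close> are squares, so a field embedding preserves the
  order automatically.\<close>

lemma e_less_iff: "e a < e b \<longleftrightarrow> a < b"
proof -
  have less: "e a < e b" if ab: "a < b" for a b
  proof -
    obtain s where "s * s = b - a" using real_closedD(1)[OF R.rc, of "b - a"] ab by auto
    then have "e b - e a = e s * e s" by (simp flip: e_mult e_diff)
    moreover have "e b - e a \<noteq> 0" using ab e_eq_0_iff[of "b - a"] by (simp add: e_diff)
    ultimately show ?thesis by (metis diff_gt_0_iff_gt le_less zero_le_square)
  qed
  show ?thesis using less[of a b] less[of b a] by (metis less_asym less_irrefl linorder_neqE)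
qed

lemma e_le_iff: "e a \<le> e b \<longleftrightarrow> a \<le> b" by (simp add: e_less_iff flip: not_less)

lemma e_abs: "e \<bar>a\<bar> = \<bar>e a\<bar>"
  using e_less_iff[of a 0] by (simp add: abs_if e_minus e_0)

lemma e_numeral: "e (numeral n) = numeral n"
  using e_of_nat[of "numeral n"] by simp

lemma map_poly_e_add: "map_poly e (p + q) = map_poly e p + map_poly e q"
  by (intro map_poly_hom_add e_0 e_add)

lemma map_poly_e_mult: "map_poly e (p * q) = map_poly e p * map_poly e q"
  by (intro map_poly_hom_mult e_0 e_add e_mult)

lemma map_poly_e_eq_0_iff: "map_poly e p = 0 \<longleftrightarrow> p = 0"
  by (auto simp: poly_eq_iff coeff_map_poly e_0 e_eq_0_iff)

lemma rf_emb_Fract: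
  assumes "q \<noteq> 0" shows "rf_emb e (Fract p q) = Fract (map_poly e p) (map_poly e q)"
  unfolding rf_emb_def
proof (rule the_equality)
  show "\<exists>p' q'. q' \<noteq> 0 \<and> Fract p q = Fract p' q' \<and> Fract (map_poly e p) (map_poly e q) = Fract (map_poly e p') (map_poly e q')"
    using assms by blast
  fix z assume "\<exists>p' q'. q' \<noteq> 0 \<and> Fract p q = Fract p' q' \<and> z = Fract (map_poly e p') (map_poly e q')"
  then obtain p' q' where *: "q' \<noteq> 0" "Fract p q = Fract p' q'" "z = Fract (map_poly e p') (map_poly e q')" by blast
  then have "p * q' = p' * q" using assms by (simp add: eq_fract)
  then have "map_poly e p * map_poly e q' = map_poly e p' * map_poly e q" by (metis map_poly_e_mult)
  then show "z = Fract (map_poly e p) (map_poly e q)"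
    using * assms by (simp add: eq_fract map_poly_e_eq_0_iff)
qed

lemma rf_emb_add: "rf_emb e (x + y) = rf_emb e x + rf_emb e y"
  and rf_emb_mult: "rf_emb e (x * y) = rf_emb e x * rf_emb e y"
proof -
  obtain p q where x: "x = Fract p q" "q \<noteq> 0" by (cases x)
  obtain r s where y: "y = Fract r s" "s \<noteq> 0" by (cases y)
  show "rf_emb e (x + y) = rf_emb e x + rf_emb e y" "rf_emb e (x * y) = rf_emb e x * rf_emb e y"
    using x y by (simp_all add: rf_emb_Fract map_poly_e_eq_0_iff map_poly_e_add map_poly_e_mult)
qed

lemma rf_emb_eq_0_iff: "rf_emb e x = 0 \<longleftrightarrow> x = 0"
proof -
  obtain p q where x: "x = Fract p q" "q \<noteq> 0" by (cases x)
  then show ?thesis by (simp add: rf_emb_Fract Fract_zero_iff map_poly_e_eq_0_iff)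
qed

lemma rf_emb_1: "rf_emb e 1 = 1"
  unfolding One_fract_def by (simp add: rf_emb_Fract one_pCons map_poly_pCons e_1 e_0)

lemma rf_emb_0: "rf_emb e 0 = 0" using rf_emb_eq_0_iff by blast

lemma rf_emb_minus: "rf_emb e (- x) = - rf_emb e x"
  using rf_emb_add[of x "- x"] by (simp add: rf_emb_0 eq_neg_iff_add_eq_0 add.commute)

lemma rf_emb_diff: "rf_emb e (x - y) = rf_emb e x - rf_emb e y"
  using rf_emb_add[of x "- y"] by (simp add: rf_emb_minus)

lemma rf_emb_of_nat: "rf_emb e (of_nat n) = of_nat n"
  by (induction n) (simp_all add: rf_emb_0 rf_emb_1 rf_emb_add)

lemma rf_emb_of_int: "rf_emb e (of_int n) = of_int n"
  by (cases n rule: int_cases2) (simp_all add: rf_emb_of_nat rf_emb_minus)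

lemma rf_emb_linear: "rf_emb e (rf_y - rf_const d) = rf_y - rf_const (e d)"
  unfolding rf_y_diff by (simp add: rf_emb_Fract map_poly_pCons e_0 e_1 e_minus one_pCons)

lemma restrict_cut_in_cuts: "C \<in> cuts \<Longrightarrow> restrict_cut e C \<in> cuts"
  unfolding cuts_def restrict_cut_def using e_less_iff by fastforce

lemma fst_restrict_cut: "fst (restrict_cut e C) = {d. e d \<in> fst C}"
  unfolding restrict_cut_def by auto

text \<open>The ordering of the cut pulls back along \<open>rf_emb\<close> to an ordering with the
  restricted cut. \<open>lam\<close> is expressed by field operations and membership in the ordering
  alone, so it commutes with pulling back.\<close>

lemma res_place:
  assumes C: "C \<in> cuts"
  shows "res e (lam (chi C)) = lam (chi (restrict_cut e C))"
proof -
  interpret ordered_by "chi C" using F.ord_chi[OF C] rational_ordered_by.axioms(1) by blast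
  let ?P = "rf_emb e -` chi C"
  have zero: "x = 0" if "x \<in> ?P" "- x \<in> ?P" for x
    using that P_antisym[of "rf_emb e x"] by (simp add: rf_emb_minus rf_emb_eq_0_iff)
  have "x \<in> ?P \<union> uminus ` ?P" for x
    using P_or_neg[of "rf_emb e x"] by (auto simp: image_iff rf_emb_minus intro!: bexI[of _ "- x"])
  moreover have "?P \<inter> uminus ` ?P = {0}"
    using zero P_0 by (force simp: image_iff rf_emb_0)
  ultimately have "field_ordering ?P"
    unfolding field_ordering_def using P_add P_mult by (auto simp: rf_emb_add rf_emb_mult)
  moreover have "fst (restrict_cut e C) = {d. rf_y - rf_const d \<in> ?P}"
    using fst_chi[OF F.rc C] unfolding fst_restrict_cut by (auto simp: rf_emb_linear)
  ultimately have chi: "chi (restrict_cut e C) = ?P"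
    by (intro chi_eqI[OF R.rc restrict_cut_in_cuts[OF C]])
  show ?thesis
    unfolding chi res_def by (rule ext)
      (simp add: lam_def rf_emb_add rf_emb_diff rf_emb_mult rf_emb_of_nat rf_emb_of_int)
qed

definition lower_ext :: "'r set \<times> 'r set \<Rightarrow> 'f set \<times> 'f set" where
  "lower_ext C = upper_cut (e ` fst C)"

definition upper_ext :: "'r set \<times> 'r set \<Rightarrow> 'f set \<times> 'f set" where
  "upper_ext C = lower_cut (e ` (- fst C))"

lemma mem_lower_ext: "t \<in> fst (lower_ext C) \<longleftrightarrow> (\<exists>d\<in>fst C. t \<le> e d)"
  unfolding lower_ext_def upper_cut_def by auto

lemma mem_upper_ext: "t \<in> fst (upper_ext C) \<longleftrightarrow> (\<forall>b. b \<notin> fst C \<longrightarrow> t < e b)"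
  unfolding upper_ext_def lower_cut_def by (auto simp: not_le)

lemma lower_ext_in_cuts: "lower_ext C \<in> cuts" and upper_ext_in_cuts: "upper_ext C \<in> cuts"
  unfolding lower_ext_def upper_ext_def upper_cut_def lower_cut_def
  by (force intro!: cutI, force simp: cuts_def not_le)

lemma restrict_lower_ext: "C \<in> cuts \<Longrightarrow> restrict_cut e (lower_ext C) = C"
  and restrict_upper_ext: "C \<in> cuts \<Longrightarrow> restrict_cut e (upper_ext C) = C"
proof -
  assume C: "C \<in> cuts"
  show "restrict_cut e (lower_ext C) = C"
    by (rule cut_eqI[OF restrict_cut_in_cuts[OF lower_ext_in_cuts] C])
      (use cutsD[OF C] in \<open>auto simp: fst_restrict_cut mem_lower_ext e_le_iff\<close>)
  show "restrict_cut e (upper_ext C) = C"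
    by (rule cut_eqI[OF restrict_cut_in_cuts[OF upper_ext_in_cuts] C])
      (use cut_less_if_mem[OF C] in \<open>auto simp: fst_restrict_cut mem_upper_ext e_less_iff\<close>)
qed

lemma lower_ext_subset_upper_ext: "C \<in> cuts \<Longrightarrow> fst (lower_ext C) \<subseteq> fst (upper_ext C)"
proof
  fix t assume C: "C \<in> cuts" and "t \<in> fst (lower_ext C)"
  then obtain d where d: "d \<in> fst C" "t \<le> e d" unfolding mem_lower_ext by blast
  have "t < e b" if "b \<notin> fst C" for b
    using cut_less_if_mem[OF C d(1) that] d(2) e_less_iff by (meson le_less_trans)
  then show "t \<in> fst (upper_ext C)" unfolding mem_upper_ext by blast
qed

text \<open>The canonical choice: the extension that is a limit of lifts from a side on which the
  cut can be approached. It represents every admissible map on the level of places, and it is also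
  the map on cuts produced in the converse.\<close>

definition ext_cut :: "'r set \<times> 'r set \<Rightarrow> 'f set \<times> 'f set" where
  "ext_cut C = (if has_no_max (fst C) then lower_ext C else upper_ext C)"

lemma ext_cut_in_cuts: "ext_cut C \<in> cuts"
  using lower_ext_in_cuts upper_ext_in_cuts by (simp add: ext_cut_def)

lemma restrict_ext_cut: "C \<in> cuts \<Longrightarrow> restrict_cut e (ext_cut C) = C"
  using restrict_lower_ext restrict_upper_ext by (simp add: ext_cut_def)

lemma mem_restrict: "restrict_cut e C' = C \<Longrightarrow> e d \<in> fst C' \<longleftrightarrow> d \<in> fst C"
  by (metis (no_types) fst_restrict_cut mem_Collect_eq)

text \<open>Half of the squeezing arguments below: a cut of \<open>F\<close> already separated from
  \<open>C\<close> by an element of \<open>R\<close> cannot enter the gap between the two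
  extensions.\<close>

lemma subset_lower_ext:
  assumes C': "C' \<in> cuts" and x: "x \<in> fst C" "e x \<notin> fst C'" shows "fst C' \<subseteq> fst (lower_ext C)"
  using cut_less_if_mem[OF C' _ x(2)] x(1) by (force simp: mem_lower_ext)

lemma upper_ext_subset:
  assumes C': "C' \<in> cuts" and x: "x \<notin> fst C" "e x \<in> fst C'" shows "fst (upper_ext C) \<subseteq> fst C'"
  using cutsD[OF C' x(2)] x(1) by (force simp: mem_upper_ext)

end

section \<open>Embeddings of spaces of places\<close>

context rcf_extension
begin

lemma value_group_imageI:
  assumes conv: "convex_subgroup (value_group_image e)"
    and "a \<noteq> 0" "b \<noteq> 0" "z \<noteq> 0" and "\<bar>z\<bar> \<le> \<bar>e a\<bar>" "\<bar>e b\<bar> \<le> \<bar>z\<bar>"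
  obtains c where "c \<noteq> 0" "cval z = cval (e c)"
proof -
  have le: "val_le (cval (e a)) (cval z)" "val_le (cval z) (cval (e b))"
    using assms by (auto simp: val_le_cval_iff e_eq_0_iff intro!: exI[of _ 1])
  have "cval (e a) \<in> value_group_image e" "cval (e b) \<in> value_group_image e"
    using assms unfolding value_group_image_def by blast+
  moreover have "cval z \<in> value_group" using assms unfolding value_group_def by blast
  ultimately have "cval z \<in> value_group_image e"
    using conv le unfolding convex_subgroup_def by blast
  then show thesis using that unfolding value_group_image_def by blast
qed

text \<open>The reflection of \<open>x\<close> at \<open>w\<close> can leave the gap only past some \<open>e b\<close>. By convexity the gap then
  has the value of some constant \<open>c\<close>, and stepping down from \<open>b\<close> by a fraction of \<open>c\<close> would land
  between \<open>x\<close> and \<open>w\<close>.\<close>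

lemma gap_reflect_up:
  assumes conv: "convex_subgroup (value_group_image e)"
    and D: "D \<noteq> {}" and E: "has_no_min E" and DE: "D \<union> E = UNIV"
    and x: "\<And>d. d \<in> D \<Longrightarrow> e d < x" and w: "\<And>b. b \<in> E \<Longrightarrow> w < e b" and xw: "x < w" and b: "b \<in> E"
  shows "2 * w - x < e b"
proof (rule ccontr)
  assume "\<not> 2 * w - x < e b"
  then have le: "e b - x \<le> 2 * (w - x)" by (simp add: algebra_simps)
  obtain b1 where b1: "b1 \<in> E" "b1 < b" using E b unfolding has_no_min_def by blast
  obtain d where d: "d \<in> D" using D by blast
  have pos: "0 < e b - x" using w[OF b] xw by simp
  \<comment> \<open>Absence of a minimum above the cut supplies \<open>b1\<close>, and with it a
    nonzero constant not exceeding \<open>e b - x\<close>; any \<open>d\<close> below the cut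
    supplies one that is not smaller. This is the situation convexity applies to.\<close>
  have lo: "e (b - b1) \<le> e b - x" using w[OF b1(1)] xw by (simp add: e_diff)
  have hi: "e b - x \<le> e (b - d)" using x[OF d] by (simp add: e_diff)
  have p1: "0 < e (b - b1)" using b1 e_less_iff[of 0 "b - b1"] by (simp add: e_0)
  have p2: "0 < e (b - d)" using pos hi by linarith
  obtain c where c: "c \<noteq> 0" "cval (e b - x) = cval (e c)"
  proof (rule value_group_imageI[OF conv, of "b - d" "b - b1" "e b - x"])
    show "b - d \<noteq> 0" "b - b1 \<noteq> 0" using p1 p2 by (auto simp: e_0)
    show "e b - x \<noteq> 0" "\<bar>e b - x\<bar> \<le> \<bar>e (b - d)\<bar>" "\<bar>e (b - b1)\<bar> \<le> \<bar>e b - x\<bar>" using pos lo hi p1 p2 by auto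
  qed blast
  obtain m n :: nat where "\<bar>e c\<bar> \<le> of_nat n * \<bar>e b - x\<bar>" "\<bar>e b - x\<bar> \<le> of_nat m * \<bar>e c\<bar>"
    using cval_eqD[OF c(2)] cval_eqD[OF c(2)[symmetric]] by blast
  then have mn: "e \<bar>c\<bar> \<le> of_nat n * (e b - x)" "e b - x \<le> of_nat m * e \<bar>c\<bar>" using pos by (simp_all add: e_abs)
  \<comment> \<open>Since \<open>e b - x\<close> is at most \<open>2 (w - x)\<close>, the constant
    \<open>e \<bar>c\<bar>\<close> is at most \<open>2 n (w - x)\<close>. The divisor
    \<open>2 * n + 1\<close> therefore makes \<open>e \<delta>\<close> strictly smaller than
    \<open>w - x\<close>.\<close>
  define \<delta> where "\<delta> = \<bar>c\<bar> / of_nat (2 * n + 1)"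
  have cd: "\<bar>c\<bar> = of_nat (2 * n + 1) * \<delta>"
    unfolding \<delta>_def by (metis nonzero_mult_div_cancel_left of_nat_eq_0_iff times_divide_eq_right add_is_0 one_neq_zero)
  have d0: "0 < \<delta>" unfolding \<delta>_def using c(1)
    by (intro divide_pos_pos) (simp, simp only: of_nat_0_less_iff)
  then have ed0: "0 < e \<delta>" using e_less_iff[of 0 \<delta>] by (simp add: e_0)
  have step: "e \<delta> < w - x"
  proof (rule ccontr)
    assume "\<not> e \<delta> < w - x"
    then have "of_nat n * (e b - x) \<le> of_nat n * (2 * e \<delta>)" using le by (intro mult_left_mono) auto
    moreover have "e \<bar>c\<bar> = of_nat n * (2 * e \<delta>) + e \<delta>"
      unfolding cd by (simp add: e_mult e_of_nat e_add e_1 e_numeral algebra_simps)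
    ultimately show False using mn(1) ed0 by linarith
  qed
  \<comment> \<open>The first step of length \<open>e \<delta>\<close> from \<open>e b\<close> that
    falls below \<open>w\<close> still lies above \<open>x\<close>, because the step is shorter than
    \<open>w - x\<close>. The bound \<open>m * (2 * n + 1) + 1\<close> ensures that there is such a
    step.\<close>
  define hits where "hits k \<longleftrightarrow> e b - of_nat k * e \<delta> < w" for k :: nat
  have "hits (m * (2 * n + 1) + 1)"
  proof -
    have "e b - x \<le> of_nat (m * (2 * n + 1)) * e \<delta>"
      using mn(2) unfolding cd by (simp add: e_mult e_of_nat e_add e_1 e_numeral algebra_simps)
    then show ?thesis unfolding hits_def using xw ed0 by (simp add: algebra_simps)
  qed
  then obtain k where k: "hits k" "\<And>j. j < k \<Longrightarrow> \<not> hits j" using exists_least_iff[of hits] by blast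
  have "k \<noteq> 0" using k(1) w[OF b] unfolding hits_def by (intro notI) simp
  then obtain j where j: "k = Suc j" by (metis not0_implies_Suc)
  have "\<not> hits j" using k(2) j by simp
  then have "x < e b - of_nat k * e \<delta>" unfolding hits_def using step by (simp add: j algebra_simps)
  moreover have "e b - of_nat k * e \<delta> = e (b - of_nat k * \<delta>)" by (simp add: e_diff e_mult e_of_nat)
  ultimately have "x < e (b - of_nat k * \<delta>)" "e (b - of_nat k * \<delta>) < w" using k(1) unfolding hits_def by simp_all
  moreover have "b - of_nat k * \<delta> \<in> D \<or> b - of_nat k * \<delta> \<in> E" using DE by blast
  ultimately show False using x w by (meson less_asym)
qed

lemma gap_reflection_closed:
  assumes conv: "convex_subgroup (value_group_image e)" and C: "C \<in> cuts"
    and D: "has_no_max (fst C)" and E: "has_no_min (- fst C)"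
  shows "reflection_closed (fst (upper_ext C) - fst (lower_ext C))"
proof -
  let ?D = "fst C" and ?E = "- fst C"
  have mem: "t \<in> fst (upper_ext C) - fst (lower_ext C) \<longleftrightarrow> (\<forall>d\<in>?D. e d < t) \<and> (\<forall>b\<in>?E. t < e b)" for t
    unfolding Diff_iff mem_upper_ext mem_lower_ext by (auto simp: not_le)
  have D0: "?D \<noteq> {}" and E0: "?E \<noteq> {}" using D E unfolding has_no_max_def has_no_min_def by blast+
  \<comment> \<open>Downward reflection is upward reflection in the negated gap, so the same lemma
    serves both directions.\<close>
  have E': "has_no_min (uminus ` ?D)"
    using D unfolding has_no_max_def has_no_min_def by force
  have DE': "uminus ` ?E \<union> uminus ` ?D = UNIV"
    by (metis Compl_partition2 image_Un surj_uminus)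
  have "2 * w - x \<in> fst (upper_ext C) - fst (lower_ext C)"
    if x: "x \<in> fst (upper_ext C) - fst (lower_ext C)" and w: "w \<in> fst (upper_ext C) - fst (lower_ext C)" for x w
  proof (cases x w rule: linorder_cases)
    case less
    have "2 * w - x < e b" if "b \<in> ?E" for b
      by (rule gap_reflect_up[OF conv D0 E _ _ _ less that]) (use x w mem in auto)
    moreover have "e d < 2 * w - x" if "d \<in> ?D" for d
    proof -
      have "e d < w" using w mem that by blast
      then show ?thesis using less by linarith
    qed
    ultimately show ?thesis unfolding mem by blast
  next
    case greater
    have "2 * (- w) - (- x) < e (- d)" if "d \<in> ?D" for d
    proof (rule gap_reflect_up[OF conv _ E' DE'])
      show "uminus ` ?E \<noteq> {}" using E0 by blast
      show "e d < - x" if "d \<in> uminus ` ?E" for d using that x mem by (auto simp: e_minus)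
      show "- w < e b" if "b \<in> uminus ` ?D" for b using that w mem by (auto simp: e_minus)
      show "- x < - w" "- d \<in> uminus ` ?D" using greater that by auto
    qed
    then have "e d < 2 * w - x" if "d \<in> ?D" for d using that by (force simp: e_minus)
    moreover have "2 * w - x < e b" if "b \<in> ?E" for b
    proof -
      have "w < e b" using w mem that by blast
      then show ?thesis using greater by linarith
    qed
    ultimately show ?thesis unfolding mem by blast
  qed (use x in simp)
  then show ?thesis
    unfolding reflection_closed_def using cutsD[OF upper_ext_in_cuts] cutsD[OF lower_ext_in_cuts] by blast
qed

lemma lower_upper_ext_places:
  assumes "convex_subgroup (value_group_image e)" "C \<in> cuts" "has_no_max (fst C)" "has_no_min (- fst C)"
  shows "lam (chi (lower_ext C)) = lam (chi (upper_ext C))"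
  using F.equal_places_iff[OF lower_ext_in_cuts upper_ext_in_cuts lower_ext_subset_upper_ext]
    gap_reflection_closed assms by blast

section \<open>Admissible cut maps and the maps of places that they induce\<close>

lemma ball_complement_edges:
  assumes "is_ball (B :: 'a::linordered_field set)"
  shows "ball_complement B (fst (lower_cut B)) (snd (upper_cut B))"
proof -
  have refl: "reflection_closed B" and ne: "B \<noteq> {}" using assms is_ball_iff by blast+
  show ?thesis unfolding ball_complement_def
  proof (intro conjI ballI)
    fix d b assume "d \<in> fst (lower_cut B)" "b \<in> B"
    then show "d < b" unfolding lower_cut_def by force
  next
    fix x b assume "x \<in> snd (upper_cut B)" "b \<in> B"
    then show "b < x" unfolding upper_cut_def by force
  next
    have "t \<in> B" if "a \<in> B" "a \<le> t" "b \<in> B" "t \<le> b" for a b t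
      using reflection_closedD(2)[OF refl] that by blast
    then show "fst (lower_cut B) \<union> B \<union> snd (upper_cut B) = UNIV"
      unfolding lower_cut_def upper_cut_def by auto
  qed
qed

lemma admissible_cases:
  assumes adm: "admissible_cut_map e \<tau>" and C: "C \<in> cuts"
  shows "fst C = {} \<Longrightarrow> \<tau> C = upper_ext C" "fst C = UNIV \<Longrightarrow> \<tau> C = lower_ext C"
    "is_ball B \<Longrightarrow> B \<noteq> UNIV \<Longrightarrow> \<tau> (lower_cut B) = lower_ext (lower_cut B) \<and> \<tau> (upper_cut B) = upper_ext (upper_cut B)"
    "fst C \<noteq> {} \<Longrightarrow> fst C \<noteq> UNIV \<Longrightarrow> \<tau> C = lower_ext C \<or> \<tau> C = upper_ext C"
proof -
  show "\<tau> C = upper_ext C" if e: "fst C = {}"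
  proof -
    have "C = ({}, UNIV)" using snd_cut[OF C] e by (metis Compl_empty_eq prod.collapse)
    then show ?thesis using adm unfolding admissible_cut_map_def upper_ext_def by simp
  qed
  show "\<tau> C = lower_ext C" if e: "fst C = UNIV"
  proof -
    have "C = (UNIV, {})" using snd_cut[OF C] e by (metis Compl_UNIV_eq prod.collapse)
    then show ?thesis using adm unfolding admissible_cut_map_def lower_ext_def by simp
  qed
  show ball: "\<tau> (lower_cut B) = lower_ext (lower_cut B) \<and> \<tau> (upper_cut B) = upper_ext (upper_cut B)"
    if "is_ball B" "B \<noteq> UNIV" for B
    using adm ball_complement_edges[OF that(1)] that snd_cut[OF lower_upper_cut_ball(2)[OF that(1)]]
    unfolding admissible_cut_map_def lower_ext_def upper_ext_def by metis
  show "\<tau> C = lower_ext C \<or> \<tau> C = upper_ext C" if ne: "fst C \<noteq> {}" "fst C \<noteq> UNIV"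
  proof (cases "ball_cut C")
    case True
    then obtain B where B: "is_ball B" "C = upper_cut B \<or> C = lower_cut B" unfolding ball_cut_def by blast
    have "B \<noteq> UNIV" using B(2) ne unfolding upper_cut_def lower_cut_def by auto
    then show ?thesis using ball B by blast
  next
    case False
    then have "\<tau> C = upper_cut (e ` fst C) \<or> \<tau> C = lower_cut (e ` snd C)"
      using adm C unfolding admissible_cut_map_def by blast
    then show ?thesis unfolding lower_ext_def upper_ext_def snd_cut[OF C] .
  qed
qed

text \<open>If both sides lack an extremum, the two extensions carry the same place. If only one
  does, the cut is an edge of the singleton ball of the remaining extremum, and admissibility
  prescribes exactly the required extension.\<close>

lemma admissible_place:
  assumes conv: "convex_subgroup (value_group_image e)" and adm: "admissible_cut_map e \<tau>" and C: "C \<in> cuts"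
  shows "has_no_max (fst C) \<Longrightarrow> lam (chi (\<tau> C)) = lam (chi (lower_ext C))"
    and "has_no_min (- fst C) \<Longrightarrow> lam (chi (\<tau> C)) = lam (chi (upper_ext C))"
proof -
  note cases = admissible_cases[OF adm C]
  show "lam (chi (\<tau> C)) = lam (chi (lower_ext C))" if nm: "has_no_max (fst C)"
  proof (cases "fst C = UNIV")
    case False
    have ne: "fst C \<noteq> {}" using nm unfolding has_no_max_def by blast
    show ?thesis
    proof (cases "has_no_min (- fst C)")
      case True
      then show ?thesis using cases(4)[OF ne False] lower_upper_ext_places[OF conv C nm True] by auto
    next
      case False
      obtain m where m: "fst C = {..<m}" using not_has_no_min_cut[OF C \<open>fst C \<noteq> UNIV\<close> False] .
      have "fst (lower_cut {m}) = {..<m}" by (auto simp: lower_cut_def)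
      then have "C = lower_cut {m}"
        using cut_eqI[OF C lower_upper_cut_ball(1)[OF R.is_ball_singleton]] m by simp
      moreover have "{m} \<noteq> UNIV" using gt_ex[of m] by (metis UNIV_I less_irrefl singletonD)
      ultimately show ?thesis using admissible_cases(3)[OF adm C R.is_ball_singleton] by simp
    qed
  qed (simp add: cases(2))
  show "lam (chi (\<tau> C)) = lam (chi (upper_ext C))" if nm: "has_no_min (- fst C)"
  proof (cases "fst C = {}")
    case False
    have ne: "fst C \<noteq> UNIV" using nm unfolding has_no_min_def by blast
    show ?thesis
    proof (cases "has_no_max (fst C)")
      case True
      then show ?thesis using cases(4)[OF False ne] lower_upper_ext_places[OF conv C True nm] by auto
    next
      case nmax: False
      obtain m where m: "fst C = {..m}" using not_has_no_max_cut[OF C False nmax] .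
      have "fst (upper_cut {m}) = {..m}" by (auto simp: upper_cut_def)
      then have "C = upper_cut {m}"
        using cut_eqI[OF C lower_upper_cut_ball(2)[OF R.is_ball_singleton]] m by simp
      moreover have "{m} \<noteq> UNIV" using gt_ex[of m] by (metis UNIV_I less_irrefl singletonD)
      ultimately show ?thesis using admissible_cases(3)[OF adm C R.is_ball_singleton] by simp
    qed
  qed (simp add: cases(1))
qed

text \<open>The right-hand side does not mention \<open>\<tau>\<close>: this is the independence of
  the choice.\<close>

lemma admissible_ext_cut:
  assumes "convex_subgroup (value_group_image e)" "admissible_cut_map e \<tau>" "C \<in> cuts"
  shows "lam (chi (\<tau> C)) = lam (chi (ext_cut C))"
  using admissible_place[OF assms] cut_no_max_or_no_min[OF assms(3)] by (auto simp: ext_cut_def)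

lemma res_ext_cut: "C \<in> cuts \<Longrightarrow> res e (lam (chi (ext_cut C))) = lam (chi C)"
  by (simp add: res_place ext_cut_in_cuts restrict_ext_cut)

text \<open>Points outside the ball remain outside when moved to a third of their distance from the
  centre \<open>a\<close>, on either side. Bounding \<open>x\<close> and \<open>w\<close> by the
  images of such points keeps \<open>2 * w - x\<close> in the gap.\<close>

lemma ball_edges_ext_places:
  assumes B: "is_ball B"
  shows "lam (chi (lower_ext (lower_cut B))) = lam (chi (upper_ext (upper_cut B)))"
proof -
  have refl: "reflection_closed B" and ne: "B \<noteq> {}" using B is_ball_iff by blast+
  obtain a where a: "a \<in> B" using ne by blast
  let ?D = "fst (lower_cut B)" and ?E = "- fst (upper_cut B)"
  let ?G = "fst (upper_ext (upper_cut B)) - fst (lower_ext (lower_cut B))"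
  have mem: "t \<in> ?G \<longleftrightarrow> (\<forall>d\<in>?D. e d < t) \<and> (\<forall>b\<in>?E. t < e b)" for t
    unfolding Diff_iff mem_upper_ext mem_lower_ext by (auto simp: not_le)
  have D: "d \<in> ?D \<longleftrightarrow> d \<notin> B \<and> d < a" and E: "d \<in> ?E \<longleftrightarrow> d \<notin> B \<and> a < d" for d
  proof -
    have mem: "d \<in> ?D \<longleftrightarrow> (\<forall>b\<in>B. d < b)" "d \<in> ?E \<longleftrightarrow> (\<forall>b\<in>B. b < d)"
      unfolding lower_cut_def upper_cut_def by (auto simp: not_le)
    have conv: "d \<in> B" if "b \<in> B" "b' \<in> B" "b \<le> d" "d \<le> b'" for b b'
      using reflection_closedD(2)[OF refl] that by blast
    show "d \<in> ?D \<longleftrightarrow> d \<notin> B \<and> d < a" unfolding mem using a conv by (meson less_imp_le less_irrefl not_less)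
    show "d \<in> ?E \<longleftrightarrow> d \<notin> B \<and> a < d" unfolding mem using a conv by (meson less_imp_le less_irrefl not_less)
  qed
  \<comment> \<open>The fraction is chosen so that \<open>a - (d - a) / 3\<close>, reflected at
    \<open>a + (d - a) / 3\<close>, gives exactly \<open>d\<close>.\<close>
  have third: "a + (t - a) / 3 \<notin> B \<and> a - (t - a) / 3 \<notin> B" if "t \<notin> B" for t
  proof -
    have "\<bar>t - a\<bar> \<le> of_nat 3 * \<bar>(a + (t - a) / 3) - a\<bar>" "\<bar>t - a\<bar> \<le> of_nat 3 * \<bar>(a - (t - a) / 3) - a\<bar>"
      by (simp_all add: abs_divide)
    then show ?thesis using reflection_closed_scale[OF refl a] that by blast
  qed
  have "2 * w - x \<in> ?G" if x: "x \<in> ?G" and w: "w \<in> ?G" for x w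
    unfolding mem
  proof (intro conjI ballI)
    fix d assume d: "d \<in> ?D"
    then have "a - (d - a) / 3 \<in> ?E" "a + (d - a) / 3 \<in> ?D" using third[of d] D E by auto
    then have "x < e (a - (d - a) / 3)" "e (a + (d - a) / 3) < w" using x w mem by blast+
    then show "e d < 2 * w - x" by (simp add: e_add e_diff e_divide e_mult e_numeral field_simps)
  next
    fix d assume d: "d \<in> ?E"
    then have "a - (d - a) / 3 \<in> ?D" "a + (d - a) / 3 \<in> ?E" using third[of d] D E by auto
    then have "e (a - (d - a) / 3) < x" "w < e (a + (d - a) / 3)" using x w mem by blast+
    then show "2 * w - x < e d" by (simp add: e_add e_diff e_divide e_mult e_numeral field_simps)
  qed
  then have "reflection_closed ?G"
    unfolding reflection_closed_def using cutsD[OF upper_ext_in_cuts] cutsD[OF lower_ext_in_cuts] by blast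
  moreover have "fst (lower_ext (lower_cut B)) \<subseteq> fst (upper_ext (upper_cut B))"
  proof
    fix t assume "t \<in> fst (lower_ext (lower_cut B))"
    then obtain d where d: "d \<in> ?D" "t \<le> e d" unfolding mem_lower_ext by blast
    have "t < e b" if "b \<notin> fst (upper_cut B)" for b
    proof -
      have "d < b" using D[of d] E[of b] d that by auto
      then show ?thesis using d(2) e_less_iff by (meson le_less_trans)
    qed
    then show "t \<in> fst (upper_ext (upper_cut B))" unfolding mem_upper_ext by blast
  qed
  ultimately show ?thesis
    using F.equal_places_iff[OF lower_ext_in_cuts upper_ext_in_cuts] by blast
qed

text \<open>Here the gap is the convex hull of the image of \<open>R\<close>, and it is closed under
  reflection because bounds from \<open>R\<close> add up.\<close>

lemma admissible_UNIV_edges: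
  assumes adm: "admissible_cut_map e \<tau>"
  shows "lam (chi (\<tau> ({}, UNIV))) = lam (chi (\<tau> (UNIV, {})))"
proof -
  have \<tau>: "\<tau> ({}, UNIV) = lower_cut (range e)" "\<tau> (UNIV, {}) = upper_cut (range e)"
    using adm unfolding admissible_cut_map_def by blast+
  have c: "lower_cut (range e) \<in> cuts" "upper_cut (range e) \<in> cuts"
    unfolding lower_cut_def upper_cut_def cuts_def by (auto simp: not_le)
      (meson le_less_trans less_le_trans not_le order_trans)+
  have mem: "t \<in> fst (upper_cut (range e)) - fst (lower_cut (range e)) \<longleftrightarrow> (\<exists>a. \<bar>t\<bar> \<le> e a)" for t
  proof
    assume "t \<in> fst (upper_cut (range e)) - fst (lower_cut (range e))"
    then obtain a b where "t \<le> e a" "e b \<le> t" unfolding upper_cut_def lower_cut_def by auto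
    then have "\<bar>t\<bar> \<le> max (e a) (e (- b))" by (auto simp: e_minus abs_le_iff max_def)
    then show "\<exists>a. \<bar>t\<bar> \<le> e a" by (metis max_def)
  next
    assume "\<exists>a. \<bar>t\<bar> \<le> e a"
    then obtain a where "\<bar>t\<bar> \<le> e a" by blast
    then have "t \<le> e a" "e (- a) \<le> t" by (simp_all add: e_minus abs_le_iff)
    then show "t \<in> fst (upper_cut (range e)) - fst (lower_cut (range e))"
      unfolding upper_cut_def lower_cut_def by auto
  qed
  have "reflection_closed (fst (upper_cut (range e)) - fst (lower_cut (range e)))"
    unfolding reflection_closed_def
  proof (intro conjI ballI allI impI)
    fix x w assume "x \<in> fst (upper_cut (range e)) - fst (lower_cut (range e))"
      "w \<in> fst (upper_cut (range e)) - fst (lower_cut (range e))"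
    then obtain a b where ab: "\<bar>x\<bar> \<le> e a" "\<bar>w\<bar> \<le> e b" unfolding mem by blast
    then have "\<bar>2 * w - x\<bar> \<le> e (2 * b + a)" by (simp add: e_add e_mult e_numeral abs_le_iff)
    then show "2 * w - x \<in> fst (upper_cut (range e)) - fst (lower_cut (range e))" unfolding mem by blast
  next
    fix x w y assume "x \<in> fst (upper_cut (range e)) - fst (lower_cut (range e))"
      "w \<in> fst (upper_cut (range e)) - fst (lower_cut (range e))" "x \<le> y \<and> y \<le> w"
    then show "y \<in> fst (upper_cut (range e)) - fst (lower_cut (range e))"
      using cutsD[OF c(1)] cutsD[OF c(2)] by blast
  qed
  moreover have "fst (lower_cut (range e)) \<subseteq> fst (upper_cut (range e))"
    unfolding lower_cut_def upper_cut_def by auto (metis linear)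
  ultimately show ?thesis unfolding \<tau> using F.equal_places_iff[OF c] by blast
qed

lemma admissible_well_defined:
  assumes adm: "admissible_cut_map e \<tau>" and C: "C \<in> cuts" "C' \<in> cuts"
    and eq: "lam (chi C) = lam (chi C')"
  shows "lam (chi (\<tau> C)) = lam (chi (\<tau> C'))"
proof -
  have edges: "lam (chi (\<tau> (lower_cut B))) = lam (chi (\<tau> (upper_cut B)))" if B: "is_ball B" for B
  proof (cases "B = UNIV")
    case True
    have "lower_cut UNIV = ({}, UNIV :: 'r set)" "upper_cut UNIV = (UNIV :: 'r set, {})"
      unfolding lower_cut_def upper_cut_def by auto
    then show ?thesis using admissible_UNIV_edges[OF adm] True by simp
  next
    case False
    then show ?thesis using admissible_cases(3)[OF adm C(1) B] ball_edges_ext_places[OF B] by simp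
  qed
  have "cut_equiv C C'" using R.cut_equiv_iff C eq by blast
  then show ?thesis unfolding cut_equiv_def using edges by auto
qed

text \<open>The two assumptions say that the value at a cut agrees with the limit from each side on
  which the cut can be approached. If the approached side has no extremum, values at nearby cuts are
  squeezed towards the extreme extension.\<close>

lemma ext_cut_continuous:
  assumes lower: "\<And>C. C \<in> cuts \<Longrightarrow> has_no_max (fst C) \<Longrightarrow> lam (chi (ext_cut C)) = lam (chi (lower_ext C))"
    and upper: "\<And>C. C \<in> cuts \<Longrightarrow> has_no_min (- fst C) \<Longrightarrow> lam (chi (ext_cut C)) = lam (chi (upper_ext C))"
  shows "continuous_map interval_topology places_top (\<lambda>C. lam (chi (ext_cut C)))"
  unfolding places_top_def
proof (rule continuous_on_generated_topo)
  fix U :: "('f poly fract \<Rightarrow> real option) set" assume "U \<in> range H'"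
  then obtain b where U: "U = H' b" by blast
  define V where "V = {C' \<in> cuts. lam (chi C') \<in> H' b}"
  have V: "cut_nbhd V C'" if "C' \<in> V" for C'
    using F.openin_interval_H'[of b] that unfolding openin_interval_iff V_def by blast
  let ?W = "{C \<in> cuts. lam (chi (ext_cut C)) \<in> H' b}"
  have "openin interval_topology ?W"
    unfolding openin_interval_iff
  proof (intro conjI ballI)
    fix C assume "C \<in> ?W"
    then have C: "C \<in> cuts" and inH: "lam (chi (ext_cut C)) \<in> H' b" by blast+
    have same: "C' \<in> ?W" if "C' \<in> cuts" "fst C' = fst C" for C'
      using cut_eqI[OF that(1) C that(2)] C inH by simp
    show "cut_nbhd ?W C" unfolding cut_nbhd_def
    proof (intro conjI impI)
      assume ne: "fst C \<noteq> {}"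
      show "\<exists>a\<in>fst C. \<forall>C'\<in>cuts. a \<in> fst C' \<and> fst C' \<subseteq> fst C \<longrightarrow> C' \<in> ?W"
      proof (cases "has_no_max (fst C)")
        case True
        then have "lower_ext C \<in> V" unfolding V_def using lower[OF C] inH lower_ext_in_cuts by simp
        note nb = cut_nbhdD(1)[OF V[OF this]]
        have "fst (lower_ext C) \<noteq> {}" using ne mem_lower_ext by blast
        then obtain t where t: "t \<in> fst (lower_ext C)"
          "\<forall>C'\<in>cuts. t \<in> fst C' \<and> fst C' \<subseteq> fst (lower_ext C) \<longrightarrow> C' \<in> V"
          using nb by (elim meta_impE bexE)
        then obtain d where d: "d \<in> fst C" "t \<le> e d" using mem_lower_ext by blast
        have "C' \<in> ?W" if C': "C' \<in> cuts" "d \<in> fst C'" "fst C' \<subseteq> fst C" for C'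
        proof (cases "fst C' = fst C")
          case False
          \<comment> \<open>\<open>x\<close> witnesses that \<open>C'\<close> is strictly smaller
            than \<open>C\<close>, which pushes \<open>ext_cut C'\<close> below
            \<open>lower_ext C\<close> whichever extension it takes.\<close>
          then obtain x where x: "x \<in> fst C" "x \<notin> fst C'" using C' by blast
          have "e d \<in> fst (ext_cut C')" "e x \<notin> fst (ext_cut C')"
            using mem_restrict[OF restrict_ext_cut[OF C'(1)]] C' x by blast+
          then have "ext_cut C' \<in> V"
            by (intro t(2)[rule_format] conjI ext_cut_in_cuts cutsD[OF ext_cut_in_cuts _ d(2)]
                subset_lower_ext[OF ext_cut_in_cuts x(1)])
          then show ?thesis unfolding V_def using C' by blast
        qed (use same C' in blast)
        then show ?thesis using d(1) by blast
      next
        case False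
        \<comment> \<open>With the last element \<open>m\<close> as bound, this half of the
          neighbourhood consists of \<open>C\<close> alone.\<close>
        then obtain m where m: "fst C = {..m}" using not_has_no_max_cut[OF C ne] by blast
        have "C' \<in> ?W" if "C' \<in> cuts" "m \<in> fst C'" "fst C' \<subseteq> fst C" for C'
          using same[OF that(1)] that(3) cutsD[OF that(1,2)] unfolding m by blast
        then show ?thesis using m by blast
      qed
    next
      assume ne: "fst C \<noteq> UNIV"
      show "\<exists>b. b \<notin> fst C \<and> (\<forall>C'\<in>cuts. fst C \<subseteq> fst C' \<and> b \<notin> fst C' \<longrightarrow> C' \<in> ?W)"
      proof (cases "has_no_min (- fst C)")
        case True
        then have "upper_ext C \<in> V" unfolding V_def using upper[OF C] inH upper_ext_in_cuts by simp
        note nb = cut_nbhdD(2)[OF V[OF this]]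
        have "fst (upper_ext C) \<noteq> UNIV" using ne mem_upper_ext by (metis UNIV_I UNIV_eq_I less_irrefl)
        then obtain t where t: "t \<notin> fst (upper_ext C)"
          "\<forall>C'\<in>cuts. fst (upper_ext C) \<subseteq> fst C' \<and> t \<notin> fst C' \<longrightarrow> C' \<in> V"
          using nb by (elim meta_impE exE conjE)
        then obtain d where d: "d \<notin> fst C" "e d \<le> t" using mem_upper_ext by (meson not_less)
        have "C' \<in> ?W" if C': "C' \<in> cuts" "d \<notin> fst C'" "fst C \<subseteq> fst C'" for C'
        proof (cases "fst C' = fst C")
          case False
          then obtain x where x: "x \<notin> fst C" "x \<in> fst C'" using C' by blast
          have "e d \<notin> fst (ext_cut C')" "e x \<in> fst (ext_cut C')"
            using mem_restrict[OF restrict_ext_cut[OF C'(1)]] C' x by blast+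
          then have "t \<notin> fst (ext_cut C')" "fst (upper_ext C) \<subseteq> fst (ext_cut C')"
            using cutsD[OF ext_cut_in_cuts _ d(2)] upper_ext_subset[OF ext_cut_in_cuts x(1)] by blast+
          then have "ext_cut C' \<in> V" by (intro t(2)[rule_format] conjI ext_cut_in_cuts)
          then show ?thesis unfolding V_def using C' by blast
        qed (use same C' in blast)
        then show ?thesis using d(1) by blast
      next
        case False
        then obtain m where m: "fst C = {..<m}" using not_has_no_min_cut[OF C ne] by blast
        have "C' \<in> ?W" if "C' \<in> cuts" "m \<notin> fst C'" "fst C \<subseteq> fst C'" for C'
          using same[OF that(1)] that(3) cut_less_if_mem[OF that(1) _ that(2)] unfolding m by blast
        then show ?thesis using m by blast
      qed
    qed
  qed blast
  moreover have "(\<lambda>C. lam (chi (ext_cut C))) -` U \<inter> topspace interval_topology = ?W"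
    unfolding U topspace_interval_topology by blast
  ultimately show "openin interval_topology ((\<lambda>C. lam (chi (ext_cut C))) -` U \<inter> topspace interval_topology)" by simp
next
  have "\<Union> (range H') = (places :: ('f poly fract \<Rightarrow> real option) set)"
    using topspace_places_top unfolding places_top_def topology_generated_by_topspace .
  then show "(\<lambda>C. lam (chi (ext_cut C))) ` topspace interval_topology \<subseteq> \<Union> (range H')"
    unfolding places_eq_lam_chi[OF F.rc] using ext_cut_in_cuts by blast
qed

text \<open>Well-definedness on equivalence classes permits an arbitrary representative. Continuity
  is tested on cuts through the quotient map, and injectivity follows from the restriction being a
  left inverse.\<close>

theorem admissible_induces_embedding:
  assumes conv: "convex_subgroup (value_group_image e)" and adm: "admissible_cut_map e \<tau>"
  shows "\<exists>\<iota> :: ('r poly fract \<Rightarrow> real option) \<Rightarrow> ('f poly fract \<Rightarrow> real option).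
      (\<forall>C\<in>cuts. \<iota> (lam (chi C)) = lam (chi (\<tau> C))) \<and> inj_on \<iota> places \<and>
      continuous_map places_top places_top \<iota> \<and> (\<forall>\<zeta>\<in>places. res e (\<iota> \<zeta>) = \<zeta>)"
proof -
  define \<iota> :: "('r poly fract \<Rightarrow> real option) \<Rightarrow> ('f poly fract \<Rightarrow> real option)" where
    "\<iota> \<zeta> = lam (chi (\<tau> (SOME C. C \<in> cuts \<and> lam (chi C) = \<zeta>)))" for \<zeta>
  have \<iota>: "\<iota> (lam (chi C)) = lam (chi (\<tau> C))" if C: "C \<in> cuts" for C
  proof -
    have "(SOME C'. C' \<in> cuts \<and> lam (chi C') = lam (chi C)) \<in> cuts \<and>
        lam (chi (SOME C'. C' \<in> cuts \<and> lam (chi C') = lam (chi C))) = lam (chi C)"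
      by (rule someI[of _ C]) (use C in blast)
    then show ?thesis unfolding \<iota>_def using admissible_well_defined[OF adm _ C] by blast
  qed
  have ext: "\<iota> (lam (chi C)) = lam (chi (ext_cut C))" if "C \<in> cuts" for C
    using \<iota>[OF that] admissible_ext_cut[OF conv adm that] by simp
  have res: "res e (\<iota> \<zeta>) = \<zeta>" if "\<zeta> \<in> places" for \<zeta>
    using that ext res_ext_cut unfolding places_eq_lam_chi[OF R.rc] by force
  have "continuous_map interval_topology places_top (\<lambda>C. lam (chi (ext_cut C)))"
    using admissible_place[OF conv adm] admissible_ext_cut[OF conv adm] by (intro ext_cut_continuous) auto
  then have "continuous_map interval_topology places_top (\<iota> \<circ> (\<lambda>C. lam (chi C)))"
    by (rule continuous_map_eq) (simp add: topspace_interval_topology ext)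
  then have "continuous_map places_top places_top \<iota>"
    by (rule continuous_compose_quotient_map[OF R.quotient_map_places])
  moreover have "inj_on \<iota> places" using res by (metis inj_onI)
  ultimately show ?thesis using \<iota> res by blast
qed


section \<open>Continuous sections of the restriction of places\<close>

context
  fixes \<iota> :: "('r poly fract \<Rightarrow> real option) \<Rightarrow> ('f poly fract \<Rightarrow> real option)"
  assumes cont: "continuous_map places_top places_top \<iota>"
    and res: "\<And>\<zeta>. \<zeta> \<in> places \<Longrightarrow> res e (\<iota> \<zeta>) = \<zeta>"
begin

lemma embedding_place_cut:
  assumes C: "C \<in> cuts"
  obtains C' where "C' \<in> cuts" "\<iota> (lam (chi C)) = lam (chi C')" "lam (chi (restrict_cut e C')) = lam (chi C)"
proof -
  have \<zeta>: "lam (chi C) \<in> places" using C places_eq_lam_chi[OF R.rc] by blast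
  then have "\<iota> (lam (chi C)) \<in> places"
    using cont unfolding continuous_map_def topspace_places_top by blast
  then obtain C' where "C' \<in> cuts" "\<iota> (lam (chi C)) = lam (chi C')" using places_eq_lam_chi[OF F.rc] by blast
  moreover from this have "lam (chi (restrict_cut e C')) = lam (chi C)"
    using res[OF \<zeta>] by (simp add: res_place)
  ultimately show thesis using that by blast
qed

lemma openin_embedding_preimage:
  assumes "openin places_top U" shows "openin interval_topology {C \<in> cuts. \<iota> (lam (chi C)) \<in> U}"
proof -
  have "continuous_map interval_topology places_top (\<iota> \<circ> (\<lambda>C. lam (chi C)))"
    by (rule continuous_map_compose[OF quotient_imp_continuous_map[OF R.quotient_map_places] cont])
  from openin_continuous_map_preimage[OF this assms] show ?thesis
    unfolding topspace_interval_topology by simp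
qed

text \<open>A place is the limit of the places at \<open>x\<^sup>+\<close>, for \<open>x\<close> tending to the cut. The lifts of these are
  squeezed towards the extreme extension of the cut.\<close>

lemma embedding_lower:
  assumes C: "C \<in> cuts" and D: "has_no_max (fst C)"
  shows "\<iota> (lam (chi C)) = lam (chi (lower_ext C))"
proof (rule ccontr)
  assume ne: "\<iota> (lam (chi C)) \<noteq> lam (chi (lower_ext C))"
  have "\<iota> (lam (chi C)) \<in> places" "lam (chi (lower_ext C)) \<in> places"
    using embedding_place_cut[OF C] lower_ext_in_cuts places_eq_lam_chi[OF F.rc] by blast+
  then obtain b where b: "\<iota> (lam (chi C)) \<in> H' b" "lam (chi (lower_ext C)) \<in> H' (- b)"
    using places_separated[OF _ _ ne] by blast
  let ?W = "{C \<in> cuts. \<iota> (lam (chi C)) \<in> H' b}" and ?V = "{C \<in> cuts. lam (chi C) \<in> H' (- b)}"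
  have W: "cut_nbhd ?W C" using openin_embedding_preimage[OF openin_H'] C b unfolding openin_interval_iff by blast
  have V: "cut_nbhd ?V (lower_ext C)"
    using F.openin_interval_H' lower_ext_in_cuts b unfolding openin_interval_iff by blast
  have "fst C \<noteq> {}" using D unfolding has_no_max_def by blast
  moreover from this have "fst (lower_ext C) \<noteq> {}" using mem_lower_ext by blast
  ultimately obtain a t where a: "a \<in> fst C" "\<forall>C'\<in>cuts. a \<in> fst C' \<and> fst C' \<subseteq> fst C \<longrightarrow> C' \<in> ?W"
    and t: "t \<in> fst (lower_ext C)" "\<forall>C'\<in>cuts. t \<in> fst C' \<and> fst C' \<subseteq> fst (lower_ext C) \<longrightarrow> C' \<in> ?V"
    using cut_nbhdD(1)[OF W] cut_nbhdD(1)[OF V] by meson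
  obtain d where d: "d \<in> fst C" "t \<le> e d" using t(1) mem_lower_ext by blast
  have "max a d \<in> fst C" using a(1) d(1) by (simp add: max_def)
  \<comment> \<open>The lift of the place at \<open>x\<close> may restrict to \<open>{..x}\<close>
    or to \<open>{..<x}\<close>. Taking \<open>x\<close> above \<open>d\<close> and a further
    \<open>x'\<close> above \<open>x\<close> makes \<open>d\<close> lie below and \<open>x'\<close>
    above the lifted cut in either case.\<close>
  then obtain x x' where x: "x \<in> fst C" "max a d < x" and x': "x' \<in> fst C" "x < x'"
    using D unfolding has_no_max_def by meson
  have "fst (le_cut x) = {..x}" by (simp add: le_cut_def)
  moreover have "{..x} \<subseteq> fst C" using cutsD[OF C x(1)] by blast
  ultimately have "le_cut x \<in> ?W" using a(2) lt_le_cut_in_cuts(2)[of x] x(2) by auto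
  then have inb: "\<iota> (lam (chi (le_cut x))) \<in> H' b" by blast
  obtain C' where C': "C' \<in> cuts" "\<iota> (lam (chi (le_cut x))) = lam (chi C')"
      "lam (chi (restrict_cut e C')) = lam (chi (le_cut x))"
    using embedding_place_cut[OF lt_le_cut_in_cuts(2)[of x]] by blast
  have "fst (restrict_cut e C') = {..x} \<or> fst (restrict_cut e C') = {..<x}"
    using R.le_cut_equal_places[OF restrict_cut_in_cuts[OF C'(1)] C'(3)] .
  then have "d \<in> fst (restrict_cut e C') \<and> x' \<notin> fst (restrict_cut e C')"
    by (elim disjE) (use x(2) x'(2) in simp_all)
  then have mem: "e d \<in> fst C'" "e x' \<notin> fst C'" unfolding fst_restrict_cut by blast+
  have "C' \<in> ?V"
    by (rule t(2)[rule_format, OF C'(1)]) (intro conjI cutsD[OF C'(1) mem(1) d(2)] subset_lower_ext[OF C'(1) x'(1) mem(2)])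
  then have "lam (chi C') \<in> H' b \<inter> H' (- b)" using inb unfolding C'(2) by blast
  then show False unfolding H'_disjoint by blast
qed

lemma embedding_upper:
  assumes C: "C \<in> cuts" and E: "has_no_min (- fst C)"
  shows "\<iota> (lam (chi C)) = lam (chi (upper_ext C))"
proof (rule ccontr)
  assume ne: "\<iota> (lam (chi C)) \<noteq> lam (chi (upper_ext C))"
  have "\<iota> (lam (chi C)) \<in> places" "lam (chi (upper_ext C)) \<in> places"
    using embedding_place_cut[OF C] upper_ext_in_cuts places_eq_lam_chi[OF F.rc] by blast+
  then obtain b where b: "\<iota> (lam (chi C)) \<in> H' b" "lam (chi (upper_ext C)) \<in> H' (- b)"
    using places_separated[OF _ _ ne] by blast
  let ?W = "{C \<in> cuts. \<iota> (lam (chi C)) \<in> H' b}" and ?V = "{C \<in> cuts. lam (chi C) \<in> H' (- b)}"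
  have W: "cut_nbhd ?W C" using openin_embedding_preimage[OF openin_H'] C b unfolding openin_interval_iff by blast
  have V: "cut_nbhd ?V (upper_ext C)"
    using F.openin_interval_H' upper_ext_in_cuts b unfolding openin_interval_iff by blast
  obtain z where z: "z \<notin> fst C" using E unfolding has_no_min_def by blast
  then have "e z \<notin> fst (upper_ext C)" using mem_upper_ext by blast
  then have "fst C \<noteq> UNIV" "fst (upper_ext C) \<noteq> UNIV" using z by blast+
  then obtain a t where a: "a \<notin> fst C" "\<forall>C'\<in>cuts. fst C \<subseteq> fst C' \<and> a \<notin> fst C' \<longrightarrow> C' \<in> ?W"
    and t: "t \<notin> fst (upper_ext C)" "\<forall>C'\<in>cuts. fst (upper_ext C) \<subseteq> fst C' \<and> t \<notin> fst C' \<longrightarrow> C' \<in> ?V"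
    using cut_nbhdD(2)[OF W] cut_nbhdD(2)[OF V] by meson
  obtain d where d: "d \<notin> fst C" "e d \<le> t" using t(1) mem_upper_ext by (meson not_less)
  have "min a d \<in> - fst C" using a(1) d(1) by (simp add: min_def)
  then obtain x x' where x: "x \<notin> fst C" "x < min a d" and x': "x' \<notin> fst C" "x' < x"
    using E unfolding has_no_min_def by (meson ComplD)
  have "fst (le_cut x) = {..x}" by (simp add: le_cut_def)
  moreover have "fst C \<subseteq> {..x}" using cut_less_if_mem[OF C _ x(1)] by force
  ultimately have "le_cut x \<in> ?W" using a(2) lt_le_cut_in_cuts(2)[of x] x(2) by auto
  then have inb: "\<iota> (lam (chi (le_cut x))) \<in> H' b" by blast
  obtain C' where C': "C' \<in> cuts" "\<iota> (lam (chi (le_cut x))) = lam (chi C')"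
      "lam (chi (restrict_cut e C')) = lam (chi (le_cut x))"
    using embedding_place_cut[OF lt_le_cut_in_cuts(2)[of x]] by blast
  have "fst (restrict_cut e C') = {..x} \<or> fst (restrict_cut e C') = {..<x}"
    using R.le_cut_equal_places[OF restrict_cut_in_cuts[OF C'(1)] C'(3)] .
  then have "d \<notin> fst (restrict_cut e C') \<and> x' \<in> fst (restrict_cut e C')"
    by (elim disjE) (use x(2) x'(2) in simp_all)
  then have mem: "e d \<notin> fst C'" "e x' \<in> fst C'" unfolding fst_restrict_cut by blast+
  have "t \<notin> fst C'" using cutsD[OF C'(1) _ d(2)] mem(1) by blast
  then have "C' \<in> ?V"
    by (intro t(2)[rule_format, OF C'(1)] conjI upper_ext_subset[OF C'(1) x'(1) mem(2)])
  then have "lam (chi C') \<in> H' b \<inter> H' (- b)" using inb unfolding C'(2) by blast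
  then show False unfolding H'_disjoint by blast
qed

text \<open>A continuous section is unique, since \<open>ext_cut\<close> does not depend on
  it.\<close>

lemma embedding_ext_cut: "C \<in> cuts \<Longrightarrow> \<iota> (lam (chi C)) = lam (chi (ext_cut C))"
  using embedding_lower[of C] embedding_upper[of C] cut_no_max_or_no_min[of C] unfolding ext_cut_def by metis

text \<open>An open full set is the preimage of an open set of places. Its preimage under
  \<open>ext_cut\<close> is thus also its preimage under the passage to places followed by
  \<open>\<iota>\<close>, and such a set is both open and full.\<close>

lemma ext_cut_full_continuous: "continuous_map full_topology full_topology ext_cut"
proof -
  have "continuous_map full_topology (topology_generated_by {U. openin interval_topology U \<and> full U}) ext_cut"
  proof (rule continuous_on_generated_topo)
    fix U :: "('f set \<times> 'f set) set" assume "U \<in> {U. openin interval_topology U \<and> full U}"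
    then have U: "openin interval_topology U" "full U" by blast+
    let ?V = "{C \<in> cuts. ext_cut C \<in> U}"
    have V: "?V = {C \<in> cuts. \<iota> (lam (chi C)) \<in> (\<lambda>C. lam (chi C)) ` U}"
      by (rule Collect_cong) (metis embedding_ext_cut F.openin_places_image_full(2)[OF U ext_cut_in_cuts])
    have "openin interval_topology ?V"
      unfolding V by (rule openin_embedding_preimage[OF F.openin_places_image_full(1)[OF U]])
    moreover have "full ?V"
      unfolding V R.full_iff by auto
    ultimately have "openin full_topology ?V"
      unfolding full_topology_def by (intro topology_generated_by_Basis) blast
    moreover have "ext_cut -` U \<inter> topspace full_topology = ?V"
      unfolding R.topspace_full_topology by blast
    ultimately show "openin full_topology (ext_cut -` U \<inter> topspace full_topology)" by simp
  next
    have "\<Union> {U. openin interval_topology U \<and> full U} = (cuts :: ('f set \<times> 'f set) set)"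
      using F.topspace_full_topology unfolding full_topology_def topology_generated_by_topspace .
    then show "ext_cut ` topspace full_topology \<subseteq> \<Union> {U. openin interval_topology U \<and> full U}"
      using ext_cut_in_cuts by blast
  qed
  then show ?thesis unfolding full_topology_def[where 'a = 'f] .
qed

text \<open>An element \<open>x\<close> with value strictly between values of \<open>R\<close>, but not in \<open>vR\<close>, would produce a cut whose two
  extreme extensions carry the same place although the gap between them contains \<open>x\<close> and \<open>2 x\<close>, but not \<open>0\<close>.\<close>

lemma embedding_value_between:
  assumes a: "a \<noteq> 0" "\<bar>x\<bar> \<le> of_nat n * \<bar>e a\<bar>" and b: "b \<noteq> 0" "\<bar>e b\<bar> \<le> of_nat m * \<bar>x\<bar>"
  shows "\<exists>c. c \<noteq> 0 \<and> cval x = cval (e c)"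
proof (rule ccontr)
  assume no: "\<not> ?thesis"
  define \<xi> where "\<xi> = \<bar>x\<bar>"
  have "e b \<noteq> 0" using b e_eq_0_iff by blast
  then have pos_x: "0 < \<xi>" using b unfolding \<xi>_def by (auto simp: mult_le_0_iff order.strict_iff_order)
  \<comment> \<open>For no positive \<open>c\<close> are \<open>\<xi>\<close> and \<open>e c\<close>
    bounded by integer multiples of each other, as their values would coincide. Hence a bound up to
    an integer factor sharpens to a strict inequality, in \<open>half\<close> and
    \<open>double\<close>; these exclude extrema on both sides of the cut below.\<close>
  have gap: "\<not> (\<xi> \<le> of_nat k * e c \<and> e c \<le> of_nat l * \<xi>)" if "0 < c" for c and k l :: nat
  proof
    assume le: "\<xi> \<le> of_nat k * e c \<and> e c \<le> of_nat l * \<xi>"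
    have "0 < e c" using e_less_iff[of 0 c] that by (simp add: e_0)
    then have abs_ec: "\<bar>e c\<bar> = e c" by simp
    have "\<bar>e c\<bar> \<le> of_nat l * \<bar>x\<bar>" unfolding abs_ec using le unfolding \<xi>_def by blast
    moreover have "\<bar>x\<bar> \<le> of_nat k * \<bar>e c\<bar>" unfolding abs_ec using le unfolding \<xi>_def by blast
    moreover have "x \<noteq> 0" using pos_x unfolding \<xi>_def by simp
    ultimately have "cval x = cval (e c)" by (metis cval_eqI)
    moreover have "c \<noteq> 0" using that by simp
    ultimately show False using no by (metis (no_types))
  qed
  have half: "e d < \<xi>" if "0 < d" "e d \<le> of_nat l * \<xi>" for d l
  proof (rule ccontr)
    assume "\<not> e d < \<xi>"
    then show False using gap[OF that(1), of 1 l] that(2) by simp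
  qed
  have double: "\<xi> < e d" if "0 < d" "\<xi> \<le> of_nat k * e d" for d k
  proof (rule ccontr)
    assume "\<not> \<xi> < e d"
    then show False using gap[OF that(1), of k 1] that(2) by simp
  qed
  define C where "C = ({d. e d < \<xi>}, - {d. e d < \<xi>})"
  have C: "C \<in> cuts" unfolding C_def
    by (rule cutI) (metis e_le_iff le_less_trans mem_Collect_eq)
  have mem: "d \<in> fst C \<longleftrightarrow> e d < \<xi>" for d unfolding C_def by simp
  have bpos: "0 < \<bar>b\<bar>" "e \<bar>b\<bar> < \<xi>" using b half[of "\<bar>b\<bar>" m] unfolding \<xi>_def by (auto simp: e_abs)
  have D: "has_no_max (fst C)" unfolding has_no_max_def
  proof (intro conjI ballI)
    show "fst C \<noteq> {}" using bpos mem by blast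
    fix d assume d: "d \<in> fst C"
    show "\<exists>d'\<in>fst C. d < d'"
    proof (cases "0 < d")
      case True
      have "e (2 * d) < \<xi>" using half[of "2 * d" 2] d True unfolding mem by (simp add: e_mult e_numeral)
      then show ?thesis using True mem by (intro bexI[of _ "2 * d"]) auto
    next
      case False
      then show ?thesis using bpos mem by (intro bexI[of _ "\<bar>b\<bar>"]) auto
    qed
  qed
  have pos: "0 < d" if "d \<notin> fst C" for d
    using that pos_x e_less_iff[of 0 d] unfolding mem by (simp add: e_0)
  have halfE: "d / 2 \<notin> fst C" if "d \<notin> fst C" for d
  proof -
    have "\<xi> < e (d / 2)" using double[of "d / 2" 2] pos[OF that] that unfolding mem by (simp add: e_divide e_numeral)
    then show ?thesis unfolding mem by simp
  qed
  have E: "has_no_min (- fst C)" unfolding has_no_min_def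
  proof (intro conjI ballI)
    have apos: "0 < of_nat (Suc n) * \<bar>a\<bar>" using a by (intro mult_pos_pos) (simp_all del: of_nat_Suc)
    have "\<xi> \<le> of_nat (Suc n) * e \<bar>a\<bar>" using a unfolding \<xi>_def by (simp add: e_abs algebra_simps add_increasing)
    then have "of_nat (Suc n) * \<bar>a\<bar> \<notin> fst C" unfolding mem by (simp add: e_mult e_of_nat del: of_nat_Suc)
    then show "- fst C \<noteq> {}" by blast
    fix d assume d: "d \<in> - fst C"
    then show "\<exists>b'\<in>- fst C. b' < d" using halfE[of d] pos[of d] by (intro bexI[of _ "d / 2"]) auto
  qed
  have "lam (chi (lower_ext C)) = lam (chi (upper_ext C))"
    using embedding_lower[OF C D] embedding_upper[OF C E] by simp
  then have refl: "reflection_closed (fst (upper_ext C) - fst (lower_ext C))"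
    using F.equal_places_iff[OF lower_ext_in_cuts upper_ext_in_cuts lower_ext_subset_upper_ext[OF C]] by blast
  have low: "t \<notin> fst (lower_ext C)" if "\<xi> \<le> t" for t
    using that unfolding mem_lower_ext by (auto simp: mem)
  \<comment> \<open>Two halvings are used because one gives only a weak inequality, and membership
    in \<open>upper_ext\<close> is strict.\<close>
  have "2 * \<xi> < e d" if "d \<notin> fst C" for d
  proof -
    have "\<xi> \<le> e (d / 2 / 2)" using halfE[OF halfE[OF that]] unfolding mem by simp
    then show ?thesis using pos_x by (simp add: e_divide e_numeral)
  qed
  then have up: "t \<in> fst (upper_ext C)" if "t \<le> 2 * \<xi>" for t
    unfolding mem_upper_ext using that by (meson le_less_trans)
  \<comment> \<open>This is \<open>2 * \<xi>\<close> reflected at \<open>\<xi>\<close>, left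
    unsimplified to match \<open>reflection_closedD\<close>.\<close>
  have "2 * \<xi> - 2 * \<xi> \<in> fst (upper_ext C) - fst (lower_ext C)"
    by (rule reflection_closedD(1)[OF refl]) (use low up pos_x in auto)
  moreover have "0 \<in> fst (lower_ext C)"
    unfolding mem_lower_ext using bpos mem by (intro bexI[of _ "\<bar>b\<bar>"]) (auto simp: e_abs)
  ultimately show False by simp
qed

lemma embedding_convex: "convex_subgroup (value_group_image e)"
  unfolding convex_subgroup_def
proof (intro conjI allI impI ballI)
  show "value_group_image e \<subseteq> value_group"
    unfolding value_group_image_def value_group_def using e_eq_0_iff by blast
  show "cval 1 \<in> value_group_image e"
    unfolding value_group_image_def using e_1 by (intro CollectI exI[of _ 1]) simp
next
  fix x y :: 'f assume "x \<noteq> 0" "y \<noteq> 0" "cval x \<in> value_group_image e" "cval y \<in> value_group_image e"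
  then obtain a b where ab: "cval x = cval (e a)" "a \<noteq> 0" "cval y = cval (e b)" "b \<noteq> 0"
    unfolding value_group_image_def by blast
  obtain u w where u: "u \<in> cval_units" "e a = x * u" and w: "w \<in> cval_units" "e b = y * w"
    using ab(1,3) unfolding cval_eq_iff by blast
  have "e (a * b) = x * y * (u * w)" by (simp add: e_mult u w)
  then have "cval (x * y) = cval (e (a * b))" unfolding cval_eq_iff using cval_units_mult[OF u(1) w(1)] by blast
  then show "cval (x * y) \<in> value_group_image e"
    unfolding value_group_image_def using ab by (intro CollectI exI[of _ "a * b"]) simp
  have "e (inverse a) = inverse x * inverse u" by (simp add: e_inverse u)
  then have "cval (inverse x) = cval (e (inverse a))" unfolding cval_eq_iff using cval_units_inverse[OF u(1)] by blast
  then show "cval (inverse x) \<in> value_group_image e"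
    unfolding value_group_image_def using ab by (intro CollectI exI[of _ "inverse a"]) simp
next
  fix g h1 h2 :: "'f set" assume g: "g \<in> value_group" and h: "h1 \<in> value_group_image e" "h2 \<in> value_group_image e"
    and le: "val_le h1 g \<and> val_le g h2"
  obtain x where x: "g = cval x" "x \<noteq> 0" using g unfolding value_group_def by blast
  obtain a b where ab: "h1 = cval (e a)" "a \<noteq> 0" "h2 = cval (e b)" "b \<noteq> 0"
    using h unfolding value_group_image_def by blast
  have "e a \<noteq> 0" "e b \<noteq> 0" using ab e_eq_0_iff by blast+
  then obtain m n :: nat where "\<bar>x\<bar> \<le> of_nat n * \<bar>e a\<bar>" "\<bar>e b\<bar> \<le> of_nat m * \<bar>x\<bar>"
    using le x(2) unfolding x(1) ab by (auto simp: val_le_cval_iff)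
  then have "\<exists>c. c \<noteq> 0 \<and> cval x = cval (e c)" using embedding_value_between ab by blast
  then show "g \<in> value_group_image e" unfolding x(1) value_group_image_def by blast
qed

end

end

theorem theorem5p1:
  fixes e :: "'r::linordered_field \<Rightarrow> 'f::linordered_field"
  assumes "real_closed TYPE('r)" and "real_closed TYPE('f)"
    and "field_hom e"
  shows
   "(convex_subgroup (value_group_image e) \<longrightarrow>
      (\<forall>\<tau>. admissible_cut_map e \<tau> \<longrightarrow>
         (\<forall>\<zeta>\<in>(places :: ('r poly fract \<Rightarrow> real option) set). \<exists>C\<in>cuts. \<zeta> = lam (chi C)) \<and>
         (\<forall>C\<in>cuts. \<forall>C'\<in>cuts. lam (chi C) = lam (chi C') \<longrightarrow>
              lam (chi (\<tau> C)) = lam (chi (\<tau> C'))) \<and>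
         (\<forall>\<tau>'. admissible_cut_map e \<tau>' \<longrightarrow>
              (\<forall>C\<in>cuts. lam (chi (\<tau>' C)) = lam (chi (\<tau> C)))) \<and>
         (\<exists>\<iota> :: ('r poly fract \<Rightarrow> real option) \<Rightarrow> ('f poly fract \<Rightarrow> real option).
              (\<forall>C\<in>cuts. \<iota> (lam (chi C)) = lam (chi (\<tau> C))) \<and>
              inj_on \<iota> places \<and>
              continuous_map places_top places_top \<iota> \<and>
              (\<forall>\<zeta>\<in>places. res e (\<iota> \<zeta>) = \<zeta>))))
    \<and>
    (\<forall>\<iota> :: ('r poly fract \<Rightarrow> real option) \<Rightarrow> ('f poly fract \<Rightarrow> real option).
       continuous_map places_top places_top \<iota> \<and> inj_on \<iota> places \<and>
       (\<forall>\<zeta>\<in>places. res e (\<iota> \<zeta>) = \<zeta>) \<longrightarrow>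
       (\<exists>\<tau>. \<tau> \<in> cuts \<rightarrow> cuts \<and> inj_on \<tau> cuts \<and>
            continuous_map full_topology full_topology \<tau> \<and>
            (\<forall>C\<in>cuts. restrict_cut e (\<tau> C) = C) \<and>
            (\<forall>C\<in>cuts. lam (chi (\<tau> C)) = \<iota> (lam (chi C))))
       \<and> convex_subgroup (value_group_image e))"
proof -
  interpret rcf_extension "TYPE('r)" "TYPE('f)" e using assms by unfold_locales
  show ?thesis
  proof (intro conjI allI impI; (elim conjE)?)
    show "\<forall>\<zeta>\<in>(places :: ('r poly fract \<Rightarrow> real option) set). \<exists>C\<in>cuts. \<zeta> = lam (chi C)"
      unfolding places_eq_lam_chi[OF R.rc] by blast
  next
    fix \<tau> assume "admissible_cut_map e \<tau>"
    then show "\<forall>C\<in>cuts. \<forall>C'\<in>cuts. lam (chi C) = lam (chi C') \<longrightarrow> lam (chi (\<tau> C)) = lam (chi (\<tau> C'))"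
      using admissible_well_defined by blast
  next
    fix \<tau> \<tau>' assume "convex_subgroup (value_group_image e)" "admissible_cut_map e \<tau>" "admissible_cut_map e \<tau>'"
    then show "\<forall>C\<in>cuts. lam (chi (\<tau>' C)) = lam (chi (\<tau> C))" using admissible_ext_cut by simp
  next
    fix \<tau> assume "convex_subgroup (value_group_image e)" "admissible_cut_map e \<tau>"
    then show "\<exists>\<iota> :: ('r poly fract \<Rightarrow> real option) \<Rightarrow> ('f poly fract \<Rightarrow> real option).
        (\<forall>C\<in>cuts. \<iota> (lam (chi C)) = lam (chi (\<tau> C))) \<and> inj_on \<iota> places \<and>
        continuous_map places_top places_top \<iota> \<and> (\<forall>\<zeta>\<in>places. res e (\<iota> \<zeta>) = \<zeta>)"
      by (rule admissible_induces_embedding)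
  next
    fix \<iota> :: "('r poly fract \<Rightarrow> real option) \<Rightarrow> ('f poly fract \<Rightarrow> real option)"
    assume cont: "continuous_map places_top places_top \<iota>" and res: "\<forall>\<zeta>\<in>places. res e (\<iota> \<zeta>) = \<zeta>"
    have "inj_on ext_cut cuts" using restrict_ext_cut by (metis inj_onI)
    then show "\<exists>\<tau>. \<tau> \<in> cuts \<rightarrow> cuts \<and> inj_on \<tau> cuts \<and> continuous_map full_topology full_topology \<tau> \<and>
        (\<forall>C\<in>cuts. restrict_cut e (\<tau> C) = C) \<and> (\<forall>C\<in>cuts. lam (chi (\<tau> C)) = \<iota> (lam (chi C)))"
      using ext_cut_in_cuts restrict_ext_cut ext_cut_full_continuous[OF cont] embedding_ext_cut[OF cont] res
      by (intro exI[of _ ext_cut]) auto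
    show "convex_subgroup (value_group_image e)" using embedding_convex[OF cont] res by blast
  qed
qed

end
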